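(* Let $E/\mathbb{Q}$ be an elliptic curve with conductor $N_E$ and let $K = \mathbb{Q}(\sqrt{d})$, with $d$ a square-free integer, be a quadratic number field with $E_\mathrm{tors}(\mathbb{Q}) \neq E_\mathrm{tors}(K)$. If $p$ is a prime with $p \mid d$, then either $p \mid N_E$ or $p = 3$.
   Context: $E_\mathrm{tors}(F)$ denotes the torsion subgroup of $E(F)$. *)

theory Defs
  imports
    Complex_Main
    "HOL-Algebra.Algebra"
    "HOL-Algebra.Algebraic_Closure_Type"
    "HOL-Computational_Algebra.Computational_Algebra"
begin

section \<open>Weierstrass equations\<close>

text \<open>
  The equation \<open>y\<^sup>2 + a\<^sub>1 x y + a\<^sub>3 y = x\<^sup>3 + a\<^sub>2 x\<^sup>2 + a\<^sub>4 x + a\<^sub>6\<close>.  An elliptic curve over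
  the rationals is represented by such an equation with rational coefficients and nonzero
  discriminant.
\<close>

datatype 'a weierstrass =
  Weierstrass (a1: 'a) (a2: 'a) (a3: 'a) (a4: 'a) (a6: 'a)

definition b2 :: "'a::field weierstrass \<Rightarrow> 'a" where
  "b2 W = a1 W ^ 2 + 4 * a2 W"

definition b4 :: "'a::field weierstrass \<Rightarrow> 'a" where
  "b4 W = 2 * a4 W + a1 W * a3 W"

definition b6 :: "'a::field weierstrass \<Rightarrow> 'a" where
  "b6 W = a3 W ^ 2 + 4 * a6 W"

definition b8 :: "'a::field weierstrass \<Rightarrow> 'a" where
  "b8 W = a1 W ^ 2 * a6 W + 4 * a2 W * a6 W - a1 W * a3 W * a4 W + a2 W * a3 W ^ 2 - a4 W ^ 2"

definition c4 :: "'a::field weierstrass \<Rightarrow> 'a" where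
  "c4 W = b2 W ^ 2 - 24 * b4 W"

definition disc :: "'a::field weierstrass \<Rightarrow> 'a" where
  "disc W = - (b2 W ^ 2) * b8 W - 8 * b4 W ^ 3 - 27 * b6 W ^ 2 + 9 * b2 W * b4 W * b6 W"

definition elliptic :: "'a::field weierstrass \<Rightarrow> bool" where
  "elliptic W \<longleftrightarrow> disc W \<noteq> 0"

text \<open>The substitution \<open>x = u\<^sup>2 x' + r\<close>, \<open>y = u\<^sup>3 y' + u\<^sup>2 s x' + t\<close>.\<close>

definition change_vars :: "'a::field \<Rightarrow> 'a \<Rightarrow> 'a \<Rightarrow> 'a \<Rightarrow> 'a weierstrass \<Rightarrow> 'a weierstrass" where
  "change_vars u r s t W = Weierstrass
     ((a1 W + 2 * s) / u)
     ((a2 W - s * a1 W + 3 * r - s ^ 2) / u ^ 2)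
     ((a3 W + r * a1 W + 2 * t) / u ^ 3)
     ((a4 W - s * a3 W + 2 * r * a2 W - (t + r * s) * a1 W + 3 * r ^ 2 - 2 * s * t) / u ^ 4)
     ((a6 W + r * a4 W + r ^ 2 * a2 W + r ^ 3 - t * a3 W - t ^ 2 - r * t * a1 W) / u ^ 6)"

definition isomorphic :: "'a::field weierstrass \<Rightarrow> 'a weierstrass \<Rightarrow> bool" where
  "isomorphic W W' \<longleftrightarrow> (\<exists>u r s t. u \<noteq> 0 \<and> W' = change_vars u r s t W)"


section \<open>The Mordell--Weil group\<close>

datatype 'a point = Infinity | Affine 'a 'a

fun on_curve :: "'a::field weierstrass \<Rightarrow> 'a point \<Rightarrow> bool" where
  "on_curve W Infinity \<longleftrightarrow> True"
| "on_curve W (Affine x y) \<longleftrightarrow>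
     y ^ 2 + a1 W * x * y + a3 W * y = x ^ 3 + a2 W * x ^ 2 + a4 W * x + a6 W"

text \<open>
  The chord-tangent law; \<open>m\<close> is the slope of the line through the two points (the tangent
  if they coincide), and \<open>x\<^sub>1 = x\<^sub>2\<close>, \<open>y\<^sub>1 + y\<^sub>2 + a\<^sub>1 x\<^sub>1 + a\<^sub>3 = 0\<close> says that they are opposite.
\<close>

fun add_point :: "'a::field weierstrass \<Rightarrow> 'a point \<Rightarrow> 'a point \<Rightarrow> 'a point" where
  "add_point W Infinity Q = Q"
| "add_point W P Infinity = P"
| "add_point W (Affine x1 y1) (Affine x2 y2) =
     (if x1 = x2 \<and> y1 + y2 + a1 W * x1 + a3 W = 0 then Infinity
      else
        let m = (if x1 = x2
                 then (3 * x1 ^ 2 + 2 * a2 W * x1 + a4 W - a1 W * y1) / (2 * y1 + a1 W * x1 + a3 W)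
                 else (y2 - y1) / (x2 - x1));
            x3 = m ^ 2 + a1 W * m - a2 W - x1 - x2
        in Affine x3 (- (m + a1 W) * x3 - (y1 - m * x1) - a3 W))"

text \<open>
  \<open>E(F)\<close> for a subfield \<open>F\<close> of the complex numbers, in multiplicative notation.  All these
  groups consist of points with complex coordinates, so that \<open>E(F) \<subseteq> E(F')\<close> for \<open>F \<subseteq> F'\<close>.
\<close>

definition points_over :: "rat weierstrass \<Rightarrow> complex set \<Rightarrow> complex point monoid" where
  "points_over W F =
     \<lparr> carrier = {P. on_curve (map_weierstrass of_rat W) P \<and> set_point P \<subseteq> F},
       monoid.mult = add_point (map_weierstrass of_rat W),
       one = Infinity \<rparr>"

definition torsion :: "('a, 'b) monoid_scheme \<Rightarrow> 'a set" where
  "torsion G = {x \<in> carrier G. \<exists>n::nat. n > 0 \<and> x [^]\<^bsub>G\<^esub> n = \<one>\<^bsub>G\<^esub>}"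

definition E_tors :: "rat weierstrass \<Rightarrow> complex set \<Rightarrow> complex point set" where
  "E_tors W F = torsion (points_over W F)"


section \<open>Subfields of the complex numbers\<close>

text \<open>\<open>\<rat>(S)\<close>, the prime field being contained in every generated subfield.\<close>

definition rat_adjoin :: "complex set \<Rightarrow> complex set" where
  "rat_adjoin S = generate_field ring_of_type_algebra S"

definition quadratic_field :: "int \<Rightarrow> complex set" where
  "quadratic_field d = rat_adjoin {csqrt (of_int d)}"

definition subring_of :: "complex set \<Rightarrow> complex ring" where
  "subring_of S = ring_of_type_algebra\<lparr>carrier := S\<rparr>"

text \<open>Field automorphisms; those of a field of characteristic 0 fix the rationals.\<close>

definition galois_group :: "complex set \<Rightarrow> (complex \<Rightarrow> complex) set" where
  "galois_group L = {\<sigma> \<in> extensional L. \<sigma> \<in> ring_iso (subring_of L) (subring_of L)}"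

definition integers_of :: "complex set \<Rightarrow> complex ring" where
  "integers_of L = subring_of {x \<in> L. algebraic_int x}"

text \<open>
  The ramification groups \<open>G\<^sub>i\<close> in lower numbering of a prime \<open>\<PP>\<close> of \<open>L\<close>.  The condition
  forces \<open>\<sigma>\<close> to fix \<open>\<PP>\<close>, so that these are the ramification groups of the completion at \<open>\<PP>\<close>.
\<close>

definition ramification_group :: "complex set \<Rightarrow> complex set \<Rightarrow> nat \<Rightarrow> (complex \<Rightarrow> complex) set" where
  "ramification_group L \<PP> i =
     {\<sigma> \<in> galois_group L. \<forall>x \<in> carrier (integers_of L).
        \<sigma> x - x \<in> \<PP> [^]\<^bsub>ideals_set (integers_of L)\<^esub> Suc i}"


section \<open>Reduction types\<close>

definition p_integral :: "nat \<Rightarrow> rat \<Rightarrow> bool" where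
  "p_integral p x \<longleftrightarrow> \<not> int p dvd snd (quotient_of x)"

text \<open>The \<open>p\<close>-adic valuation of a nonzero \<open>p\<close>-integral rational number.\<close>

definition p_val :: "nat \<Rightarrow> rat \<Rightarrow> nat" where
  "p_val p x = multiplicity (int p) (fst (quotient_of x))"

text \<open>For \<open>p\<close>-integral \<open>x\<close>: its image in the residue field vanishes (in particular for \<open>x = 0\<close>).\<close>

definition zero_mod :: "nat \<Rightarrow> rat \<Rightarrow> bool" where
  "zero_mod p x \<longleftrightarrow> int p dvd fst (quotient_of x)"

definition p_integral_model :: "nat \<Rightarrow> rat weierstrass \<Rightarrow> rat weierstrass \<Rightarrow> bool" where
  "p_integral_model p W W' \<longleftrightarrow> isomorphic W W' \<and> (\<forall>a \<in> set_weierstrass W'. p_integral p a)"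

definition minimal_model :: "nat \<Rightarrow> rat weierstrass \<Rightarrow> rat weierstrass \<Rightarrow> bool" where
  "minimal_model p W W' \<longleftrightarrow> p_integral_model p W W' \<and>
     (\<forall>W''. p_integral_model p W W'' \<longrightarrow> p_val p (disc W') \<le> p_val p (disc W''))"

text \<open>
  The reduction of a \<open>p\<close>-minimal equation is nonsingular if and only if the discriminant is a
  \<open>p\<close>-adic unit; otherwise its singular point is a node if \<open>c\<^sub>4\<close> is a unit and a cusp if not.
\<close>

definition good_reduction :: "nat \<Rightarrow> rat weierstrass \<Rightarrow> bool" where
  "good_reduction p W \<longleftrightarrow> (\<exists>W'. minimal_model p W W' \<and> \<not> zero_mod p (disc W'))"

definition multiplicative_reduction :: "nat \<Rightarrow> rat weierstrass \<Rightarrow> bool" where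
  "multiplicative_reduction p W \<longleftrightarrow>
     (\<exists>W'. minimal_model p W W' \<and> zero_mod p (disc W') \<and> \<not> zero_mod p (c4 W'))"


section \<open>The conductor\<close>

text \<open>The \<open>l\<close>-torsion \<open>E[l]\<close>; its points automatically have algebraic coordinates.\<close>

definition l_torsion :: "rat weierstrass \<Rightarrow> nat \<Rightarrow> complex point set" where
  "l_torsion W l = {P \<in> carrier (points_over W UNIV).
     P [^]\<^bsub>points_over W UNIV\<^esub> l = \<one>\<^bsub>points_over W UNIV\<^esub>}"

definition torsion_field :: "rat weierstrass \<Rightarrow> nat \<Rightarrow> complex set" where
  "torsion_field W l = rat_adjoin (\<Union>P \<in> l_torsion W l. set_point P)"

definition l_torsion_fixed :: "rat weierstrass \<Rightarrow> nat \<Rightarrow> (complex \<Rightarrow> complex) set \<Rightarrow> complex point set"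
  where "l_torsion_fixed W l H = {P \<in> l_torsion W l. \<forall>\<sigma> \<in> H. map_point \<sigma> P = P}"

text \<open>
  The wild part of the conductor exponent,
  \[ \delta = \sum_{i \ge 1} \frac{|G_i|}{|G_0|} \dim_{\mathbf{F}_l} (E[l] / E[l]^{G_i}), \]
  where \<open>G\<^sub>i\<close> are the ramification groups of \<open>\<rat>(E[l])\<close> at a prime \<open>\<PP>\<close> above \<open>p\<close>, and
  \<open>l \<noteq> p\<close> is prime.  All but finitely many summands vanish, as \<open>Sum_any\<close> requires.  The dimension is the exponent
  of \<open>l\<close> in the order of the quotient.
\<close>

definition wild_part :: "rat weierstrass \<Rightarrow> nat \<Rightarrow> complex set \<Rightarrow> real" where
  "wild_part W l \<PP> = Sum_any (\<lambda>i. let G = ramification_group (torsion_field W l) \<PP> in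
     real (card (G (Suc i))) / real (card (G 0)) *
     real (multiplicity l (card (l_torsion W l) div card (l_torsion_fixed W l (G (Suc i))))))"

text \<open>
  The value does not depend on \<open>l\<close> and \<open>\<PP>\<close>, and it is a nonnegative integer, so rounding
  down only changes the type.
\<close>

definition wild_exponent :: "nat \<Rightarrow> rat weierstrass \<Rightarrow> nat" where
  "wild_exponent p W =
     (let l = (LEAST l. Factorial_Ring.prime l \<and> l \<noteq> p);
          \<PP> = (SOME \<PP>. primeideal \<PP> (integers_of (torsion_field W l)) \<and> of_nat p \<in> \<PP>)
      in nat \<lfloor>wild_part W l \<PP>\<rfloor>)"

definition conductor_exponent :: "nat \<Rightarrow> rat weierstrass \<Rightarrow> nat" where
  "conductor_exponent p W =
     (if good_reduction p W then 0
      else if multiplicative_reduction p W then 1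
      else 2 + wild_exponent p W)"

text \<open>The product over all primes, restricted to its finitely many factors different from 1.\<close>

definition conductor :: "rat weierstrass \<Rightarrow> nat" where
  "conductor W = (\<Prod>p | Factorial_Ring.prime p \<and> conductor_exponent p W \<noteq> 0. p ^ conductor_exponent p W)"

end

theory Submission
  imports Defs "HOL-Number_Theory.Number_Theory"
begin

text \<open>
  The conductor is divisible exactly by the primes of bad reduction, so suppose that \<open>E\<close> has good
  reduction at \<open>p \<noteq> 3\<close> and let \<open>\<sigma>\<close> generate the Galois group of \<open>K\<close>.  Since \<open>p\<close> ramifies, \<open>\<sigma>\<close> acts
  trivially on the residue field, and for a torsion point \<open>P\<close> over \<open>K\<close> the point \<open>R = P - \<sigma> P\<close> lies in
  the kernel of reduction.  If \<open>p \<ge> 5\<close>, the ramification index 2 is less than \<open>p - 1\<close>, so that this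
  kernel has no torsion and \<open>R = 0\<close>.  If \<open>p = 2\<close>, the torsion of the kernel has 2-power order, and it
  remains to exclude that \<open>R\<close> has order 2.  Then \<open>R\<close> is rational, \<open>K\<close> is generated by a preimage of a
  rational point under the isogeny with kernel \<open>{0, R}\<close>, and the equation of the
  2-descent shows that \<open>d\<close> has even valuation at 2.
\<close>

section \<open>The chord-tangent law and changes of variables\<close>

text \<open>For \<open>p = 2\<close> the kernel of reduction can contain a point of order two, so
  estimates in the kernel cannot finish the proof alone. They settle odd order, because doubling
  strictly lowers the valuation of \<open>x\<close>; even order goes by induction on the power of 2.
  If \<open>2 P\<close> is already fixed by \<open>\<sigma>\<close>, then
  \<open>P - \<sigma> P\<close> has order at most two, and being rational it has such restricted
  coordinates that a congruence modulo 4 decides. For \<open>p \<ge> 5\<close> both 2 and 3 are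
  units, so a short equation is available, for which \<open>x / y\<close> is additive up to terms of
  order 5. Torsion in the kernel would then need \<open>w p \<ge> 4\<close>, while
  \<open>w p = 2\<close> in the ramified field. For \<open>p = 3\<close> the coefficient
  \<open>a2\<close> cannot be removed in general, additivity holds only up to order 3, and the
  contradiction disappears. Torsion arguments presuppose the group axioms, whose obstacle is the
  many degenerate cases of associativity. They are avoided by computing one normalised configuration
  and working up to finitely many points elsewhere.\<close>

lemma power6_expand: "(x::'a::monoid_mult) ^ 6 = x * (x * (x * (x * (x * x))))"
  by (simp add: eval_nat_numeral mult.assoc)

lemmas ring_expand = algebra_simps power2_eq_square power3_eq_cube power4_eq_xxxx power6_expand

fun neg_point :: "'a::field weierstrass \<Rightarrow> 'a point \<Rightarrow> 'a point" where
  "neg_point W Infinity = Infinity"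
| "neg_point W (Affine x y) = Affine x (- y - a1 W * x - a3 W)"

text \<open>The inverse of the substitution behind \<open>change_vars\<close>: it passes from old to
  new coordinates and so carries points of \<open>W\<close> to points of
  \<open>change_vars u r s t W\<close>.\<close>

fun change_point :: "'a::field \<Rightarrow> 'a \<Rightarrow> 'a \<Rightarrow> 'a \<Rightarrow> 'a point \<Rightarrow> 'a point" where
  "change_point u r s t Infinity = Infinity"
| "change_point u r s t (Affine x y) = Affine ((x - r) / u ^ 2) ((y - s * (x - r) - t) / u ^ 3)"

text \<open>
  Both equations hold for chords and for tangents, and except for opposite points they determine
  \<open>m\<close>; the second is the first multiplied by \<open>y\<^sub>1 + y\<^sub>2 + a\<^sub>1 x\<^sub>2 + a\<^sub>3\<close> and divided by \<open>x\<^sub>1 - x\<^sub>2\<close>.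
\<close>

definition is_slope :: "'a::field weierstrass \<Rightarrow> 'a \<Rightarrow> 'a \<Rightarrow> 'a \<Rightarrow> 'a \<Rightarrow> 'a \<Rightarrow> bool" where
  "is_slope W m x1 y1 x2 y2 \<longleftrightarrow> m * (x1 - x2) = y1 - y2 \<and>
     m * (y1 + y2 + a1 W * x2 + a3 W) = x1 ^ 2 + x1 * x2 + x2 ^ 2 + a2 W * (x1 + x2) + a4 W - a1 W * y1"

text \<open>The sum, that is, the reflection of the third intersection: \<open>x3\<close> comes from
  the sum of the roots, and \<open>y1 - m * x1\<close> is the intercept of the line.\<close>

definition third_point :: "'a::field weierstrass \<Rightarrow> 'a \<Rightarrow> 'a \<Rightarrow> 'a \<Rightarrow> 'a \<Rightarrow> 'a point" where
  "third_point W m x1 y1 x2 = (let x3 = m ^ 2 + a1 W * m - a2 W - x1 - x2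
     in Affine x3 (- (m + a1 W) * x3 - (y1 - m * x1) - a3 W))"

lemma is_slope_commute:
  assumes "is_slope W m x1 y1 x2 y2"
  shows "is_slope W m x2 y2 x1 y1"
proof -
  note m = assms[unfolded is_slope_def]
  have "m * (y2 + y1 + a1 W * x1 + a3 W) = m * (y1 + y2 + a1 W * x2 + a3 W) + a1 W * (m * (x1 - x2))"
    by (simp add: algebra_simps)
  also have "\<dots> = x2 ^ 2 + x2 * x1 + x1 ^ 2 + a2 W * (x2 + x1) + a4 W - a1 W * y2"
    unfolding m[THEN conjunct1] m[THEN conjunct2] by (simp add: algebra_simps)
  finally have "m * (y2 + y1 + a1 W * x1 + a3 W) = x2 ^ 2 + x2 * x1 + x1 ^ 2 + a2 W * (x2 + x1) + a4 W - a1 W * y2" .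
  moreover have "m * (x2 - x1) = y2 - y1"
    using m[THEN conjunct1] by (simp add: algebra_simps)
  ultimately show ?thesis unfolding is_slope_def by metis
qed

text \<open>Subtract the two curve equations and factor. This makes the two conditions of
  \<open>is_slope\<close> compatible, and for equal abscissae it leaves only equal or opposite
  points.\<close>

lemma chord_identity:
  fixes W :: "'a::field weierstrass"
  assumes "on_curve W (Affine x1 y1)" "on_curve W (Affine x2 y2)"
  shows "(y1 - y2) * (y1 + y2 + a1 W * x2 + a3 W) =
    (x1 - x2) * (x1 ^ 2 + x1 * x2 + x2 ^ 2 + a2 W * (x1 + x2) + a4 W - a1 W * y1)"
proof -
  have "(y1 - y2) * (y1 + y2 + a1 W * x2 + a3 W) - (x1 - x2) * (x1 ^ 2 + x1 * x2 + x2 ^ 2 + a2 W * (x1 + x2) + a4 W - a1 W * y1)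
    = ((y1 ^ 2 + a1 W * x1 * y1 + a3 W * y1) - (x1 ^ 3 + a2 W * x1 ^ 2 + a4 W * x1 + a6 W))
    - ((y2 ^ 2 + a1 W * x2 * y2 + a3 W * y2) - (x2 ^ 3 + a2 W * x2 ^ 2 + a4 W * x2 + a6 W))"
    by (simp add: algebra_simps power2_eq_square power3_eq_cube)
  also have "\<dots> = 0" using assms by simp
  finally show ?thesis by simp
qed

lemma add_point_chord:
  assumes "x1 \<noteq> x2" "m * (x1 - x2) = y1 - y2"
  shows "add_point W (Affine x1 y1) (Affine x2 y2) = third_point W m x1 y1 x2"
proof -
  have "(y2 - y1) / (x2 - x1) = m" using assms by (simp add: field_simps)
  then show ?thesis using assms(1) by (simp add: third_point_def Let_def)
qed

lemma same_x:
  fixes W :: "'a::field weierstrass"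
  assumes "on_curve W (Affine x y1)" "on_curve W (Affine x y2)"
  shows "y1 = y2 \<or> y1 + y2 + a1 W * x + a3 W = 0"
  using chord_identity[OF assms] by simp

lemma add_point_opposite:
  "y1 + y2 + a1 W * x + a3 W = 0 \<Longrightarrow> add_point W (Affine x y1) (Affine x y2) = Infinity"
  by simp

lemma add_point_slope:
  fixes W :: "'a::field weierstrass"
  assumes "on_curve W (Affine x1 y1)" "on_curve W (Affine x2 y2)"
    and "x1 = x2 \<Longrightarrow> y1 + y2 + a1 W * x1 + a3 W \<noteq> 0"
    and "is_slope W m x1 y1 x2 y2"
  shows "add_point W (Affine x1 y1) (Affine x2 y2) = third_point W m x1 y1 x2"
proof (cases "x1 = x2")
  case True
  with assms same_x[of W x1 y1 y2] have y: "y1 = y2" by simp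
  with True assms have nz: "2 * y1 + a1 W * x1 + a3 W \<noteq> 0" by simp
  have "m * (2 * y1 + a1 W * x1 + a3 W) = 3 * x1 ^ 2 + 2 * a2 W * x1 + a4 W - a1 W * y1"
    using assms(4) True y by (simp add: is_slope_def power2_eq_square algebra_simps)
  with nz have "(3 * x1 ^ 2 + 2 * a2 W * x1 + a4 W - a1 W * y1) / (2 * y1 + a1 W * x1 + a3 W) = m"
    by (metis nonzero_mult_div_cancel_right)
  then show ?thesis using True y nz by (simp add: third_point_def Let_def)
next
  case False
  then have "(y2 - y1) / (x2 - x1) = m"
    using assms(4) by (simp add: is_slope_def field_simps)
  then show ?thesis using False by (simp add: third_point_def Let_def)
qed

lemma slope_exists:
  fixes W :: "'a::field weierstrass"
  assumes "on_curve W (Affine x1 y1)" "on_curve W (Affine x2 y2)"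
    and "x1 = x2 \<Longrightarrow> y1 + y2 + a1 W * x1 + a3 W \<noteq> 0"
  obtains m where "is_slope W m x1 y1 x2 y2"
proof (cases "x1 = x2")
  case True
  with assms same_x[of W x1 y1 y2] have y: "y1 = y2" by simp
  with True assms have nz: "y1 + y2 + a1 W * x2 + a3 W \<noteq> 0" by simp
  show ?thesis
    using nz y True by (intro that[of "(x1 ^ 2 + x1 * x2 + x2 ^ 2 + a2 W * (x1 + x2) + a4 W - a1 W * y1) /
      (y1 + y2 + a1 W * x2 + a3 W)"]) (simp add: is_slope_def)
next
  case False
  then show ?thesis
    using chord_identity[OF assms(1,2)]
    by (intro that[of "(y1 - y2) / (x1 - x2)"]) (simp add: is_slope_def nonzero_divide_eq_eq divide_eq_eq mult.commute)
qed

text \<open>The formulas of \<open>change_vars\<close> solved for the old coefficients, so that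
  substituting them leaves polynomial identities without division by \<open>u\<close>.\<close>

lemma change_vars_sel:
  assumes "u \<noteq> 0"
  shows "a1 W = u * a1 (change_vars u r s t W) - 2 * s"
    "a2 W = u ^ 2 * a2 (change_vars u r s t W) + s * a1 W - 3 * r + s ^ 2"
    "a3 W = u ^ 3 * a3 (change_vars u r s t W) - r * a1 W - 2 * t"
    "a4 W = u ^ 4 * a4 (change_vars u r s t W) + s * a3 W - 2 * r * a2 W + (t + r * s) * a1 W - 3 * r ^ 2 + 2 * s * t"
    "a6 W = u ^ 6 * a6 (change_vars u r s t W) - r * a4 W - r ^ 2 * a2 W - r ^ 3 + t * a3 W + t ^ 2 + r * t * a1 W"
  using assms by (simp_all add: change_vars_def)

lemma on_curve_change_iff:
  fixes W :: "'a::field weierstrass"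
  assumes u: "u \<noteq> 0"
  shows "on_curve (change_vars u r s t W) (change_point u r s t P) \<longleftrightarrow> on_curve W P"
proof (cases P)
  case (Affine x y)
  define Xa where "Xa = (x - r) / u ^ 2"
  define Y where "Y = (y - s * (x - r) - t) / u ^ 3"
  have x: "x = u ^ 2 * Xa + r" and y: "y = u ^ 3 * Y + u ^ 2 * s * Xa + t"
    using u by (simp_all add: Xa_def Y_def)
  obtain b1 b2 b3 b4 b6 where W': "change_vars u r s t W = Weierstrass b1 b2 b3 b4 b6"
    by (cases "change_vars u r s t W")
  note b = change_vars_sel[OF u, of W r s t, unfolded W' weierstrass.sel]
  have "(y ^ 2 + a1 W * x * y + a3 W * y) - (x ^ 3 + a2 W * x ^ 2 + a4 W * x + a6 W) =
     u ^ 6 * ((Y ^ 2 + b1 * Xa * Y + b3 * Y) - (Xa ^ 3 + b2 * Xa ^ 2 + b4 * Xa + b6))"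
    unfolding x y b by (simp add: ring_expand)
  then have "on_curve W P \<longleftrightarrow> Y ^ 2 + b1 * Xa * Y + b3 * Y = Xa ^ 3 + b2 * Xa ^ 2 + b4 * Xa + b6"
    using u Affine by (metis (no_types, lifting) eq_iff_diff_eq_0 mult_eq_0_iff on_curve.simps(2) power_not_zero)
  then show ?thesis unfolding W' Affine by (simp flip: Xa_def Y_def)
qed simp

lemma add_point_change:
  fixes W :: "'a::field weierstrass"
  assumes u: "u \<noteq> 0" and PQ: "on_curve W P" "on_curve W Q"
  shows "add_point (change_vars u r s t W) (change_point u r s t P) (change_point u r s t Q) =
    change_point u r s t (add_point W P Q)"
proof (cases P; cases Q)
  fix x1 y1 x2 y2 assume P: "P = Affine x1 y1" and Q: "Q = Affine x2 y2"
  let ?W = "change_vars u r s t W"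
  define X1 where "X1 = (x1 - r) / u ^ 2"
  define Y1 where "Y1 = (y1 - s * (x1 - r) - t) / u ^ 3"
  define X2 where "X2 = (x2 - r) / u ^ 2"
  define Y2 where "Y2 = (y2 - s * (x2 - r) - t) / u ^ 3"
  note pp = X1_def Y1_def X2_def Y2_def
  have P': "change_point u r s t P = Affine X1 Y1" and Q': "change_point u r s t Q = Affine X2 Y2"
    by (simp_all add: P Q pp)
  have x: "x1 = u ^ 2 * X1 + r" "x2 = u ^ 2 * X2 + r" and
    y: "y1 = u ^ 3 * Y1 + u ^ 2 * s * X1 + t" "y2 = u ^ 3 * Y2 + u ^ 2 * s * X2 + t"
    using u by (simp_all add: pp)
  obtain b1 b2 b3 b4 b6 where W': "?W = Weierstrass b1 b2 b3 b4 b6"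
    by (cases "?W")
  note b = change_vars_sel(1-4)[OF u, of W r s t, unfolded W' weierstrass.sel]
  have xeq: "X1 = X2 \<longleftrightarrow> x1 = x2" using u by (simp add: pp)
  have "x1 = x2 \<Longrightarrow> y1 + y2 + a1 W * x1 + a3 W = u ^ 3 * (Y1 + Y2 + b1 * X1 + b3)"
    unfolding x y b using u by (auto simp: algebra_simps eval_nat_numeral)
  then have opp: "x1 = x2 \<Longrightarrow> Y1 + Y2 + b1 * X1 + b3 = 0 \<longleftrightarrow> y1 + y2 + a1 W * x1 + a3 W = 0"
    using u by simp
  show ?thesis
  proof (cases "x1 = x2 \<and> y1 + y2 + a1 W * x1 + a3 W = 0")
    case True
    then have "X1 = X2 \<and> Y1 + Y2 + b1 * X1 + b3 = 0" using xeq opp by blast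
    then have "add_point ?W (Affine X1 Y1) (Affine X2 Y2) = Infinity"
      unfolding W' by (metis add_point.simps(3) weierstrass.sel(1,3))
    moreover have "add_point W P Q = Infinity"
      using True unfolding P Q by (metis add_point_opposite)
    ultimately show ?thesis unfolding P' Q' by simp
  next
    case False
    then obtain m where m: "is_slope W m x1 y1 x2 y2"
      using slope_exists PQ unfolding P Q by metis
    \<comment> \<open>From \<open>x = u^2 x' + r\<close> and
      \<open>y = u^3 y' + u^2 s x' + t\<close>, slopes are related by
      \<open>m = u n + s\<close>.\<close>
    define n where "n = (m - s) / u"
    have mn: "m = u * n + s" using u by (simp add: n_def)
    have n: "is_slope ?W n X1 Y1 X2 Y2"
    proof -
      have "u ^ 3 * (n * (X1 - X2)) = u ^ 3 * (Y1 - Y2)"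
        using m[unfolded is_slope_def, THEN conjunct1] unfolding x y mn by (simp add: ring_expand)
      moreover have "u ^ 4 * (n * (Y1 + Y2 + b1 * X2 + b3)) =
         u ^ 4 * (X1 ^ 2 + X1 * X2 + X2 ^ 2 + b2 * (X1 + X2) + b4 - b1 * Y1)"
      proof -
        \<comment> \<open>The new second condition times \<open>u^4\<close> is the old second
          condition minus \<open>s\<close> times the old first one.\<close>
        have "m * (x1 - x2) = y1 - y2"
          "m * (y1 + y2 + a1 W * x2 + a3 W) = x1 ^ 2 + x1 * x2 + x2 ^ 2 + a2 W * (x1 + x2) + a4 W - a1 W * y1"
          using m by (auto simp: is_slope_def)
        then have "(m * (y1 + y2 + a1 W * x2 + a3 W) - (x1 ^ 2 + x1 * x2 + x2 ^ 2 + a2 W * (x1 + x2) + a4 W - a1 W * y1))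
            - s * (y1 + y2 + a1 W * x2 + a3 W) - s * (m * (x1 - x2) - (y1 - y2)) = - s * (y1 + y2 + a1 W * x2 + a3 W)"
          by simp
        then show ?thesis unfolding x y mn b by (simp add: ring_expand)
      qed
      ultimately show ?thesis using u unfolding W' is_slope_def by simp
    qed
    have "add_point ?W (Affine X1 Y1) (Affine X2 Y2) = third_point ?W n X1 Y1 X2"
    proof (rule add_point_slope[OF _ _ _ n])
      show "on_curve ?W (Affine X1 Y1)" "on_curve ?W (Affine X2 Y2)"
        using on_curve_change_iff[OF u, of r s t W] PQ P' Q' by metis+
      show "X1 = X2 \<Longrightarrow> Y1 + Y2 + a1 ?W * X1 + a3 ?W \<noteq> 0"
        unfolding W' weierstrass.sel using opp xeq False by blast
    qed
    moreover have "add_point W P Q = third_point W m x1 y1 x2"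
      unfolding P Q by (rule add_point_slope[OF PQ[unfolded P Q] _ m]) (use False in blast)
    moreover have "third_point ?W n X1 Y1 X2 = change_point u r s t (third_point W m x1 y1 x2)"
    proof -
      define x3 where "x3 = m ^ 2 + a1 W * m - a2 W - x1 - x2"
      define X3 where "X3 = n ^ 2 + b1 * n - b2 - X1 - X2"
      have x3: "x3 = u ^ 2 * X3 + r" unfolding x3_def X3_def x mn b by (simp add: ring_expand)
      have "(- (m + a1 W) * x3 - (y1 - m * x1) - a3 W) =
         u ^ 3 * (- (n + b1) * X3 - (Y1 - n * X1) - b3) + u ^ 2 * s * X3 + t"
        unfolding x3 x y mn b by (simp add: ring_expand)
      then have "(- (m + a1 W) * x3 - (y1 - m * x1) - a3 W) - s * (x3 - r) - t =
         u ^ 3 * (- (n + b1) * X3 - (Y1 - n * X1) - b3)" unfolding x3 by (simp add: ring_expand)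
      then show ?thesis unfolding third_point_def Let_def W'
        using u by (simp flip: x3_def X3_def) (simp add: x3)
    qed
    ultimately show ?thesis unfolding P' Q' by simp
  qed
qed auto

lemma on_curve_add:
  fixes W :: "'a::field weierstrass"
  assumes "on_curve W P" "on_curve W Q"
  shows "on_curve W (add_point W P Q)"
proof (cases P; cases Q)
  fix x1 y1 x2 y2 assume P: "P = Affine x1 y1" and Q: "Q = Affine x2 y2"
  show ?thesis
  proof (cases "x1 = x2 \<and> y1 + y2 + a1 W * x1 + a3 W = 0")
    case False
    then obtain m where m: "is_slope W m x1 y1 x2 y2"
      using slope_exists assms unfolding P Q by metis
    have "add_point W P Q = third_point W m x1 y1 x2"
      unfolding P Q by (rule add_point_slope[OF assms[unfolded P Q] _ m]) (use False in blast)
    moreover have "on_curve W (third_point W m x1 y1 x2)"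
    proof (cases W)
      case W: (Weierstrass b1 b2 b3 b4 b6)
      \<comment> \<open>The slope conditions, the curve equation and the definition of
        \<open>x3\<close> are linear in \<open>y2\<close>, \<open>b4\<close>, \<open>b6\<close> and
        \<open>b2\<close>. Eliminating these four leaves a polynomial identity in free
        variables.\<close>
      have y2: "y2 = y1 - m * (x1 - x2)"
        and b4: "b4 = m * (y1 + y2 + b1 * x2 + b3) - (x1 ^ 2 + x1 * x2 + x2 ^ 2 + b2 * (x1 + x2) - b1 * y1)"
        and b6: "b6 = y1 ^ 2 + b1 * x1 * y1 + b3 * y1 - (x1 ^ 3 + b2 * x1 ^ 2 + b4 * x1)"
        using m assms(1) unfolding P W is_slope_def by (auto simp: algebra_simps)
      define x3 where "x3 = m ^ 2 + b1 * m - b2 - x1 - x2"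
      then have b2: "b2 = m ^ 2 + b1 * m - x1 - x2 - x3" by simp
      have "(- (m + b1) * x3 - (y1 - m * x1) - b3) ^ 2 + b1 * x3 * (- (m + b1) * x3 - (y1 - m * x1) - b3)
          + b3 * (- (m + b1) * x3 - (y1 - m * x1) - b3) = x3 ^ 3 + b2 * x3 ^ 2 + b4 * x3 + b6"
        unfolding b6 unfolding b4 unfolding b2 y2 by (simp add: algebra_simps power2_eq_square power3_eq_cube)
      then show ?thesis
        unfolding W third_point_def Let_def by (simp flip: x3_def)
    qed
    ultimately show ?thesis by simp
  next
    case True
    then have "add_point W P Q = Infinity" unfolding P Q by (metis add_point_opposite)
    then show ?thesis by simp
  qed
qed (use assms in auto)

lemma add_point_commute:
  fixes W :: "'a::field weierstrass"
  assumes "on_curve W P" "on_curve W Q"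
  shows "add_point W P Q = add_point W Q P"
proof (cases P; cases Q)
  fix x1 y1 x2 y2 assume P: "P = Affine x1 y1" and Q: "Q = Affine x2 y2"
  show ?thesis
  proof (cases "x1 = x2 \<and> y1 + y2 + a1 W * x1 + a3 W = 0")
    case True
    then have "add_point W P Q = Infinity" "add_point W Q P = Infinity"
      unfolding P Q by (metis add_point_opposite add.commute)+
    then show ?thesis by simp
  next
    case False
    then obtain m where m: "is_slope W m x1 y1 x2 y2"
      using slope_exists assms unfolding P Q by metis
    have m': "is_slope W m x2 y2 x1 y1"
      by (rule is_slope_commute[OF m])
    have "add_point W P Q = third_point W m x1 y1 x2"
      unfolding P Q by (rule add_point_slope[OF assms[unfolded P Q] _ m]) (use False in blast)
    moreover have "add_point W Q P = third_point W m x2 y2 x1"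
      unfolding P Q by (rule add_point_slope[OF assms(2,1)[unfolded P Q] _ m']) (use False in \<open>metis add.commute\<close>)
    moreover have "third_point W m x2 y2 x1 = third_point W m x1 y1 x2"
    proof -
      have "m * x2 - y2 = m * x1 - y1" using m[unfolded is_slope_def] by (simp add: algebra_simps)
      then show ?thesis unfolding third_point_def Let_def by (simp add: algebra_simps)
    qed
    ultimately show ?thesis by simp
  qed
qed auto

lemma on_curve_neg [simp]: "on_curve W (neg_point W P) \<longleftrightarrow> on_curve W P"
  by (cases P) (auto simp: power2_eq_square algebra_simps)

section \<open>Associativity\<close>

lemma neg_neg [simp]: "neg_point W (neg_point W P) = P"
  by (cases P) (auto simp: algebra_simps)

lemma add_neg_point [simp]: "add_point W P (neg_point W P) = Infinity" "add_point W (neg_point W P) P = Infinity"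
  by (cases P; simp)+

lemma add_eq_Infinity_iff:
  assumes "on_curve W P" "on_curve W Q"
  shows "add_point W P Q = Infinity \<longleftrightarrow> Q = neg_point W P"
proof
  assume *: "add_point W P Q = Infinity"
  show "Q = neg_point W P"
  proof (cases P; cases Q)
    fix x1 y1 x2 y2 assume PQ: "P = Affine x1 y1" "Q = Affine x2 y2"
    with * have "x1 = x2 \<and> y1 + y2 + a1 W * x1 + a3 W = 0"
      by (simp add: Let_def split: if_splits)
    then have x: "x1 = x2" and y: "y1 + y2 + a1 W * x1 + a3 W = 0" by auto
    have "y2 = (y1 + y2 + a1 W * x1 + a3 W) - y1 - a1 W * x1 - a3 W" by simp
    then have "y2 = - y1 - a1 W * x1 - a3 W" unfolding y by simp
    then show ?thesis using PQ x by simp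
  qed (use * in auto)
qed simp

lemma add_point_Infinity_right [simp]: "add_point W P Infinity = P"
  by (cases P) auto

lemma third_point_eqD:
  assumes "third_point W m x1 y1 x2 = Affine x3 y3"
  shows "x3 = m ^ 2 + a1 W * m - a2 W - x1 - x2" "y3 = - (m + a1 W) * x3 - (y1 - m * x1) - a3 W"
  using assms by (auto simp: third_point_def Let_def)

text \<open>Reflection maps the line through \<open>A\<close> and \<open>S\<close> to the line
  through \<open>-A\<close> and \<open>A + S\<close>, whose slope is therefore
  \<open>- (m + a1 W)\<close>.\<close>

lemma add_neg_cancel_chord:
  assumes "xA \<noteq> xS" and add: "add_point W (Affine xA yA) (Affine xS yS) = Affine x3 y3" and "x3 \<noteq> xA"
  shows "add_point W (neg_point W (Affine xA yA)) (Affine x3 y3) = Affine xS yS"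
proof -
  define m where "m = (yA - yS) / (xA - xS)"
  have m: "m * (xA - xS) = yA - yS" using assms(1) by (simp add: m_def)
  have "third_point W m xA yA xS = Affine x3 y3"
    using add add_point_chord[OF assms(1) m] by metis
  then have x3: "x3 = m ^ 2 + a1 W * m - a2 W - xA - xS"
    and y3: "y3 = - (m + a1 W) * x3 - (yA - m * xA) - a3 W"
    by (rule third_point_eqD)+
  have yS: "yS = yA - m * (xA - xS)" using m by simp
  have "add_point W (Affine xA (- yA - a1 W * xA - a3 W)) (Affine x3 y3) =
    third_point W (- (m + a1 W)) xA (- yA - a1 W * xA - a3 W) x3"
    by (rule add_point_chord) (use assms(3) in \<open>auto simp: y3 algebra_simps\<close>)
  also have "\<dots> = Affine xS yS"
    unfolding third_point_def Let_def by (simp add: x3 yS ring_expand)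
  finally show ?thesis by simp
qed

text \<open>
  After moving \<open>B\<close> to the origin and the line \<open>AB\<close> to \<open>y = 0\<close>, the curve is
  \<open>y (y + a x + c) = x (x - x\<^sub>1) (x - e)\<close> with \<open>A = (x\<^sub>1, 0)\<close> and \<open>-(A + B) = (e, 0)\<close>; the case
  \<open>x\<^sub>1 = 0\<close> is the doubling of \<open>B\<close>.
\<close>

lemma assoc_normalised:
  fixes x1 e a c x y :: "'a::field"
  defines "W \<equiv> Weierstrass a (- (x1 + e)) c (x1 * e) 0"
  assumes S: "on_curve W (Affine x y)" and "x \<noteq> 0" "y \<noteq> 0" "x \<noteq> e"
    and BS: "add_point W (Affine 0 0) (Affine x y) = Affine x2 y2" and "x2 \<noteq> x1"
  shows "add_point W (Affine e (- a * e - c)) (Affine x y) = add_point W (Affine x1 0) (Affine x2 y2)"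
proof -
  define m where "m = y / x"
  have y: "y = m * x" and m0: "m \<noteq> 0" using assms by (auto simp: m_def)
  have "third_point W m 0 0 x = Affine x2 y2"
    using add_point_chord[of 0 x m 0 y W] BS \<open>x \<noteq> 0\<close> y by simp
  then have x2: "x2 = m ^ 2 + a * m + x1 + e - x" and y2: "y2 = - (m + a) * x2 - c"
    using third_point_eqD[of W m 0 0 x x2 y2] by (simp_all add: W_def)
  \<comment> \<open>In terms of \<open>m\<close>, \<open>k\<close>, \<open>l\<close>,
    \<open>x\<close>, \<open>e\<close> the quantities \<open>x1\<close>, \<open>a\<close> and
    \<open>c\<close> become polynomials. The two chords to be compared have slopes
    \<open>k - a\<close> and \<open>- l\<close>, and both lead to the point
    \<open>(- k * l, k * (e + k * l))\<close>.\<close>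
  define k where "k = (x - x1) / m"
  define l where "l = (x2 - e) / m"
  have x1: "x1 = x - m * k" and x2': "x2 = m * l + e" using m0 by (simp_all add: k_def l_def)
  have "m * (m + a) = m * (k + l)" using x2 unfolding x1 x2' by (simp add: ring_expand)
  then have "m + a = k + l" using m0 by (simp only: mult_cancel_left) simp
  then have a: "a = k + l - m" by (simp add: algebra_simps)
  have "x * m * (k * (x - e)) = x * m * (m * x + a * x + c)"
    using S unfolding W_def x1 y by (simp add: ring_expand)
  then have "k * (x - e) = m * x + a * x + c" using \<open>x \<noteq> 0\<close> m0 by simp
  then have "c = k * (x - e) - m * x - a * x" by simp
  then have c: "c = - k * e - l * x" unfolding a by (simp add: ring_expand)
  have "add_point W (Affine e (- a * e - c)) (Affine x y) = third_point W (k - a) e (- a * e - c) x"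
    by (rule add_point_chord) (use assms in \<open>auto simp: y c a ring_expand\<close>)
  also have "\<dots> = Affine (- k * l) (k * (e + k * l))"
    unfolding third_point_def Let_def W_def weierstrass.sel point.inject
    unfolding x1 a c by (simp add: ring_expand)
  also have "\<dots> = third_point W (- l) x1 0 x2"
    unfolding third_point_def Let_def W_def weierstrass.sel point.inject
    unfolding x2' unfolding x1 a c by (simp add: ring_expand)
  also have "\<dots> = add_point W (Affine x1 0) (Affine x2 y2)"
  proof (rule add_point_chord[symmetric])
    show "- l * (x1 - x2) = 0 - y2" unfolding y2 x2' unfolding x1 c a by (simp add: ring_expand)
  qed (use assms in auto)
  finally show ?thesis .
qed

lemma change_point_eq_iff:
  assumes "u \<noteq> 0"
  shows "change_point u r s t P = change_point u r s t Q \<longleftrightarrow> P = Q"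
  using assms by (cases P; cases Q) auto

text \<open>Only \<open>A + B\<close> may be a tangent. The conditions
  \<open>xS \<noteq> xB\<close>, \<open>xS \<noteq> xC\<close> and \<open>xD \<noteq> xA\<close>
  make the other three sums proper chords, and together with \<open>xS \<noteq> xA\<close> they keep
  \<open>S\<close> off the line through \<open>A\<close> and \<open>B\<close>.\<close>

lemma assoc_generic:
  assumes on: "on_curve W (Affine xA yA)" "on_curve W (Affine xB yB)" "on_curve W (Affine xS yS)"
    and AB: "add_point W (Affine xA yA) (Affine xB yB) = Affine xC yC"
    and BS: "add_point W (Affine xB yB) (Affine xS yS) = Affine xD yD"
    and ne: "xS \<notin> {xA, xB, xC}" "xD \<noteq> xA"
  shows "add_point W (Affine xC yC) (Affine xS yS) = add_point W (Affine xA yA) (Affine xD yD)"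
proof -
  have opp: "xA = xB \<Longrightarrow> yA + yB + a1 W * xA + a3 W \<noteq> 0"
    using AB by auto
  then obtain m where m: "is_slope W m xA yA xB yB"
    using slope_exists[OF on(1,2)] by blast
  define W' where "W' = change_vars 1 xB m yB W"
  let ?c = "change_point 1 xB m yB"
  define x1 where "x1 = xA - xB"
  define e where "e = xC - xB"
  define x where "x = xS - xB"
  define y where "y = yS - m * (xS - xB) - yB"
  have c: "?c (Affine xA yA) = Affine x1 0" "?c (Affine xB yB) = Affine 0 0" "?c (Affine xS yS) = Affine x y"
    using m[unfolded is_slope_def] by (auto simp: x1_def x_def y_def algebra_simps)
  have xC: "xC = m ^ 2 + a1 W * m - a2 W - xA - xB" "yC = - (m + a1 W) * xC - (yA - m * xA) - a3 W"
    using add_point_slope[OF on(1,2) opp m] AB third_point_eqD[of W m xA yA xB xC yC] by simp_all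
  have onW': "on_curve W' (Affine x1 0)" "on_curve W' (Affine 0 0)" "on_curve W' (Affine x y)"
    using on c on_curve_change_iff[of 1 xB m yB W] unfolding W'_def by (metis zero_neq_one)+
  have sel: "a2 W' = - (x1 + e)" "a4 W' = x1 * e" "a6 W' = 0"
  proof -
    show "a6 W' = 0" using onW'(2) by simp
    show a2: "a2 W' = - (x1 + e)" by (simp add: W'_def change_vars_def x1_def e_def xC ring_expand)
    have yA: "yA = yB + m * (xA - xB)" using m[unfolded is_slope_def] by simp
    have "a4 W' + a2 W' * x1 + x1 ^ 2 = - (m * (yA + yB + a1 W * xB + a3 W)) + (xA ^ 2 + xA * xB + xB ^ 2 + a2 W * (xA + xB) + a4 W - a1 W * yA)"
      unfolding W'_def change_vars_def x1_def yA by (simp add: ring_expand)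
    also have "\<dots> = 0" using m[unfolded is_slope_def] by simp
    finally show "a4 W' = x1 * e" unfolding a2 by (simp add: ring_expand eq_neg_iff_add_eq_0)
  qed
  then have W': "W' = Weierstrass (a1 W') (- (x1 + e)) (a3 W') (x1 * e) 0"
    by (metis weierstrass.collapse)
  have cC: "?c (Affine xC yC) = Affine e (- a1 W' * e - a3 W')"
    using m[unfolded is_slope_def] by (simp add: e_def W'_def change_vars_def xC(2) algebra_simps)
  obtain x2 y2 where c2: "?c (Affine xD yD) = Affine x2 y2" and x2: "x2 = xD - xB" by simp
  have "x \<noteq> 0" "x \<noteq> e" "x2 \<noteq> x1" using ne by (auto simp: x_def e_def x1_def x2)
  moreover have "y \<noteq> 0"
  proof
    assume "y = 0"
    then have "x * ((x - x1) * (x - e)) = 0"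
      using onW'(3) sel by (simp add: ring_expand)
    then show False using ne by (auto simp: x_def x1_def e_def)
  qed
  moreover have "add_point W' (Affine 0 0) (Affine x y) = Affine x2 y2"
    unfolding c(2,3)[symmetric] c2[symmetric] W'_def using add_point_change[OF _ on(2,3)] BS by (metis zero_neq_one)
  ultimately have "add_point W' (Affine e (- a1 W' * e - a3 W')) (Affine x y) = add_point W' (Affine x1 0) (Affine x2 y2)"
    using assoc_normalised[of "a1 W'" x1 e "a3 W'" x y x2 y2] onW'(3) W' by metis
  moreover have "on_curve W (Affine xC yC)" "on_curve W (Affine xD yD)"
    using on_curve_add[OF on(1,2)] on_curve_add[OF on(2,3)] AB BS by simp_all
  ultimately have "?c (add_point W (Affine xC yC) (Affine xS yS)) = ?c (add_point W (Affine xA yA) (Affine xD yD))"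
    unfolding c(1,3)[symmetric] c2[symmetric] cC[symmetric] unfolding W'_def
    using add_point_change[of 1 W _ _ xB m yB] on
    by (simp del: add_point.simps change_point.simps)
  then show ?thesis using change_point_eq_iff[of 1] by (metis zero_neq_one)
qed

declare add_point.simps(3) [simp del]

section \<open>Properties of all but finitely many points of a curve\<close>

definition curve_points :: "'a::field weierstrass \<Rightarrow> 'a point set" where
  "curve_points W = {P. on_curve W P}"

text \<open>The cofinite filter of the curve, so that finite exceptional sets are combined by
  \<open>eventually_elim\<close>.\<close>

definition generic_points :: "'a::field weierstrass \<Rightarrow> 'a point filter" where
  "generic_points W = inf cofinite (principal (curve_points W))"

text \<open>The factor 4 removes \<open>b8\<close> by \<open>4 * b8 = b2 * b6 - b4^2\<close>; the
  remaining \<open>b2\<close>, \<open>b4\<close>, \<open>b6\<close> transform simply under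
  translations.\<close>

lemma four_disc:
  "4 * disc W = - (b2 W ^ 3) * b6 W + b2 W ^ 2 * b4 W ^ 2 - 32 * b4 W ^ 3 - 108 * b6 W ^ 2 + 36 * b2 W * b4 W * b6 W"
proof -
  have b8: "4 * b8 W = b2 W * b6 W - b4 W ^ 2"
    unfolding b2_def b4_def b6_def b8_def by (simp add: ring_expand)
  have "4 * disc W = - (b2 W ^ 2) * (4 * b8 W) - 32 * b4 W ^ 3 - 108 * b6 W ^ 2 + 36 * b2 W * b4 W * b6 W"
    unfolding disc_def by (simp add: algebra_simps)
  then show ?thesis unfolding b8 by (simp add: ring_expand)
qed

text \<open>With \<open>(x, y)\<close> moved to the origin, \<open>a\<^sub>3\<close> and \<open>a\<^sub>4\<close> are the two partial derivatives there.\<close>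

lemma disc_at_point:
  fixes W :: "'a::field_char_0 weierstrass"
  assumes "on_curve W (Affine x y)"
  defines "\<eta> \<equiv> 2 * y + a1 W * x + a3 W"
    and "\<nu> \<equiv> 3 * x ^ 2 + 2 * a2 W * x + a4 W - a1 W * y"
    and "c \<equiv> a2 W + 3 * x"
  shows "disc W = disc (Weierstrass (a1 W) c \<eta> \<nu> 0)"
proof -
  obtain p q r s t where W: "W = Weierstrass p q r s t" by (cases W)
  have t: "t = y ^ 2 + p * x * y + r * y - (x ^ 3 + q * x ^ 2 + s * x)"
    using assms(1) by (simp add: W)
  define V where "V = Weierstrass p c \<eta> \<nu> 0"
  note d = V_def W \<eta>_def \<nu>_def c_def
  have b2: "b2 W = b2 V - 12 * x" unfolding d b2_def by (simp add: ring_expand)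
  have b4: "b4 W = b4 V - x * b2 V + 6 * x ^ 2" unfolding d b2_def b4_def by (simp add: ring_expand)
  have b6: "b6 W = b6 V - 2 * x * b4 V + x ^ 2 * b2 V - 4 * x ^ 3"
    unfolding d b2_def b4_def b6_def by (simp add: ring_expand t)
  have "4 * disc W = 4 * disc V"
    unfolding four_disc b2 b4 b6 by (simp add: ring_expand)
  then have "disc W = disc V" by simp
  then show ?thesis by (simp add: V_def W)
qed

lemma elliptic_nonsingular:
  fixes W :: "'a::field_char_0 weierstrass"
  assumes "elliptic W" "on_curve W (Affine x y)"
  shows "2 * y + a1 W * x + a3 W \<noteq> 0 \<or> 3 * x ^ 2 + 2 * a2 W * x + a4 W - a1 W * y \<noteq> 0"
proof (rule ccontr)
  assume "\<not> ?thesis"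
  then have "disc W = 0"
    unfolding disc_at_point[OF assms(2)] by (simp add: disc_def b2_def b4_def b6_def b8_def)
  then show False using assms(1) by (simp add: elliptic_def)
qed

lemma finite_same_x: "finite {P. on_curve W P \<and> (\<exists>y. P = Affine x y)}"
proof (cases "\<exists>y. on_curve W (Affine x y)")
  case True
  then obtain y0 where y0: "on_curve W (Affine x y0)" by blast
  have "{P. on_curve W P \<and> (\<exists>y. P = Affine x y)} \<subseteq> {Affine x y0, neg_point W (Affine x y0)}"
  proof
    fix P assume "P \<in> {P. on_curve W P \<and> (\<exists>y. P = Affine x y)}"
    then obtain y where P: "P = Affine x y" "on_curve W (Affine x y)" by auto
    from same_x[OF y0 P(2)] show "P \<in> {Affine x y0, neg_point W (Affine x y0)}"
    proof
      assume *: "y0 + y + a1 W * x + a3 W = 0"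
      then have "add_point W (Affine x y0) (Affine x y) = Infinity" by (rule add_point_opposite)
      then show ?thesis using add_eq_Infinity_iff[OF y0 P(2)] P by simp
    qed (use P in simp)
  qed
  then show ?thesis using finite_subset by blast
next
  case False
  then have "{P. on_curve W P \<and> (\<exists>y. P = Affine x y)} = {}" by auto
  then show ?thesis by (metis finite.emptyI)
qed

text \<open>Infinitely many points make the filter of generic points nontrivial, so that a statement
  about fixed points can be tested after adding a generic point.\<close>

locale weierstrass_curve =
  fixes W :: "'a::field_char_0 weierstrass"
  assumes elliptic: "elliptic W" and infinite_points: "infinite (curve_points W)"
begin

abbreviation "gp \<equiv> generic_points W"
abbreviation add (infixl "\<oplus>" 65) where "P \<oplus> Q \<equiv> add_point W P Q"

lemma eventually_gp: "eventually P gp \<longleftrightarrow> finite {S. on_curve W S \<and> \<not> P S}"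
  by (simp add: generic_points_def curve_points_def eventually_inf_principal eventually_cofinite Collect_conj_eq)

lemma gp_nontrivial: "gp \<noteq> bot"
  using infinite_points eventually_gp[of "\<lambda>_. False"] by (simp add: trivial_limit_def curve_points_def)

lemma gp_on_curve: "eventually (on_curve W) gp"
  by (simp add: eventually_gp)

lemma gp_not_in: "finite A \<Longrightarrow> eventually (\<lambda>S. S \<notin> A) gp"
  unfolding eventually_gp by (rule finite_subset[of _ A]) auto

lemma gp_affine_not_x: "eventually (\<lambda>S. \<exists>xS yS. S = Affine xS yS \<and> xS \<noteq> x) gp"
proof -
  have "{S. on_curve W S \<and> \<not> (\<exists>xS yS. S = Affine xS yS \<and> xS \<noteq> x)} \<subseteq>
      insert Infinity {P. on_curve W P \<and> (\<exists>y. P = Affine x y)}"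
  proof
    fix S assume "S \<in> {S. on_curve W S \<and> \<not> (\<exists>xS yS. S = Affine xS yS \<and> xS \<noteq> x)}"
    then show "S \<in> insert Infinity {P. on_curve W P \<and> (\<exists>y. P = Affine x y)}"
      by (cases S) auto
  qed
  then show ?thesis unfolding eventually_gp
    by (rule finite_subset) (simp add: finite_same_x)
qed

text \<open>
  The only further point \<open>S\<close> with \<open>x(B + S) = x(B)\<close> is the one on the tangent at \<open>B\<close>.
\<close>

lemma gp_add_x_self:
  assumes B: "on_curve W (Affine xB yB)"
  shows "eventually (\<lambda>S. \<exists>x3 y3. Affine xB yB \<oplus> S = Affine x3 y3 \<and> x3 \<noteq> xB) gp"
proof -
  define \<eta> where "\<eta> = 2 * yB + a1 W * xB + a3 W"
  define \<nu> where "\<nu> = 3 * xB ^ 2 + 2 * a2 W * xB + a4 W - a1 W * yB"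
  \<comment> \<open>The slope of the tangent at \<open>B\<close> and the abscissa where it meets the
    curve again. If \<open>\<eta> = 0\<close>, the division returns 0; that case is excluded below,
    since \<open>\<nu>\<close> would vanish as well.\<close>
  define m0 where "m0 = \<nu> / \<eta>"
  define x0 where "x0 = m0 ^ 2 + a1 W * m0 - a2 W - 2 * xB"
  have "eventually (\<lambda>S. \<exists>xS yS. S = Affine xS yS \<and> xS \<noteq> x0) gp"
    "eventually (\<lambda>S. \<exists>xS yS. S = Affine xS yS \<and> xS \<noteq> xB) gp"
    by (rule gp_affine_not_x)+
  then show ?thesis using gp_on_curve
  proof eventually_elim
    case (elim S)
    then obtain xS yS where S: "S = Affine xS yS" "xS \<noteq> x0" "xS \<noteq> xB" "on_curve W (Affine xS yS)"
      by auto
    obtain m where m: "is_slope W m xB yB xS yS"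
      using slope_exists[OF B S(4)] S(3) by auto
    define d where "d = xS - xB"
    have xS: "xS = xB + d" by (simp add: d_def)
    have yS: "yS = yB + m * d" using m[unfolded is_slope_def] by (simp add: d_def algebra_simps)
    define x3 where "x3 = m ^ 2 + a1 W * m - a2 W - xB - xS"
    have "x3 \<noteq> xB"
    proof
      assume "x3 = xB"
      then have x: "xS = m ^ 2 + a1 W * m - a2 W - 2 * xB" by (simp add: x3_def algebra_simps)
      then have m2: "m ^ 2 = xS - a1 W * m + a2 W + 2 * xB" by simp
      have "m * \<eta> - \<nu> = m * (yB + yS + a1 W * xS + a3 W) - (xB ^ 2 + xB * xS + xS ^ 2 + a2 W * (xB + xS) + a4 W - a1 W * yB)
         - d * (m ^ 2 + a1 W * m - a2 W - 2 * xB - xS)"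
        unfolding \<eta>_def \<nu>_def yS unfolding xS by (simp add: ring_expand)
      also have "\<dots> = 0" using m[unfolded is_slope_def] m2 by simp
      finally have *: "m * \<eta> = \<nu>" by simp
      then have "\<eta> \<noteq> 0" using elliptic_nonsingular[OF elliptic B] by (auto simp: \<eta>_def \<nu>_def)
      with * have "m = m0" by (auto simp: m0_def field_simps)
      with x S(2) show False by (simp add: x0_def)
    qed
    moreover have "Affine xB yB \<oplus> S = third_point W m xB yB xS"
      unfolding S(1) by (rule add_point_slope[OF B S(4) _ m]) (use S in auto)
    ultimately show ?case by (auto simp: third_point_def Let_def x3_def)
  qed
qed

lemma gp_cancel_left: 
  assumes "on_curve W A"
  shows "eventually (\<lambda>S. neg_point W A \<oplus> (A \<oplus> S) = S) gp"
proof (cases A)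
  case (Affine xA yA)
  have "eventually (\<lambda>S. \<exists>x3 y3. A \<oplus> S = Affine x3 y3 \<and> x3 \<noteq> xA) gp"
    using gp_add_x_self assms Affine by auto
  then show ?thesis using gp_affine_not_x[of xA]
  proof eventually_elim
    case (elim S)
    then show ?case using add_neg_cancel_chord unfolding Affine by metis
  qed
qed auto

text \<open>Generically \<open>neg_point W A\<close> undoes the translation, so a generic point sent
  into a finite exceptional set lies in a translate of that set.\<close>

lemma filterlim_add:
  assumes "on_curve W A"
  shows "filterlim (\<lambda>S. A \<oplus> S) gp gp"
  unfolding filterlim_iff
proof (intro allI impI)
  fix \<phi> assume \<phi>: "eventually \<phi> gp"
  define Z where "Z = {S. on_curve W S \<and> \<not> \<phi> S}"
  have "finite Z" using \<phi> by (simp add: eventually_gp Z_def)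
  then have "eventually (\<lambda>S. S \<notin> (\<lambda>T. neg_point W A \<oplus> T) ` Z) gp"
    by (intro gp_not_in) simp
  then show "eventually (\<lambda>S. \<phi> (A \<oplus> S)) gp" using gp_cancel_left[OF assms] gp_on_curve
  proof eventually_elim
    case (elim S)
    show ?case
    proof (rule ccontr)
      assume "\<not> \<phi> (A \<oplus> S)"
      then have "A \<oplus> S \<in> Z" using on_curve_add[OF assms elim(3)] by (simp add: Z_def)
      then have "neg_point W A \<oplus> (A \<oplus> S) \<in> (\<lambda>T. neg_point W A \<oplus> T) ` Z" by blast
      with elim show False by simp
    qed
  qed
qed

lemma gp_assoc:
  assumes A: "on_curve W A" and B: "on_curve W B"
  shows "eventually (\<lambda>S. (A \<oplus> B) \<oplus> S = A \<oplus> (B \<oplus> S)) gp"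
proof (cases A; cases B)
  fix xA yA xB yB assume AB: "A = Affine xA yA" "B = Affine xB yB"
  show ?thesis
  proof (cases "A \<oplus> B")
    case Infinity
    then have "B = neg_point W A" using add_eq_Infinity_iff[OF A B] by simp
    then have A': "A = neg_point W B" by simp
    from gp_cancel_left[OF B] have "eventually (\<lambda>S. S = A \<oplus> (B \<oplus> S)) gp"
      unfolding A' by eventually_elim simp
    then show ?thesis using Infinity by simp
  next
    case C: (Affine xC yC)
    have "eventually (\<lambda>S. \<exists>xS yS. B \<oplus> S = Affine xS yS \<and> xS \<noteq> xA) gp"
      by (rule eventually_compose_filterlim[OF gp_affine_not_x filterlim_add[OF B]])
    then show ?thesis using gp_on_curve gp_affine_not_x[of xA] gp_affine_not_x[of xB] gp_affine_not_x[of xC]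
    proof eventually_elim
      case (elim S)
      then show ?case
      proof -
        obtain xD yD where D: "B \<oplus> S = Affine xD yD" "xD \<noteq> xA" using elim(1) by blast
        obtain xS yS where S: "S = Affine xS yS" "xS \<noteq> xA" "xS \<noteq> xB" "xS \<noteq> xC" using elim(3-5) by auto
        show ?thesis
          unfolding C D(1) unfolding AB S(1)
          by (rule assoc_generic[where xB = xB and yB = yB]) (use A B C AB D S elim(2) in auto)
      qed
    qed
  qed
qed auto

text \<open>On the curve the square of \<open>2 * y + a1 W * x + a3 W\<close> is the cubic
  \<open>p\<close> in \<open>x\<close>, the 2-division polynomial, and finitely many points lie
  above its roots.\<close>

lemma gp_two_torsion: "eventually (\<lambda>S. \<exists>x y. S = Affine x y \<and> 2 * y + a1 W * x + a3 W \<noteq> 0) gp"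
proof -
  define p where "p = [:b6 W, 2 * b4 W, b2 W, 4:]"
  have "p \<noteq> 0" by (simp add: p_def)
  then have fin: "finite {x. poly p x = 0}" by (rule poly_roots_finite)
  have "{S. on_curve W S \<and> \<not> (\<exists>x y. S = Affine x y \<and> 2 * y + a1 W * x + a3 W \<noteq> 0)} \<subseteq>
     insert Infinity (\<Union>x\<in>{x. poly p x = 0}. {P. on_curve W P \<and> (\<exists>y. P = Affine x y)})"
  proof
    fix S assume *: "S \<in> {S. on_curve W S \<and> \<not> (\<exists>x y. S = Affine x y \<and> 2 * y + a1 W * x + a3 W \<noteq> 0)}"
    show "S \<in> insert Infinity (\<Union>x\<in>{x. poly p x = 0}. {P. on_curve W P \<and> (\<exists>y. P = Affine x y)})"
    proof (cases S)
      case (Affine x y)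
      with * have on: "on_curve W (Affine x y)" and e: "2 * y + a1 W * x + a3 W = 0" by auto
      have "poly p x = (2 * y + a1 W * x + a3 W) ^ 2
          - 4 * ((y ^ 2 + a1 W * x * y + a3 W * y) - (x ^ 3 + a2 W * x ^ 2 + a4 W * x + a6 W))"
        unfolding p_def b2_def b4_def b6_def by (simp add: ring_expand)
      also have "\<dots> = 0" using on e by simp
      finally show ?thesis using on Affine by auto
    qed simp
  qed
  then show ?thesis unfolding eventually_gp
    by (rule finite_subset) (simp add: fin finite_same_x)
qed

text \<open>If \<open>Z + S = S\<close>, then the nonvertical line through \<open>Z\<close> and
  \<open>S\<close> also contains \<open>-S\<close>; hence \<open>S = -S\<close>, which a generic
  point violates.\<close>

lemma gp_add_ne_self:
  assumes "on_curve W Z" "Z \<noteq> Infinity"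
  shows "eventually (\<lambda>S. Z \<oplus> S \<noteq> S) gp"
proof (cases Z)
  case (Affine xZ yZ)
  show ?thesis using gp_two_torsion gp_affine_not_x[of xZ] gp_on_curve
  proof eventually_elim
    case (elim S)
    then obtain x y where S: "S = Affine x y" "2 * y + a1 W * x + a3 W \<noteq> 0" "x \<noteq> xZ" by auto
    define m where "m = (y - yZ) / (x - xZ)"
    have "S \<oplus> Z = third_point W m x y xZ"
      unfolding S Affine by (rule add_point_chord) (use S in \<open>auto simp: m_def\<close>)
    then have SZ: "Z \<oplus> S = third_point W m x y xZ" using add_point_commute elim assms by metis
    show ?case
    proof
      assume "Z \<oplus> S = S"
      then have "third_point W m x y xZ = Affine x y" using SZ S by simp
      then have "y = - (m + a1 W) * x - (y - m * x) - a3 W" by (rule third_point_eqD)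
      also have "\<dots> = - y - a1 W * x - a3 W" by (simp add: algebra_simps)
      finally have "y - (- y - a1 W * x - a3 W) = 0" by simp
      then show False using S(2) by (simp add: algebra_simps)
    qed
  qed
qed (use assms in auto)

text \<open>Generic associativity and cancellation give \<open>(-P + Q) + S = S\<close> for generic
  \<open>S\<close>, and only the neutral element fixes a generic point.\<close>

lemma cancel_generic:
  assumes on: "on_curve W P" "on_curve W Q" and ev: "eventually (\<lambda>S. P \<oplus> S = Q \<oplus> S) gp"
  shows "P = Q"
proof (rule ccontr)
  assume "P \<noteq> Q"
  define Z where "Z = neg_point W P \<oplus> Q"
  have Z: "on_curve W Z" using on unfolding Z_def by (intro on_curve_add) auto
  have "Z \<noteq> Infinity"
    using add_eq_Infinity_iff[of W "neg_point W P" Q] on \<open>P \<noteq> Q\<close> by (auto simp: Z_def)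
  have on': "on_curve W (neg_point W P)" using on by simp
  have "eventually (\<lambda>S. False) gp"
    using ev gp_cancel_left[OF on(1)] gp_assoc[OF on' on(2)] gp_add_ne_self[OF Z \<open>Z \<noteq> Infinity\<close>]
    by eventually_elim (simp add: Z_def)
  then show False using gp_nontrivial by (simp add: trivial_limit_def)
qed

text \<open>Adding a generic point to both sides reduces all degenerate cases to the generic one.\<close>

lemma add_assoc:
  assumes P: "on_curve W P" and Q: "on_curve W Q" and R: "on_curve W R"
  shows "(P \<oplus> Q) \<oplus> R = P \<oplus> (Q \<oplus> R)"
proof (rule cancel_generic)
  note PQ = on_curve_add[OF P Q] and QR = on_curve_add[OF Q R]
  show "on_curve W (P \<oplus> Q \<oplus> R)" "on_curve W (P \<oplus> (Q \<oplus> R))"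
    using on_curve_add PQ QR P R by auto
  have "eventually (\<lambda>S. (P \<oplus> Q) \<oplus> (R \<oplus> S) = P \<oplus> (Q \<oplus> (R \<oplus> S))) gp"
    by (rule eventually_compose_filterlim[OF gp_assoc[OF P Q] filterlim_add[OF R]])
  then show "eventually (\<lambda>S. ((P \<oplus> Q) \<oplus> R) \<oplus> S = (P \<oplus> (Q \<oplus> R)) \<oplus> S) gp"
    using gp_assoc[OF PQ R] gp_assoc[OF Q R] gp_assoc[OF P QR]
    by eventually_elim simp
qed

end

section \<open>Valuations\<close>

text \<open>The value at 0 is the default 0, because \<open>multiplicity\<close> returns 0 there;
  hence the nonzero guards in what follows.\<close>

definition vq :: "nat \<Rightarrow> rat \<Rightarrow> int" where
  "vq p x = int (multiplicity (int p) (fst (quotient_of x))) - int (multiplicity (int p) (snd (quotient_of x)))"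

lemma vq_divide:
  assumes p: "Factorial_Ring.prime p" and "a \<noteq> 0" "b \<noteq> 0"
  shows "vq p (of_int a / of_int b) = int (multiplicity (int p) a) - int (multiplicity (int p) b)"
proof -
  obtain n m where nm: "quotient_of (of_int a / of_int b) = (n, m)" by fastforce
  have m: "m > 0" using quotient_of_denom_pos[OF nm] .
  have "(of_int a :: rat) / of_int b = of_int n / of_int m" using quotient_of_div[OF nm] .
  then have "(of_int (a * m) :: rat) = of_int (n * b)" using m assms by (simp add: field_simps)
  then have eq: "a * m = n * b" by (simp only: of_int_eq_iff)
  then have "n \<noteq> 0" using assms m by auto
  have pe: "prime_elem (int p)" using p by simp
  have "multiplicity (int p) a + multiplicity (int p) m = multiplicity (int p) n + multiplicity (int p) b"
    using prime_elem_multiplicity_mult_distrib[OF pe \<open>a \<noteq> 0\<close>, of m]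
      prime_elem_multiplicity_mult_distrib[OF pe \<open>n \<noteq> 0\<close> \<open>b \<noteq> 0\<close>] m eq by simp
  then show ?thesis by (simp add: vq_def nm)
qed

lemma rat_quotient: obtains a b :: int where "b > 0" "(x :: rat) = of_int a / of_int b" "quotient_of x = (a, b)" "coprime a b"
  by (metis quotient_of_denom_pos quotient_of_div quotient_of_coprime surj_pair)

lemma vq_of_int:
  assumes "Factorial_Ring.prime p" "a \<noteq> 0"
  shows "vq p (of_int a) = int (multiplicity (int p) a)"
  using vq_divide[OF assms, of 1] assms by simp

lemma vq_mult:
  assumes p: "Factorial_Ring.prime p" and "x \<noteq> 0" "y \<noteq> 0"
  shows "vq p (x * y) = vq p x + vq p y"
proof -
  obtain a b where x: "b > 0" "x = of_int a / of_int b" by (rule rat_quotient)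
  obtain a' b' where y: "b' > 0" "y = of_int a' / of_int b'" by (rule rat_quotient)
  have nz: "a \<noteq> 0" "a' \<noteq> 0" "b \<noteq> 0" "b' \<noteq> 0" using assms x y by auto
  have pe: "prime_elem (int p)" using p by simp
  have "vq p (x * y) = vq p (of_int (a * a') / of_int (b * b'))" by (simp add: x y)
  also have "\<dots> = int (multiplicity (int p) (a * a')) - int (multiplicity (int p) (b * b'))"
    by (rule vq_divide[OF p]) (use nz in auto)
  also have "\<dots> = vq p x + vq p y"
    unfolding x y using nz by (simp add: vq_divide[OF p] prime_elem_multiplicity_mult_distrib[OF pe])
  finally show ?thesis .
qed

lemma vq_power:
  assumes p: "Factorial_Ring.prime p" and "x \<noteq> 0"
  shows "vq p (x ^ n) = int n * vq p x"
proof (induction n)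
  case 0
  show ?case using vq_of_int[OF p, of 1] by simp
next
  case (Suc n)
  then show ?case using vq_mult[OF p assms(2), of "x ^ n"] assms(2) by (simp add: algebra_simps)
qed

lemma p_integral_iff:
  assumes p: "Factorial_Ring.prime p"
  shows "p_integral p x \<longleftrightarrow> x = 0 \<or> vq p x \<ge> 0"
proof -
  obtain a b where x: "b > 0" "x = of_int a / of_int b" "quotient_of x = (a, b)" "coprime a b" by (rule rat_quotient)
  have x0: "x = 0 \<longleftrightarrow> a = 0" using x(1,2) by simp
  have v: "vq p x = int (multiplicity (int p) a) - int (multiplicity (int p) b)" "p_integral p x \<longleftrightarrow> \<not> int p dvd b"
    using x(3) by (simp_all add: vq_def p_integral_def)
  show ?thesis
  proof (cases "int p dvd b")
    case True
    have "\<not> is_unit (int p)" using prime_gt_1_nat[OF p] by simp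
    then have "\<not> int p dvd a" using True coprime_common_divisor[OF x(4)] by blast
    moreover have "multiplicity (int p) b > 0"
      using True x(1) p by (simp add: prime_multiplicity_gt_zero_iff)
    ultimately show ?thesis using True unfolding v x0 by (auto simp: not_dvd_imp_multiplicity_0)
  next
    case False
    then show ?thesis unfolding v x0 by (simp add: not_dvd_imp_multiplicity_0)
  qed
qed

text \<open>A common bound \<open>k\<close> with guarded hypotheses, instead of a minimum, admits
  summands equal to 0.\<close>

lemma vq_add:
  assumes p: "Factorial_Ring.prime p" and "x \<noteq> 0 \<Longrightarrow> vq p x \<ge> k" "y \<noteq> 0 \<Longrightarrow> vq p y \<ge> k" "x + y \<noteq> 0"
  shows "vq p (x + y) \<ge> k"
proof (cases "x = 0 \<or> y = 0")
  case True
  then show ?thesis using assms by auto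
next
  case False
  obtain a b where x: "b > 0" "x = of_int a / of_int b" by (rule rat_quotient)
  obtain a' b' where y: "b' > 0" "y = of_int a' / of_int b'" by (rule rat_quotient)
  have nz: "a \<noteq> 0" "a' \<noteq> 0" "b \<noteq> 0" "b' \<noteq> 0" using False x y by auto
  have pe: "prime_elem (int p)" using p by simp
  have xy: "x + y = of_int (a * b' + a' * b) / of_int (b * b')" 
    unfolding x y using nz by (simp add: add_frac_eq)
  have nz': "a * b' + a' * b \<noteq> 0"
  proof
    assume "a * b' + a' * b = 0"
    then have "x + y = 0" unfolding xy by simp
    with assms(4) show False by contradiction
  qed
  define m where "m = min (multiplicity (int p) (a * b')) (multiplicity (int p) (a' * b))"
  have "int p ^ m dvd a * b'" "int p ^ m dvd a' * b"
    by (rule multiplicity_dvd'; simp add: m_def)+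
  then have "int p ^ m dvd a * b' + a' * b" by (rule dvd_add)
  then have "m \<le> multiplicity (int p) (a * b' + a' * b)"
    using nz' p by (intro multiplicity_geI) auto
  moreover have "vq p (x + y) = int (multiplicity (int p) (a * b' + a' * b)) - int (multiplicity (int p) (b * b'))"
    unfolding xy by (rule vq_divide[OF p]) (use nz nz' in auto)
  moreover have "vq p x = int (multiplicity (int p) (a * b')) - int (multiplicity (int p) (b * b'))"
    "vq p y = int (multiplicity (int p) (a' * b)) - int (multiplicity (int p) (b * b'))"
    unfolding x y using nz by (simp_all add: vq_divide[OF p] prime_elem_multiplicity_mult_distrib[OF pe])
  ultimately show ?thesis using assms(2,3) False by (auto simp: m_def min_def split: if_splits)
qed

section \<open>The calculus of a valuation on a subfield\<close>

locale valued_field =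
  fixes K :: "'a::field_char_0 set" and w :: "'a \<Rightarrow> int"
  assumes one_in [simp, intro]: "1 \<in> K"
    and diff_in [simp, intro]: "x \<in> K \<Longrightarrow> y \<in> K \<Longrightarrow> x - y \<in> K"
    and mult_in [simp, intro]: "x \<in> K \<Longrightarrow> y \<in> K \<Longrightarrow> x * y \<in> K"
    and inverse_in [simp, intro]: "x \<in> K \<Longrightarrow> inverse x \<in> K"
    and w_mult: "x \<in> K \<Longrightarrow> y \<in> K \<Longrightarrow> x \<noteq> 0 \<Longrightarrow> y \<noteq> 0 \<Longrightarrow> w (x * y) = w x + w y"
    and w_add: "x \<in> K \<Longrightarrow> y \<in> K \<Longrightarrow> x \<noteq> 0 \<Longrightarrow> y \<noteq> 0 \<Longrightarrow> x + y \<noteq> 0 \<Longrightarrow> w (x + y) \<ge> min (w x) (w y)"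
begin

lemma zero_in [simp, intro]: "0 \<in> K"
  using diff_in[OF one_in one_in] by simp

lemma uminus_in [simp, intro]: "x \<in> K \<Longrightarrow> - x \<in> K"
  using diff_in[OF zero_in, of x] by simp

lemma add_in [simp, intro]: "x \<in> K \<Longrightarrow> y \<in> K \<Longrightarrow> x + y \<in> K"
  using diff_in[of x "- y"] by simp

lemma divide_in [simp, intro]: "x \<in> K \<Longrightarrow> y \<in> K \<Longrightarrow> x / y \<in> K"
  by (simp add: divide_inverse)

lemma power_in [simp, intro]: "x \<in> K \<Longrightarrow> x ^ n \<in> K"
  by (induction n) auto

lemma of_nat_in [simp, intro]: "of_nat n \<in> K"
  by (induction n) auto

lemma numeral_in [simp, intro]: "numeral n \<in> K"
  using of_nat_in[of "numeral n"] by simp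

text \<open>The fractional ideals of the valuation. Including 0 makes them closed under sums, so
  that estimates need no case distinction on vanishing terms.\<close>

definition V :: "int \<Rightarrow> 'a set" where "V k = {x \<in> K. x = 0 \<or> w x \<ge> k}"

lemma V_in: "x \<in> V k \<Longrightarrow> x \<in> K"
  by (simp add: V_def)

lemma w_1 [simp]: "w 1 = 0"
  using w_mult[of 1 1] by simp

lemma w_minus_1: "w (-1) = 0"
  using w_mult[of "-1" "-1"] by simp

lemma w_uminus [simp]: "x \<in> K \<Longrightarrow> w (- x) = w x"
  using w_mult[of "-1" x] w_minus_1 by (cases "x = 0") auto

lemma w_inverse: "x \<in> K \<Longrightarrow> x \<noteq> 0 \<Longrightarrow> w (inverse x) = - w x"
  using w_mult[of x "inverse x"] by simp

lemma w_divide: "x \<in> K \<Longrightarrow> y \<in> K \<Longrightarrow> x \<noteq> 0 \<Longrightarrow> y \<noteq> 0 \<Longrightarrow> w (x / y) = w x - w y"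
  by (simp add: divide_inverse w_mult w_inverse)

lemma w_power: "x \<in> K \<Longrightarrow> x \<noteq> 0 \<Longrightarrow> w (x ^ n) = int n * w x"
  by (induction n) (auto simp: w_mult algebra_simps)

lemma V_0 [simp, intro]: "0 \<in> V k"
  by (simp add: V_def)

lemma V_mono: "x \<in> V k \<Longrightarrow> l \<le> k \<Longrightarrow> x \<in> V l"
  by (auto simp: V_def)

lemma V_uminus [simp]: "- x \<in> V k \<longleftrightarrow> x \<in> V k"
proof -
  have "x \<in> V k \<Longrightarrow> - x \<in> V k" for x by (auto simp: V_def)
  from this[of x] this[of "- x"] show ?thesis by auto
qed

lemma V_add [intro]: "x \<in> V k \<Longrightarrow> y \<in> V k \<Longrightarrow> x + y \<in> V k"
  using w_add[of x y] by (cases "x = 0 \<or> y = 0 \<or> x + y = 0") (auto simp: V_def)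

lemma V_diff [intro]: "x \<in> V k \<Longrightarrow> y \<in> V k \<Longrightarrow> x - y \<in> V k"
  using V_add[of x k "- y"] by simp

lemma V_mult: "x \<in> V k \<Longrightarrow> y \<in> V l \<Longrightarrow> m \<le> k + l \<Longrightarrow> x * y \<in> V m"
  by (cases "x = 0 \<or> y = 0") (auto simp: V_def w_mult)

lemma V_mult0 [intro]: "x \<in> V 0 \<Longrightarrow> y \<in> V k \<Longrightarrow> x * y \<in> V k"
  by (rule V_mult) auto

lemma V_power [intro]: "x \<in> V 0 \<Longrightarrow> x ^ n \<in> V 0"
proof (induction n)
  case (Suc n)
  then show ?case using V_mult[of x 0 "x ^ n" 0 0] by simp
qed (simp add: V_def)

lemma V_power': "x \<in> V k \<Longrightarrow> m \<le> int n * k \<Longrightarrow> n > 0 \<Longrightarrow> x ^ n \<in> V m"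
proof (cases "x = 0")
  case False
  assume *: "x \<in> V k" "m \<le> int n * k"
  then have "k \<le> w x" using False by (simp add: V_def)
  then have "int n * k \<le> int n * w x" by (rule mult_left_mono) simp
  then show ?thesis using * False by (simp add: V_def w_power)
qed (simp add: V_def)

lemma V_w: "x \<in> K \<Longrightarrow> x \<in> V (w x)"
  by (simp add: V_def)

lemma V_1 [simp, intro]: "1 \<in> V 0"
  by (simp add: V_def)

lemma V_of_nat [simp, intro]: "of_nat n \<in> V 0"
  by (induction n) auto

lemma V_numeral [simp, intro]: "numeral n \<in> V 0"
  using V_of_nat[of "numeral n"] by simp

lemma w_add_dominant:
  assumes "x \<in> K" "x \<noteq> 0" "y \<in> V (w x + 1)"
  shows "x + y \<noteq> 0" "w (x + y) = w x"
proof -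
  show nz: "x + y \<noteq> 0"
  proof
    assume "x + y = 0"
    then have "y = - x" by (simp add: eq_neg_iff_add_eq_0 add.commute)
    then have "w y = w x" "y \<noteq> 0" using assms by simp_all
    then show False using assms(3) by (simp add: V_def)
  qed
  have "w (x + y) \<ge> w x"
    using V_add[of x "w x" y] V_w[of x] V_mono[OF assms(3), of "w x"] assms nz by (auto simp: V_def)
  moreover have "w (x + y) \<le> w x"
  proof (rule ccontr)
    assume "\<not> ?thesis"
    then have "x + y \<in> V (w x + 1)" using assms by (auto simp: V_def)
    then have "(x + y) - y \<in> V (w x + 1)" using assms by blast
    then have "x \<in> V (w x + 1)" by simp
    then show False using assms(2) by (simp add: V_def)
  qed
  ultimately show "w (x + y) = w x" by simp
qed

lemma V_divide: "x \<in> V k \<Longrightarrow> y \<in> K \<Longrightarrow> y \<noteq> 0 \<Longrightarrow> m \<le> k - w y \<Longrightarrow> x / y \<in> V m"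
  by (cases "x = 0") (auto simp: V_def w_divide)

lemma not_V: "x \<in> K \<Longrightarrow> x \<notin> V k \<longleftrightarrow> x \<noteq> 0 \<and> w x < k"
  by (auto simp: V_def)

end

section \<open>Quadratic fields ramified at a prime\<close>

locale ramified_prime =
  fixes p :: nat and d :: int
  assumes prime_p: "Factorial_Ring.prime p" and sqf: "squarefree d" and p_dvd: "int p dvd d"
begin

definition s :: complex where "s = csqrt (of_int d)"

definition K :: "complex set" where "K = {z. \<exists>a b. z = of_rat a + of_rat b * s}"

definition Nm :: "rat \<Rightarrow> rat \<Rightarrow> rat" where "Nm a b = a ^ 2 - of_int d * b ^ 2"

definition parts :: "complex \<Rightarrow> rat \<times> rat" where
  "parts z = (SOME ab. z = of_rat (fst ab) + of_rat (snd ab) * s)"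

text \<open>As \<open>p\<close> ramifies, \<open>K\<close> has one prime above it, of residue degree
  1, and the valuation of the norm is the normalised valuation there: \<open>w s = 1\<close>, and on
  the rationals \<open>w\<close> is twice the \<open>p\<close>-adic valuation.\<close>

definition w :: "complex \<Rightarrow> int" where "w z = vq p (Nm (fst (parts z)) (snd (parts z)))"

definition conj :: "complex \<Rightarrow> complex" where
  "conj z = of_rat (fst (parts z)) - of_rat (snd (parts z)) * s"

lemma s_square: "s * s = of_int d"
  unfolding s_def power2_eq_square[symmetric] by simp

lemma d_nonzero: "d \<noteq> 0"
  using sqf by auto

lemma vq_d: "vq p (of_int d) = 1"
proof -
  have "multiplicity (int p) d = 1"
  proof (rule multiplicity_eqI)
    show "int p ^ 1 dvd d" using p_dvd by simp
    show "\<not> int p ^ Suc 1 dvd d"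
    proof
      assume "int p ^ Suc 1 dvd d"
      then have "is_unit (int p)" using squarefreeD[OF sqf, of "int p"] by (simp add: power2_eq_square)
      then show False using prime_gt_1_nat[OF prime_p] by simp
    qed
  qed
  then show ?thesis using vq_of_int[OF prime_p d_nonzero] by simp
qed

text \<open>One valuation is even and the other odd. So the two terms of the norm never cancel, and
  the valuation of the norm is the smaller of the two.\<close>

lemma vq_norm_terms:
  "a \<noteq> 0 \<Longrightarrow> vq p (a ^ 2) = 2 * vq p a" "b \<noteq> 0 \<Longrightarrow> vq p (of_int d * b ^ 2) = 1 + 2 * vq p b"
  using d_nonzero by (simp_all add: vq_mult[OF prime_p] vq_power[OF prime_p] vq_d)

lemma vq_uminus: "vq p (- x) = vq p x"
proof (cases "x = 0")
  case False
  have "vq p (-1) = 0" using vq_of_int[OF prime_p, of "-1"] by simp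
  then show ?thesis using vq_mult[OF prime_p, of "-1" x] False by simp
qed simp

lemma Nm_nonzero:
  assumes "a \<noteq> 0 \<or> b \<noteq> 0"
  shows "Nm a b \<noteq> 0"
proof
  assume "Nm a b = 0"
  then have *: "a ^ 2 = of_int d * b ^ 2" by (simp add: Nm_def)
  with assms d_nonzero have "a \<noteq> 0" "b \<noteq> 0" by auto
  then have "2 * vq p a = 1 + 2 * vq p b" using vq_norm_terms * by metis
  then show False by presburger
qed

lemma vq_Nm_ge_iff:
  assumes "a \<noteq> 0 \<or> b \<noteq> 0"
  shows "vq p (Nm a b) \<ge> k \<longleftrightarrow> (a \<noteq> 0 \<longrightarrow> 2 * vq p a \<ge> k) \<and> (b \<noteq> 0 \<longrightarrow> 1 + 2 * vq p b \<ge> k)"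
proof
  assume k: "(a \<noteq> 0 \<longrightarrow> 2 * vq p a \<ge> k) \<and> (b \<noteq> 0 \<longrightarrow> 1 + 2 * vq p b \<ge> k)"
  have "vq p (a ^ 2 + (- (of_int d * b ^ 2))) \<ge> k"
    by (rule vq_add[OF prime_p])
      (use k Nm_nonzero[OF assms] vq_norm_terms in \<open>auto simp: vq_uminus Nm_def\<close>)
  then show "vq p (Nm a b) \<ge> k" by (simp add: Nm_def)
next
  assume k: "vq p (Nm a b) \<ge> k"
  show "(a \<noteq> 0 \<longrightarrow> 2 * vq p a \<ge> k) \<and> (b \<noteq> 0 \<longrightarrow> 1 + 2 * vq p b \<ge> k)"
  proof (cases "a = 0 \<or> b = 0")
    case True
    then show ?thesis using k vq_norm_terms(1)[of a] vq_norm_terms(2)[of b] by (auto simp: Nm_def vq_uminus)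
  next
    case False
    define i where "i = 2 * vq p a"
    define j where "j = 1 + 2 * vq p b"
    have "i \<noteq> j" unfolding i_def j_def by presburger
    then have ij: "vq p (a ^ 2) = i" "vq p (of_int d * b ^ 2) = j" "i \<noteq> j"
      using vq_norm_terms(1)[of a] vq_norm_terms(2)[of b] False by (auto simp: i_def j_def)
    have nz: "a ^ 2 \<noteq> 0" "of_int d * b ^ 2 \<noteq> 0" "Nm a b \<noteq> 0"
      using False d_nonzero Nm_nonzero by auto
    have A: "vq p (Nm a b + of_int d * b ^ 2) \<ge> min (vq p (Nm a b)) j"
      by (rule vq_add[OF prime_p]) (use nz ij in \<open>auto simp: Nm_def\<close>)
    have B: "vq p (- Nm a b + a ^ 2) \<ge> min (vq p (Nm a b)) i"
      by (rule vq_add[OF prime_p]) (use nz ij in \<open>auto simp: Nm_def vq_uminus[of "Nm a b", unfolded Nm_def minus_diff_eq]\<close>)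
    have "i \<ge> min (vq p (Nm a b)) j" "j \<ge> min (vq p (Nm a b)) i"
      using A B ij by (simp_all add: Nm_def)
    then have "i \<ge> k \<and> j \<ge> k" using k ij(3) by linarith
    then show ?thesis by (simp add: i_def j_def)
  qed
qed

lemma parts_unique:
  assumes "of_rat a + of_rat b * s = of_rat a' + of_rat b' * s"
  shows "a = a' \<and> b = b'"
proof -
  have "of_rat (a - a') = of_rat (b' - b) * s" using assms by (simp add: of_rat_diff algebra_simps)
  then have "of_rat ((a - a') ^ 2) = (of_rat (b' - b) * s) ^ 2" by (simp add: of_rat_power)
  also have "\<dots> = of_rat (of_int d * (b' - b) ^ 2)"
    by (simp add: power_mult_distrib power2_eq_square[of s] s_square of_rat_mult of_rat_power)
  finally have "(a - a') ^ 2 = of_int d * (b' - b) ^ 2" by (simp only: of_rat_eq_iff)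
  then have "Nm (a - a') (b' - b) = 0" by (simp add: Nm_def)
  then show ?thesis using Nm_nonzero[of "a - a'" "b' - b"] by auto
qed

lemma parts_eq: "parts (of_rat a + of_rat b * s) = (a, b)"
  unfolding parts_def
proof (rule some_equality)
  fix ab assume "of_rat a + of_rat b * s = of_rat (fst ab) + of_rat (snd ab) * s"
  then show "ab = (a, b)" using parts_unique[of a b "fst ab" "snd ab"] by (simp add: prod_eq_iff)
qed simp

lemma w_eq: "w (of_rat a + of_rat b * s) = vq p (Nm a b)"
  by (simp add: w_def parts_eq)

lemma conj_eq: "conj (of_rat a + of_rat b * s) = of_rat a - of_rat b * s"
  by (simp add: conj_def parts_eq)

lemma K_I: "of_rat a + of_rat b * s \<in> K"
  by (auto simp: K_def)

lemma K_cases: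
  assumes "z \<in> K"
  obtains a b where "z = of_rat a + of_rat b * s"
  using assms by (auto simp: K_def)

lemma mult_parts:
  "(of_rat a + of_rat b * s) * (of_rat a' + of_rat b' * s) =
   of_rat (a * a' + of_int d * b * b') + of_rat (a * b' + b * a') * s"
proof -
  have "(of_rat a + of_rat b * s) * (of_rat a' + of_rat b' * s) =
    of_rat a * of_rat a' + of_rat b * of_rat b' * (s * s) + (of_rat a * of_rat b' + of_rat b * of_rat a') * s"
    by (simp add: algebra_simps)
  then show ?thesis unfolding s_square by (simp add: of_rat_add of_rat_mult algebra_simps)
qed

lemma add_parts:
  "(of_rat a + of_rat b * s) + (of_rat a' + of_rat b' * s) = of_rat (a + a') + of_rat (b + b') * s"
  by (simp add: of_rat_add algebra_simps)

lemma diff_parts: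
  "(of_rat a + of_rat b * s) - (of_rat a' + of_rat b' * s) = of_rat (a - a') + of_rat (b - b') * s"
  by (simp add: of_rat_diff algebra_simps)

lemma zero_parts: "of_rat a + of_rat b * s = 0 \<longleftrightarrow> a = 0 \<and> b = 0"
  using parts_unique[of a b 0 0] by auto

lemma inverse_parts:
  "inverse (of_rat a + of_rat b * s) = of_rat (a / Nm a b) + of_rat (- b / Nm a b) * s"
proof (cases "a = 0 \<and> b = 0")
  case False
  then have N: "Nm a b \<noteq> 0" using Nm_nonzero by blast
  have "a * (a / Nm a b) + of_int d * b * (- b / Nm a b) = 1"
  proof -
    have "a * (a / n) + of_int d * b * (- b / n) = (a ^ 2 - of_int d * b ^ 2) / n" for n
      by (simp add: power2_eq_square diff_divide_distrib mult.assoc)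
    from this[of "Nm a b"] have "a * (a / Nm a b) + of_int d * b * (- b / Nm a b) = Nm a b / Nm a b"
      by (simp flip: Nm_def)
    then show ?thesis using N by simp
  qed
  moreover have "a * (- b / Nm a b) + b * (a / Nm a b) = 0" by simp
  ultimately have "(of_rat a + of_rat b * s) * (of_rat (a / Nm a b) + of_rat (- b / Nm a b) * s) = 1"
    unfolding mult_parts by simp
  then show ?thesis by (rule inverse_unique)
qed (simp add: Nm_def)

lemma Nm_mult: "Nm (a * a' + of_int d * b * b') (a * b' + b * a') = Nm a b * Nm a' b'"
  by (simp add: Nm_def ring_expand)

sublocale valued_field K w
proof
  show "1 \<in> K" using K_I[of 1 0] by simp
next
  fix x y assume "x \<in> K" "y \<in> K"
  then obtain a b a' b' where x: "x = of_rat a + of_rat b * s" and y: "y = of_rat a' + of_rat b' * s"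
    by (metis K_cases)
  show "x - y \<in> K" unfolding x y diff_parts by (rule K_I)
  show "x * y \<in> K" unfolding x y mult_parts by (rule K_I)
  show "inverse x \<in> K" unfolding x inverse_parts by (rule K_I)
  assume nz: "x \<noteq> 0" "y \<noteq> 0"
  then have nz': "a \<noteq> 0 \<or> b \<noteq> 0" "a' \<noteq> 0 \<or> b' \<noteq> 0" unfolding x y zero_parts by auto
  show "w (x * y) = w x + w y"
    unfolding x y mult_parts w_eq Nm_mult by (rule vq_mult[OF prime_p]) (use nz' Nm_nonzero in auto)
  assume "x + y \<noteq> 0"
  then have nz'': "a + a' \<noteq> 0 \<or> b + b' \<noteq> 0" unfolding x y add_parts zero_parts by auto
  define k where "k = min (w x) (w y)"
  have k: "vq p (Nm a b) \<ge> k" "vq p (Nm a' b') \<ge> k" by (simp_all add: k_def x y w_eq)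
  have ka: "a \<noteq> 0 \<longrightarrow> 2 * vq p a \<ge> k" "b \<noteq> 0 \<longrightarrow> 1 + 2 * vq p b \<ge> k"
    "a' \<noteq> 0 \<longrightarrow> 2 * vq p a' \<ge> k" "b' \<noteq> 0 \<longrightarrow> 1 + 2 * vq p b' \<ge> k"
    using k unfolding vq_Nm_ge_iff[OF nz'(1)] vq_Nm_ge_iff[OF nz'(2)] by auto
  have "vq p (Nm (a + a') (b + b')) \<ge> k"
    unfolding vq_Nm_ge_iff[OF nz'']
  proof (intro conjI impI)
    assume "a + a' \<noteq> 0"
    \<comment> \<open>For an integer \<open>v\<close>, \<open>2 * v \<ge> k\<close> means that
      \<open>v\<close> is at least \<open>k / 2\<close> rounded up, and
      \<open>1 + 2 * v \<ge> k\<close> that it is at least \<open>k / 2\<close> rounded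
      down.\<close>
    then have "vq p (a + a') \<ge> (k + 1) div 2"
      by (intro vq_add[OF prime_p]) (use ka in auto)
    then show "2 * vq p (a + a') \<ge> k" by presburger
  next
    assume "b + b' \<noteq> 0"
    then have "vq p (b + b') \<ge> k div 2"
      by (intro vq_add[OF prime_p]) (use ka in auto)
    then show "1 + 2 * vq p (b + b') \<ge> k" by presburger
  qed
  then show "w (x + y) \<ge> min (w x) (w y)" unfolding x y add_parts w_eq[of "a + a'"] by (simp add: k_def x y)
qed

lemma V_parts:
  "of_rat a + of_rat b * s \<in> V k \<longleftrightarrow> (a \<noteq> 0 \<longrightarrow> 2 * vq p a \<ge> k) \<and> (b \<noteq> 0 \<longrightarrow> 1 + 2 * vq p b \<ge> k)"
proof (cases "a = 0 \<and> b = 0")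
  case False
  then have "a \<noteq> 0 \<or> b \<noteq> 0" by blast
  moreover have "of_rat a + of_rat b * s \<in> V k \<longleftrightarrow> vq p (Nm a b) \<ge> k"
  proof -
    have "of_rat a + of_rat b * s \<noteq> 0" using False zero_parts by blast
    then show ?thesis by (simp add: V_def K_I w_eq)
  qed
  ultimately show ?thesis by (simp only: vq_Nm_ge_iff)
qed simp

lemma K_of_rat [simp, intro]: "of_rat a \<in> K"
  using K_I[of a 0] by simp

lemma K_s [simp, intro]: "s \<in> K"
  using K_I[of 0 1] by simp

lemma w_of_rat: "a \<noteq> 0 \<Longrightarrow> w (of_rat a) = 2 * vq p a"
  using w_eq[of a 0] vq_norm_terms(1)[of a] by (simp add: Nm_def)

lemma V_of_rat: "of_rat a \<in> V k \<longleftrightarrow> (a \<noteq> 0 \<longrightarrow> 2 * vq p a \<ge> k)"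
  using V_parts[of a 0] by simp

lemma s_nonzero: "s \<noteq> 0"
  using s_square d_nonzero by auto

lemma w_s: "w s = 1"
  using w_eq[of 0 1] vq_norm_terms(2)[of 1] by (simp add: Nm_def vq_uminus vq_d)

lemma w_of_nat:
  assumes "n > 0"
  shows "w (of_nat n) = 2 * int (multiplicity (int p) (int n))"
proof -
  have "w (of_rat (of_int (int n))) = 2 * vq p (of_int (int n))" by (rule w_of_rat) (use assms in simp)
  also have "vq p (of_int (int n)) = int (multiplicity (int p) (int n))"
    using vq_of_int[OF prime_p, of "int n"] assms by simp
  finally show ?thesis by simp
qed

lemma conj_in [simp, intro]: "z \<in> K \<Longrightarrow> conj z \<in> K"
  by (metis K_cases K_I conj_eq diff_conv_add_uminus minus_mult_left of_rat_minus)

lemma conj_conj: "z \<in> K \<Longrightarrow> conj (conj z) = z"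
proof (elim K_cases)
  fix a b assume z: "z = of_rat a + of_rat b * s"
  show ?thesis using conj_eq[of a "- b"] by (simp add: z conj_eq of_rat_minus)
qed

lemma conj_of_rat [simp]: "conj (of_rat a) = of_rat a"
  using conj_eq[of a 0] by simp

lemma conj_add: "x \<in> K \<Longrightarrow> y \<in> K \<Longrightarrow> conj (x + y) = conj x + conj y"
  by (elim K_cases) (simp add: add_parts conj_eq, simp add: of_rat_add algebra_simps)

lemma conj_diff: "x \<in> K \<Longrightarrow> y \<in> K \<Longrightarrow> conj (x - y) = conj x - conj y"
  by (elim K_cases) (simp add: diff_parts conj_eq, simp add: of_rat_diff algebra_simps)

lemma conj_mult: "x \<in> K \<Longrightarrow> y \<in> K \<Longrightarrow> conj (x * y) = conj x * conj y"
proof (elim K_cases)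
  fix a b a' b' assume x: "x = of_rat a + of_rat b * s" and y: "y = of_rat a' + of_rat b' * s"
  have "conj x * conj y = (of_rat a + of_rat (- b) * s) * (of_rat a' + of_rat (- b') * s)"
    by (simp add: x y conj_eq of_rat_minus)
  also have "\<dots> = of_rat (a * a' + of_int d * b * b') + of_rat (- (a * b' + b * a')) * s"
    unfolding mult_parts by simp
  also have "\<dots> = conj (x * y)"
    unfolding x y mult_parts conj_eq by (simp only: of_rat_minus) simp
  finally show ?thesis by simp
qed

lemma conj_inverse: "x \<in> K \<Longrightarrow> conj (inverse x) = inverse (conj x)"
proof (elim K_cases)
  fix a b assume x: "x = of_rat a + of_rat b * s"
  have "conj x = of_rat a + of_rat (- b) * s" by (simp add: x conj_eq of_rat_minus)
  moreover have "conj (inverse x) = of_rat (a / Nm a b) - of_rat (- b / Nm a b) * s"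
    unfolding x inverse_parts conj_eq ..
  moreover have "Nm a (- b) = Nm a b" by (simp add: Nm_def)
  ultimately show ?thesis by (simp only: inverse_parts) (simp add: of_rat_minus)
qed

lemma conj_divide: "x \<in> K \<Longrightarrow> y \<in> K \<Longrightarrow> conj (x / y) = conj x / conj y"
  by (simp add: divide_inverse conj_mult conj_inverse)

lemma conj_power: "x \<in> K \<Longrightarrow> conj (x ^ n) = conj x ^ n"
  using conj_of_rat[of 1] by (induction n) (auto simp: conj_mult)

lemma conj_uminus: "x \<in> K \<Longrightarrow> conj (- x) = - conj x"
  using conj_diff[of 0 x] conj_of_rat[of 0] by simp

lemma conj_eq_self_iff: "z \<in> K \<Longrightarrow> conj z = z \<longleftrightarrow> z \<in> \<rat>"
proof
  assume "z \<in> K" "conj z = z"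
  then obtain a b where z: "z = of_rat a + of_rat b * s" "conj z = z" by (metis K_cases)
  then have "of_rat a + of_rat (- b) * s = of_rat a + of_rat b * s" by (simp add: conj_eq of_rat_minus)
  then have "b = 0" using parts_unique by fastforce
  then show "z \<in> \<rat>" using z(1) by simp
next
  assume "z \<in> \<rat>"
  then show "conj z = z" by (elim Rats_cases) simp
qed

lemma conj_s: "conj s = - s"
  using conj_eq[of 0 1] by simp

text \<open>The Galois group acts trivially on the residue field.\<close>

lemma V_minus_conj:
  assumes "z \<in> V (2 * k)"
  shows "z - conj z \<in> V (2 * k + 1 + w 2)"
proof -
  from assms obtain a b where z: "z = of_rat a + of_rat b * s" by (metis K_cases V_in)
  have b: "vq p b \<ge> k" if "b \<noteq> 0"
  proof -
    \<comment> \<open>An even bound on an odd number can be raised by one: this is the gain of 1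
      over \<open>2 * k\<close>, and the factor 2 of \<open>z - conj z\<close> contributes
      \<open>w 2\<close>.\<close>
    have "2 * k \<le> 1 + 2 * vq p b" using assms that unfolding z V_parts by blast
    then show ?thesis by presburger
  qed
  have "z - conj z = 2 * (of_rat b * s)" by (simp add: z conj_eq)
  also have "\<dots> \<in> V (2 * k + 1 + w 2)"
  proof (rule V_mult)
    show "2 \<in> V (w 2)" by (simp add: V_def)
    show "of_rat b * s \<in> V (2 * k + 1)" using V_parts[of 0 b "2 * k + 1"] b by auto
  qed simp
  finally show ?thesis .
qed

lemma w_conj: "z \<in> K \<Longrightarrow> w (conj z) = w z"
proof (elim K_cases)
  fix a b assume z: "z = of_rat a + of_rat b * s"
  have "conj z = of_rat a + of_rat (- b) * s" by (simp add: z conj_eq of_rat_minus)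
  then show ?thesis by (simp add: z w_eq Nm_def)
qed

lemma V_conj: "z \<in> V k \<Longrightarrow> conj z \<in> V k"
  using w_conj[of z] conj_of_rat[of 0] by (auto simp: V_def)

lemma quadratic_field_subset: "quadratic_field d \<subseteq> K"
proof
  fix z assume "z \<in> quadratic_field d"
  then have "z \<in> generate_field ring_of_type_algebra {s}"
    by (simp add: quadratic_field_def rat_adjoin_def s_def)
  then show "z \<in> K"
  proof (induction rule: generate_field.induct)
    case (m_inv h)
    have "inv\<^bsub>ring_of_type_algebra\<^esub> h = inverse h"
      by (rule monoid.inv_unique'[symmetric, OF ring.is_monoid[OF ring_from_type_algebra]])
        (use m_inv in \<open>auto simp: ring_of_type_algebra_def\<close>)
    then show ?case using m_inv by simp
  next
    case (a_inv h)
    have "\<ominus>\<^bsub>ring_of_type_algebra\<^esub> h = - h"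
      by (rule abelian_group.minus_equality[OF ring.is_abelian_group[OF ring_from_type_algebra]])
       (auto simp: ring_of_type_algebra_def)
    then show ?case using a_inv by simp
  qed (auto simp: ring_of_type_algebra_def)
qed

end

lemma Rats_subset_rat_adjoin: "\<rat> \<subseteq> rat_adjoin S"
proof
  let ?R = "ring_of_type_algebra :: complex ring"
  have ainv: "\<ominus>\<^bsub>?R\<^esub> h = - h" for h
    by (rule abelian_group.minus_equality[OF ring.is_abelian_group[OF ring_from_type_algebra]])
      (auto simp: ring_of_type_algebra_def)
  have minv: "inv\<^bsub>?R\<^esub> h = inverse h" if "h \<noteq> 0" for h
    by (rule monoid.inv_unique'[symmetric, OF ring.is_monoid[OF ring_from_type_algebra]])
      (use that in \<open>auto simp: ring_of_type_algebra_def\<close>)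
  let ?G = "generate_field ?R S"
  have one: "1 \<in> ?G" using generate_field.one[of ?R S] by (simp add: ring_of_type_algebra_def)
  have add: "x + y \<in> ?G" if "x \<in> ?G" "y \<in> ?G" for x y
    using generate_field.eng_add[OF that] by (simp add: ring_of_type_algebra_def)
  have mult: "x * y \<in> ?G" if "x \<in> ?G" "y \<in> ?G" for x y
    using generate_field.eng_mult[OF that] by (simp add: ring_of_type_algebra_def)
  have neg: "- x \<in> ?G" if "x \<in> ?G" for x
    using generate_field.a_inv[OF that] by (simp add: ainv)
  have inv: "inverse x \<in> ?G" if "x \<in> ?G" "x \<noteq> 0" for x
  proof -
    have "\<zero>\<^bsub>?R\<^esub> = 0" by (simp add: ring_of_type_algebra_def)
    then show ?thesis using generate_field.m_inv[OF that(1)] that(2) minv[OF that(2)] by simp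
  qed
  have zero: "0 \<in> ?G" using add[OF one neg[OF one]] by simp
  have nat: "of_nat n \<in> ?G" for n by (induction n) (auto intro: zero one add)
  have int: "of_int n \<in> ?G" for n
    by (cases n rule: int_cases2) (auto intro: nat neg)
  fix z :: complex assume "z \<in> \<rat>"
  then obtain a b :: int where "b \<noteq> 0" "z = of_int a / of_int b"
    by (metis Rats_cases' less_irrefl)
  then show "z \<in> rat_adjoin S"
    unfolding rat_adjoin_def by (auto simp: divide_inverse intro!: mult inv int)
qed

section \<open>Reduction\<close>

lemma disc_map: "disc (map_weierstrass (of_rat :: rat \<Rightarrow> 'a::field_char_0) W) = of_rat (disc W)"
  by (simp add: disc_def b2_def b4_def b6_def b8_def weierstrass.map_sel
      of_rat_add of_rat_diff of_rat_mult of_rat_power of_rat_minus)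

locale ramified_curve = ramified_prime +
  fixes W :: "rat weierstrass"
  assumes integral: "\<And>a. a \<in> set_weierstrass W \<Longrightarrow> p_integral p a"
    and disc_nonzero: "disc W \<noteq> 0" and disc_unit: "vq p (disc W) = 0"
begin

definition C :: "complex weierstrass" where "C = map_weierstrass of_rat W"

lemma integral_of_rat: "a \<in> set_weierstrass W \<Longrightarrow> of_rat a \<in> V 0"
  using integral[of a] by (auto simp: V_of_rat p_integral_iff[OF prime_p])

lemma C_sel: "a1 C = of_rat (a1 W)" "a2 C = of_rat (a2 W)" "a3 C = of_rat (a3 W)"
  "a4 C = of_rat (a4 W)" "a6 C = of_rat (a6 W)"
  by (simp_all add: C_def weierstrass.map_sel)

lemma C_V [simp, intro]: "a1 C \<in> V 0" "a2 C \<in> V 0" "a3 C \<in> V 0" "a4 C \<in> V 0" "a6 C \<in> V 0"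
  unfolding C_sel by (rule integral_of_rat; cases W; simp)+

lemma C_K [simp, intro]: "a1 C \<in> K" "a2 C \<in> K" "a3 C \<in> K" "a4 C \<in> K" "a6 C \<in> K"
  using C_V V_in by blast+

lemma C_conj [simp]: "conj (a1 C) = a1 C" "conj (a2 C) = a2 C" "conj (a3 C) = a3 C"
  "conj (a4 C) = a4 C" "conj (a6 C) = a6 C"
  unfolding C_sel by simp_all

lemma disc_C: "disc C \<noteq> 0" "disc C \<in> K" "w (disc C) = 0"
  using disc_nonzero disc_unit unfolding C_def disc_map by (simp_all add: w_of_rat)

text \<open>With the point moved to the origin, both partial derivatives in the maximal ideal would
  put \<open>b4\<close>, \<open>b6\<close> and \<open>b8\<close>, and hence the discriminant, into
  it; but the discriminant is a unit.\<close>

lemma smooth_reduction: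
  assumes "on_curve C (Affine x y)" "x \<in> V 0" "y \<in> V 0" and e: "2 * y + a1 C * x + a3 C \<in> V 1"
  shows "3 * x ^ 2 + 2 * a2 C * x + a4 C - a1 C * y \<notin> V 1"
proof
  assume n: "3 * x ^ 2 + 2 * a2 C * x + a4 C - a1 C * y \<in> V 1"
  define \<eta> where "\<eta> = 2 * y + a1 C * x + a3 C"
  define \<nu> where "\<nu> = 3 * x ^ 2 + 2 * a2 C * x + a4 C - a1 C * y"
  define c where "c = a2 C + 3 * x"
  define U where "U = Weierstrass (a1 C) c \<eta> \<nu> 0"
  have c: "c \<in> V 0" unfolding c_def by (intro V_add V_mult0) (use assms in auto)
  have V1: "\<eta> \<in> V 1" "\<nu> \<in> V 1" using e n by (simp_all add: \<eta>_def \<nu>_def)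
  then have V0: "\<eta> \<in> V 0" "\<nu> \<in> V 0" using V_mono by force+
  have b2: "b2 U \<in> V 0" unfolding b2_def U_def weierstrass.sel
    by (intro V_add V_mult0 V_power) (use c in auto)
  have b4: "b4 U \<in> V 1" unfolding b4_def U_def weierstrass.sel
    by (intro V_add V_mult0) (use V1 in auto)
  have b6: "b6 U \<in> V 1" unfolding b6_def U_def weierstrass.sel power2_eq_square
    by (intro V_add V_mult0) (use V1 V0 in auto)
  have b8: "b8 U \<in> V 1" unfolding b8_def U_def weierstrass.sel power2_eq_square
    by (intro V_add V_diff V_mult0) (use V1 V0 c in auto)
  have b4': "b4 U \<in> V 0" "b6 U \<in> V 0" using b4 b6 V_mono by force+
  have "disc C = disc U"
    unfolding U_def \<eta>_def \<nu>_def c_def by (rule disc_at_point[OF assms(1)])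
  also have "\<dots> = 9 * (b2 U * b4 U) * b6 U - b2 U ^ 2 * b8 U - 8 * b4 U ^ 2 * b4 U - 27 * b6 U * b6 U"
    by (simp add: disc_def ring_expand)
  also have "\<dots> \<in> V 1"
    by (intro V_diff V_mult0[of _ 1] V_mult0[of _ 0] V_power) (use b2 b4 b6 b8 b4' in auto)
  finally show False using disc_C by (simp add: V_def)
qed

text \<open>If \<open>x\<close> has a pole, \<open>x^3\<close> dominates the right-hand side and
  \<open>y^2\<close> the left-hand side, so that \<open>2 * w y = 3 * w x\<close>.\<close>

lemma kernel_w:
  assumes on: "on_curve C (Affine x y)" and K: "x \<in> K" "y \<in> K" and x: "x \<notin> V 0"
  obtains r where "r \<ge> 1" "w x = - 2 * r" "w y = - 3 * r" "x \<noteq> 0" "y \<noteq> 0"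
proof -
  have x0: "x \<noteq> 0" "w x < 0" using x K by (auto simp: not_V)
  have "x ^ 3 + (a2 C * x ^ 2 + a4 C * x + a6 C) \<noteq> 0 \<and> w (x ^ 3 + (a2 C * x ^ 2 + a4 C * x + a6 C)) = 3 * w x"
  proof -
    have w3: "w (x ^ 3) = 3 * w x" using x0 K by (simp add: w_power)
    have xV: "x \<in> V (w x)" using K(1) by (rule V_w)
    have "a2 C * x ^ 2 \<in> V (2 * w x)" "a4 C * x \<in> V (w x)" "a6 C \<in> V 0"
      by (auto intro!: V_mult0 V_power'[OF xV] xV)
    then have "a2 C * x ^ 2 + a4 C * x + a6 C \<in> V (w (x ^ 3) + 1)"
      using x0 w3 by (intro V_add) (auto elim!: V_mono intro: V_mono[OF C_V(5)])
    from w_add_dominant[OF _ _ this] show ?thesis using x0 K w3 by auto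
  qed
  moreover have "y * (y + (a1 C * x + a3 C)) = x ^ 3 + (a2 C * x ^ 2 + a4 C * x + a6 C)"
    using on by (simp add: ring_expand)
  ultimately have rhs: "y * (y + (a1 C * x + a3 C)) \<noteq> 0" "w (y * (y + (a1 C * x + a3 C))) = 3 * w x"
    by simp_all
  then have y0: "y \<noteq> 0" by auto
  have ax: "a1 C * x + a3 C \<in> V (w x)"
    using x0 K V_mono[OF C_V(3), of "w x"] by (intro V_add V_mult0 V_w) auto
  have "w y < w x"
  proof (rule ccontr)
    assume "\<not> w y < w x"
    then have y: "y \<in> V (w x)" using K by (simp add: V_def)
    then have "y + (a1 C * x + a3 C) \<in> V (w x)" using ax by blast
    then have "y * (y + (a1 C * x + a3 C)) \<in> V (w x + w x)" using V_mult[OF y] by blast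
    then show False using rhs x0 by (simp add: V_def)
  qed
  then have "w (y + (a1 C * x + a3 C)) = w y"
    using w_add_dominant(2)[OF K(2) y0 V_mono[OF ax]] by simp
  moreover have "y + (a1 C * x + a3 C) \<noteq> 0" "y + (a1 C * x + a3 C) \<in> K" using rhs K by auto
  ultimately have e: "2 * w y = 3 * w x" using rhs(2) y0 K by (simp add: w_mult)
  define r where "r = - (w y div 3)"
  have "w y = - 3 * r" unfolding r_def using e by presburger
  moreover from this have "w x = - 2 * r" using e by simp
  ultimately show ?thesis using x0 y0 that[of r] by linarith
qed

lemma integral_y:
  assumes on: "on_curve C (Affine x y)" and K: "x \<in> K" "y \<in> K" and x: "x \<in> V 0"
  shows "y \<in> V 0"
proof (rule ccontr)
  assume "y \<notin> V 0"
  then have y: "y \<noteq> 0" "w y < 0" using K by (auto simp: not_V)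
  have ax: "a1 C * x + a3 C \<in> V 0" using x by auto
  have y1: "y + (a1 C * x + a3 C) \<noteq> 0 \<and> w (y + (a1 C * x + a3 C)) = w y"
    using y K V_mono[OF ax] w_add_dominant[of y "a1 C * x + a3 C"] by auto
  have "y * (y + (a1 C * x + a3 C)) = x ^ 3 + a2 C * x ^ 2 + a4 C * x + a6 C"
    using on by (simp add: ring_expand)
  also have "\<dots> \<in> V 0" using x by (intro V_add V_mult0 V_power) auto
  finally have "w (y * (y + (a1 C * x + a3 C))) \<ge> 0"
    using y1 y by (simp add: V_def)
  moreover have "w (y * (y + (a1 C * x + a3 C))) = w y + w y"
    using y1 y K by (simp add: w_mult)
  ultimately show False using y by simp
qed

lemma slope_in_K:
  assumes on: "on_curve C (Affine x1 y1)" "on_curve C (Affine x2 y2)" and K: "x1 \<in> K" "y1 \<in> K" "x2 \<in> K" "y2 \<in> K"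
    and no: "x1 = x2 \<Longrightarrow> y1 + y2 + a1 C * x1 + a3 C \<noteq> 0" and m: "is_slope C m x1 y1 x2 y2"
  shows "m \<in> K"
proof (cases "x1 = x2")
  case False
  then have "m = (y1 - y2) / (x1 - x2)" using m by (simp add: is_slope_def field_simps)
  then show ?thesis using K by simp
next
  case True
  then have "m = (x1 ^ 2 + x1 * x2 + x2 ^ 2 + a2 C * (x1 + x2) + a4 C - a1 C * y1) / (y1 + y2 + a1 C * x2 + a3 C)"
    using m[unfolded is_slope_def, THEN conjunct2] no[OF True] True by (simp add: eq_divide_eq)
  then show ?thesis using K by simp
qed

lemma set_point_add:
  assumes on: "on_curve C P" "on_curve C Q" and K: "set_point P \<subseteq> K" "set_point Q \<subseteq> K"
  shows "set_point (add_point C P Q) \<subseteq> K"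
proof (cases P; cases Q)
  fix x1 y1 x2 y2 assume P: "P = Affine x1 y1" and Q: "Q = Affine x2 y2"
  show ?thesis
  proof (cases "x1 = x2 \<and> y1 + y2 + a1 C * x1 + a3 C = 0")
    case True
    then show ?thesis unfolding P Q by (metis add_point_opposite empty_subsetI point.set(1))
  next
    case False
    then obtain m where m: "is_slope C m x1 y1 x2 y2"
      using slope_exists on unfolding P Q by metis
    have "m \<in> K"
      by (rule slope_in_K[OF on[unfolded P Q] _ _ _ _ _ m]) (use K P Q False in auto)
    moreover have "add_point C P Q = third_point C m x1 y1 x2"
      unfolding P Q by (rule add_point_slope[OF on[unfolded P Q] _ m]) (use False in blast)
    ultimately show ?thesis using K P Q by (auto simp: third_point_def Let_def)
  qed
qed (use K in auto)

section \<open>Galois conjugation on points\<close>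

lemma on_curve_conj:
  assumes "on_curve C P" "set_point P \<subseteq> K"
  shows "on_curve C (map_point conj P)"
proof (cases P)
  case (Affine x y)
  then have "x \<in> K" "y \<in> K" using assms by auto
  moreover from this have "conj (y ^ 2 + a1 C * x * y + a3 C * y) = conj (x ^ 3 + a2 C * x ^ 2 + a4 C * x + a6 C)"
    using assms Affine by simp
  ultimately show ?thesis using Affine by (simp add: conj_add conj_mult conj_power)
qed simp

lemma conj_add_point:
  assumes on: "on_curve C P" "on_curve C Q" and K: "set_point P \<subseteq> K" "set_point Q \<subseteq> K"
  shows "map_point conj (add_point C P Q) = add_point C (map_point conj P) (map_point conj Q)"
proof (cases P; cases Q)
  fix x1 y1 x2 y2 assume P: "P = Affine x1 y1" and Q: "Q = Affine x2 y2"
  have K': "x1 \<in> K" "y1 \<in> K" "x2 \<in> K" "y2 \<in> K" using K P Q by auto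
  have inj: "conj u = conj v \<longleftrightarrow> u = v" if "u \<in> K" "v \<in> K" for u v using conj_conj that by metis
  have "conj x1 = conj x2 \<longleftrightarrow> x1 = x2" using inj K' by blast
  moreover have "conj (y1 + y2 + a1 C * x1 + a3 C) = conj y1 + conj y2 + a1 C * conj x1 + a3 C"
    using K' by (simp add: conj_add conj_mult)
  then have "conj y1 + conj y2 + a1 C * conj x1 + a3 C = 0 \<longleftrightarrow> y1 + y2 + a1 C * x1 + a3 C = 0"
    using inj[of "y1 + y2 + a1 C * x1 + a3 C" 0] conj_of_rat[of 0] K' by simp
  ultimately have opp: "conj x1 = conj x2 \<and> conj y1 + conj y2 + a1 C * conj x1 + a3 C = 0 \<longleftrightarrow>
      x1 = x2 \<and> y1 + y2 + a1 C * x1 + a3 C = 0" by simp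
  show ?thesis
  proof (cases "x1 = x2 \<and> y1 + y2 + a1 C * x1 + a3 C = 0")
    case True
    then have "add_point C P Q = Infinity" unfolding P Q by (metis add_point_opposite)
    moreover have "add_point C (map_point conj P) (map_point conj Q) = Infinity"
      using True opp unfolding P Q point.map by (metis add_point_opposite)
    ultimately show ?thesis by simp
  next
    case False
    then obtain m where m: "is_slope C m x1 y1 x2 y2"
      using slope_exists on unfolding P Q by metis
    have mK: "m \<in> K"
      by (rule slope_in_K[OF on[unfolded P Q] _ _ _ _ _ m]) (use K P Q False in auto)
    have "conj (m * (x1 - x2)) = conj (y1 - y2)"
      "conj (m * (y1 + y2 + a1 C * x2 + a3 C)) = conj (x1 ^ 2 + x1 * x2 + x2 ^ 2 + a2 C * (x1 + x2) + a4 C - a1 C * y1)"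
      using m by (simp_all add: is_slope_def)
    then have m': "is_slope C (conj m) (conj x1) (conj y1) (conj x2) (conj y2)"
      using mK K' by (simp add: is_slope_def conj_add conj_mult conj_diff conj_power)
    have "add_point C (map_point conj P) (map_point conj Q) = third_point C (conj m) (conj x1) (conj y1) (conj x2)"
      unfolding P Q point.map
      by (rule add_point_slope[OF _ _ _ m'])
        (use on_curve_conj[OF on(1) K(1)] on_curve_conj[OF on(2) K(2)] False opp P Q in \<open>simp_all only: point.map, blast\<close>)
    moreover have "add_point C P Q = third_point C m x1 y1 x2"
      unfolding P Q by (rule add_point_slope[OF on[unfolded P Q] _ m]) (use False in blast)
    moreover have "map_point conj (third_point C m x1 y1 x2) = third_point C (conj m) (conj x1) (conj y1) (conj x2)"
      using mK K' by (simp add: third_point_def Let_def conj_add conj_mult conj_diff conj_power conj_uminus)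
    ultimately show ?thesis by simp
  qed
qed auto

text \<open>The point \<open>Infinity\<close> is left out, so that membership includes being
  nonzero.\<close>

definition kernel :: "complex point set" where
  "kernel = {P. on_curve C P \<and> (\<exists>x y. P = Affine x y \<and> x \<in> K \<and> y \<in> K \<and> x \<notin> V 0)}"

text \<open>A steep chord or tangent meets the curve again in the kernel of reduction.\<close>

lemma w_third:
  assumes m: "m \<in> K" "m \<noteq> 0" "w m < 0" and "x1 \<in> V (2 * w m + 1)" "x2 \<in> V (2 * w m + 1)"
  shows "m ^ 2 + a1 C * m - a2 C - x1 - x2 \<noteq> 0" "w (m ^ 2 + a1 C * m - a2 C - x1 - x2) = 2 * w m"
proof -
  have w2: "w (m ^ 2) = 2 * w m" using m by (simp add: w_power)
  have "a1 C * m \<in> V (w m)" using m by (intro V_mult0 V_w) auto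
  then have "a1 C * m - a2 C - x1 - x2 \<in> V (2 * w m + 1)"
    using assms by (intro V_diff) (auto elim!: V_mono intro: V_mono[OF C_V(2)])
  then have *: "m ^ 2 + (a1 C * m - a2 C - x1 - x2) \<noteq> 0" "w (m ^ 2 + (a1 C * m - a2 C - x1 - x2)) = 2 * w m"
    using w_add_dominant[of "m ^ 2" "a1 C * m - a2 C - x1 - x2"] m w2 by auto
  then show "m ^ 2 + a1 C * m - a2 C - x1 - x2 \<noteq> 0" "w (m ^ 2 + a1 C * m - a2 C - x1 - x2) = 2 * w m"
    by (simp_all add: algebra_simps)
qed

text \<open>Conjugate points have the same reduction. For integral \<open>x\<close>, an integral
  slope would make both partial derivatives vanish in the residue field, against
  \<open>smooth_reduction\<close>; so the line is steep and \<open>w_third\<close> applies. If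
  \<open>p = 2\<close> and \<open>x\<close> has a pole, steepness is read off from the second slope
  condition, using that 3 is a unit.\<close>

lemma minus_conj_in_kernel:
  assumes on: "on_curve C (Affine x y)" and K: "x \<in> K" "y \<in> K"
    and ne: "conj x \<noteq> x \<or> conj y \<noteq> y" and p: "x \<in> V 0 \<or> p = 2"
  shows "add_point C (Affine x y) (neg_point C (map_point conj (Affine x y))) \<in> kernel"
proof -
  define x' where "x' = conj x"
  define y' where "y' = conj y"
  have K': "x' \<in> K" "y' \<in> K" using K by (simp_all add: x'_def y'_def)
  have on': "on_curve C (Affine x' y')" using on_curve_conj[OF on] K by (simp add: x'_def y'_def)
  define z where "z = - y' - a1 C * x' - a3 C"
  have onz: "on_curve C (Affine x' z)" using on' on_curve_neg[of C "Affine x' y'"] by (simp add: z_def)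
  have zK: "z \<in> K" using K' by (simp add: z_def)
  have no: "x = x' \<Longrightarrow> y + z + a1 C * x + a3 C \<noteq> 0"
    using ne by (auto simp: z_def x'_def y'_def)
  obtain m where m: "is_slope C m x y x' z" using slope_exists[OF on onz no] by blast
  have mK: "m \<in> K" by (rule slope_in_K[OF on onz K K'(1) zK no m])
  have sum: "add_point C (Affine x y) (Affine x' z) = third_point C m x y x'"
    by (rule add_point_slope[OF on onz no m])
  \<comment> \<open>In this form \<open>m\<close> multiplies the small differences of conjugates,
    while the right-hand sides are close to the partial derivatives at
    \<open>(x, y)\<close>.\<close>
  have m1: "m * (x - x') = y + y' + a1 C * x' + a3 C"
    and m2: "m * (y - y') = x ^ 2 + x * x' + x' ^ 2 + a2 C * (x + x') + a4 C - a1 C * y"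
    using m by (simp_all add: is_slope_def z_def algebra_simps)
  have w2: "w 2 \<ge> 0" using V_numeral[of "num.Bit0 num.One"] by (simp add: V_def)
  have "m \<noteq> 0 \<and> w m < 0 \<and> x \<in> V (2 * w m + 1)"
  proof (cases "x \<in> V 0")
    case True
    have yV: "y \<in> V 0" by (rule integral_y[OF on K True])
    have V': "x' \<in> V 0" "y' \<in> V 0" using V_conj True yV by (simp_all add: x'_def y'_def)
    have dx: "x - x' \<in> V 1" and dy: "y - y' \<in> V 1"
      using V_minus_conj[of x 0] V_minus_conj[of y 0] True yV w2 V_mono[of _ "1 + w 2" 1] by (simp_all add: x'_def y'_def)
    have "m \<notin> V 0"
    proof
      assume mV: "m \<in> V 0"
      have "2 * y + a1 C * x + a3 C = m * (x - x') + (y - y') + a1 C * (x - x')"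
        unfolding m1 by (simp add: algebra_simps)
      also have "\<dots> \<in> V 1" using mV dx dy by (intro V_add V_mult0) auto
      finally have e: "2 * y + a1 C * x + a3 C \<in> V 1" .
      have "3 * x ^ 2 + 2 * a2 C * x + a4 C - a1 C * y = m * (y - y') + (2 * x + x' + a2 C) * (x - x')"
        unfolding m2 by (simp add: ring_expand)
      also have "\<dots> \<in> V 1" using mV dx dy True V' by (intro V_add V_mult0) auto
      finally show False using smooth_reduction[OF on True yV e] by blast
    qed
    then have "m \<noteq> 0" "w m < 0" using mK by (auto simp: not_V)
    then show ?thesis using V_mono[OF True] by auto
  next
    case False
    then have p2: "p = 2" using p by blast
    obtain r where r: "r \<ge> 1" "w x = - 2 * r" "w y = - 3 * r" "x \<noteq> 0" "y \<noteq> 0"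
      using kernel_w[OF on K False] by blast
    have w2: "w 2 = 2" using w_of_nat[of 2] p2 by simp
    have w3: "w 3 = 0"
    proof -
      have "multiplicity (2::int) 3 = 0" by (rule not_dvd_imp_multiplicity_0) simp
      then show ?thesis using w_of_nat[of 3] p2 by simp
    qed
    have xV: "x \<in> V (- 2 * r)" and yV: "y \<in> V (- 3 * r)" using K r by (simp_all add: V_def)
    have dx: "x - x' \<in> V (- 2 * r + 1)"
      using V_minus_conj[of x "- r"] xV w2 V_mono by (force simp: x'_def)
    have dy: "y - y' \<in> V (- 3 * r + 2)"
    proof -
      \<comment> \<open>\<open>V_minus_conj\<close> works at even levels, so \<open>- 3 * r\<close>
        is rounded down to \<open>2 * k\<close>. This loses at most 1 of the gain
        \<open>1 + w 2 = 3\<close>.\<close>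
      define k where "k = (- 3 * r) div 2"
      have "2 * k \<le> - 3 * r" "- 3 * r + 2 \<le> 2 * k + 1 + 2" unfolding k_def by presburger+
      then show ?thesis using V_minus_conj[of y k] V_mono[OF yV, of "2 * k"] w2 V_mono by (force simp: y'_def)
    qed
    \<comment> \<open>Writing \<open>x' = x - (x - x')\<close> isolates the dominant term
      \<open>3 * x ^ 2\<close>, of valuation \<open>- 4 * r\<close>.\<close>
    have num: "m * (y - y') = 3 * x ^ 2 + ((x - x') ^ 2 - 3 * x * (x - x') + a2 C * (2 * x - (x - x')) + a4 C - a1 C * y)"
      unfolding m2 by (simp add: ring_expand)
    have w3x: "w (3 * x ^ 2) = - 4 * r" using K r w3 by (simp add: w_mult w_power)
    have "(x - x') ^ 2 - 3 * x * (x - x') + a2 C * (2 * x - (x - x')) + a4 C - a1 C * y \<in> V (w (3 * x ^ 2) + 1)"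
      unfolding w3x
    proof (intro V_add V_diff)
      show "(x - x') ^ 2 \<in> V (- 4 * r + 1)" using V_power'[OF dx, of _ 2] by simp
      show "3 * x * (x - x') \<in> V (- 4 * r + 1)"
        by (rule V_mult[OF V_mult0[OF V_numeral xV] dx]) simp
      have "2 * x - (x - x') \<in> V (- 2 * r)" by (intro V_diff V_mult0 xV V_mono[OF dx]) auto
      then show "a2 C * (2 * x - (x - x')) \<in> V (- 4 * r + 1)"
        using r by (intro V_mult0) (auto elim!: V_mono)
      show "a4 C \<in> V (- 4 * r + 1)" using r V_mono[OF C_V(4)] by simp
      show "a1 C * y \<in> V (- 4 * r + 1)" using r V_mono[OF yV] by (intro V_mult0) auto
    qed
    then have nz: "m * (y - y') \<noteq> 0" and wn: "w (m * (y - y')) = - 4 * r"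
      using w_add_dominant[of "3 * x ^ 2"] w3x K r unfolding num by auto
    then have m0: "m \<noteq> 0" "y \<noteq> y'" by auto
    have "w m + w (y - y') = - 4 * r" using wn m0 mK K K' by (simp add: w_mult)
    moreover have "w (y - y') \<ge> - 3 * r + 2" using dy m0 by (simp add: V_def)
    ultimately have "w m \<le> - r - 2" by simp
    then show ?thesis using m0 r V_mono[OF xV] by auto
  qed
  then have *: "m \<noteq> 0" "w m < 0" "x \<in> V (2 * w m + 1)" "x' \<in> V (2 * w m + 1)"
    using V_conj by (auto simp: x'_def)
  define x3 where "x3 = m ^ 2 + a1 C * m - a2 C - x - x'"
  have x3: "x3 \<noteq> 0" "w x3 = 2 * w m" "x3 \<in> K"
    using w_third[OF mK *] mK K K' by (auto simp: x3_def)
  then have "x3 \<notin> V 0" using * by (simp add: not_V)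
  moreover have "third_point C m x y x' = Affine x3 (- (m + a1 C) * x3 - (y - m * x) - a3 C)"
    by (simp add: third_point_def Let_def x3_def)
  moreover have "on_curve C (third_point C m x y x')"
    unfolding sum[symmetric] by (rule on_curve_add[OF on onz])
  ultimately have "third_point C m x y x' \<in> kernel"
    using x3 mK K by (auto simp: kernel_def)
  then show ?thesis using sum by (simp add: x'_def y'_def z_def)
qed

text \<open>The numerator of the tangent slope is dominated by \<open>3 * x ^ 2\<close>, of
  valuation \<open>- 4 * r\<close>, while the factor 2 of \<open>y\<close> puts the denominator into
  \<open>V (- 3 * r + 1)\<close>. Hence \<open>w m \<le> - r - 1\<close>, and the new abscissa has
  valuation \<open>2 * w m\<close>.\<close>

lemma double_kernel:
  assumes p2: "p = 2" and P: "Affine x y \<in> kernel" and ne: "add_point C (Affine x y) (Affine x y) \<noteq> Infinity"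
  shows "\<exists>x3 y3. add_point C (Affine x y) (Affine x y) = Affine x3 y3 \<and> Affine x3 y3 \<in> kernel \<and> w x3 < w x"
proof -
  have on: "on_curve C (Affine x y)" and K: "x \<in> K" "y \<in> K" and xV: "x \<notin> V 0"
    using P by (auto simp: kernel_def)
  have no: "y + y + a1 C * x + a3 C \<noteq> 0" using ne add_point_opposite by metis
  obtain m where m: "is_slope C m x y x y" using slope_exists[OF on on no] by blast
  have mK: "m \<in> K" by (rule slope_in_K[OF on on K K no m])
  have sum: "add_point C (Affine x y) (Affine x y) = third_point C m x y x"
    by (rule add_point_slope[OF on on no m])
  obtain r where r: "r \<ge> 1" "w x = - 2 * r" "w y = - 3 * r" "x \<noteq> 0" "y \<noteq> 0"
    using kernel_w[OF on K xV] by blast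
  have w2: "w 2 = 2" using w_of_nat[of 2] p2 by simp
  have w3: "w 3 = 0"
  proof -
    have "multiplicity (2::int) 3 = 0" by (rule not_dvd_imp_multiplicity_0) simp
    then show ?thesis using w_of_nat[of 3] p2 by simp
  qed
  have xV: "x \<in> V (- 2 * r)" and yV: "y \<in> V (- 3 * r)" using K r by (simp_all add: V_def)
  have m2: "m * (2 * y + a1 C * x + a3 C) = 3 * x ^ 2 + (2 * a2 C * x + a4 C - a1 C * y)"
    using m by (simp add: is_slope_def ring_expand)
  have w3x: "w (3 * x ^ 2) = - 4 * r" using K r w3 by (simp add: w_mult w_power)
  have "2 * a2 C * x + a4 C - a1 C * y \<in> V (w (3 * x ^ 2) + 1)"
    unfolding w3x using r by (intro V_add V_diff V_mult0 V_mono[OF xV] V_mono[OF yV] V_mono[OF C_V(4)]) auto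
  then have nz: "m * (2 * y + a1 C * x + a3 C) \<noteq> 0" and wn: "w (m * (2 * y + a1 C * x + a3 C)) = - 4 * r"
    using w_add_dominant[of "3 * x ^ 2"] w3x K r unfolding m2 by auto
  have den: "2 * y + a1 C * x + a3 C \<in> V (- 3 * r + 1)"
  proof (intro V_add)
    show "2 * y \<in> V (- 3 * r + 1)" using w2 by (intro V_mult[OF _ yV, of _ 2]) (auto simp: V_def)
    show "a1 C * x \<in> V (- 3 * r + 1)" using r by (intro V_mult0 V_mono[OF xV]) auto
    show "a3 C \<in> V (- 3 * r + 1)" using r by (intro V_mono[OF C_V(3)]) auto
  qed
  have m0: "m \<noteq> 0" "2 * y + a1 C * x + a3 C \<noteq> 0" using nz by auto
  have "w m + w (2 * y + a1 C * x + a3 C) = - 4 * r" using wn m0 mK K by (simp add: w_mult)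
  moreover have "w (2 * y + a1 C * x + a3 C) \<ge> - 3 * r + 1" using den m0 by (simp add: V_def)
  ultimately have wm: "w m \<le> - r - 1" by simp
  define x3 where "x3 = m ^ 2 + a1 C * m - a2 C - x - x"
  have "x \<in> V (2 * w m + 1)" using V_mono[OF xV] wm by simp
  then have x3: "x3 \<noteq> 0" "w x3 = 2 * w m" "x3 \<in> K"
    using w_third[OF mK m0(1), of x x] wm r mK K by (auto simp: x3_def)
  then have "x3 \<notin> V 0" using wm r by (simp add: not_V)
  moreover have tp: "third_point C m x y x = Affine x3 (- (m + a1 C) * x3 - (y - m * x) - a3 C)"
    by (simp add: third_point_def Let_def x3_def)
  moreover have "on_curve C (third_point C m x y x)"
    unfolding sum[symmetric] by (rule on_curve_add[OF on on])
  ultimately have "third_point C m x y x \<in> kernel"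
    using x3 mK K by (auto simp: kernel_def)
  then show ?thesis using x3(2) wm r(2) unfolding sum tp by auto
qed

end

section \<open>The kernel of reduction\<close>

lemma infinite_complex_points: "infinite (curve_points (W :: complex weierstrass))"
proof
  assume fin: "finite (curve_points W)"
  have "\<exists>y. on_curve W (Affine x y)" for x
  proof -
    define b where "b = a1 W * x + a3 W"
    define r where "r = x ^ 3 + a2 W * x ^ 2 + a4 W * x + a6 W"
    define e where "e = csqrt (b ^ 2 + 4 * r)"
    define y where "y = (e - b) / 2"
    have "y ^ 2 + b * y = (e ^ 2 - b ^ 2) / 4"
      by (simp add: y_def power2_eq_square field_simps)
    also have "\<dots> = r" by (simp add: e_def)
    finally have "on_curve W (Affine x y)" by (simp add: b_def r_def algebra_simps)
    then show ?thesis ..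
  qed
  then obtain f where f: "\<And>x. on_curve W (Affine x (f x))" by metis
  have "inj (\<lambda>x. Affine x (f x))" by (auto intro: injI)
  moreover have "range (\<lambda>x. Affine x (f x)) \<subseteq> curve_points W" using f by (auto simp: curve_points_def)
  ultimately have "finite (UNIV :: complex set)" using fin finite_subset finite_imageD by metis
  then show False using infinite_UNIV_char_0 by blast
qed

lemma elliptic_map: "elliptic (map_weierstrass of_rat W :: 'a::field_char_0 weierstrass) \<longleftrightarrow> elliptic W"
  by (simp add: elliptic_def disc_map)

lemma comm_group_points:
  assumes "elliptic W"
  shows "comm_group (points_over W UNIV)"
proof -
  interpret weierstrass_curve "map_weierstrass of_rat W :: complex weierstrass"
    by unfold_locales (use assms infinite_complex_points in \<open>auto simp: elliptic_map\<close>)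
  show ?thesis
  proof (rule comm_groupI)
    fix P assume "P \<in> carrier (points_over W UNIV)"
    then show "\<exists>Q\<in>carrier (points_over W UNIV). Q \<otimes>\<^bsub>points_over W UNIV\<^esub> P = \<one>\<^bsub>points_over W UNIV\<^esub>"
      by (intro bexI[of _ "neg_point (map_weierstrass of_rat W) P"]) (auto simp: points_over_def)
  next
    fix P Q assume "P \<in> carrier (points_over W UNIV)" "Q \<in> carrier (points_over W UNIV)"
    then show "P \<otimes>\<^bsub>points_over W UNIV\<^esub> Q = Q \<otimes>\<^bsub>points_over W UNIV\<^esub> P"
      by (simp add: points_over_def add_point_commute)
  qed (simp_all add: points_over_def on_curve_add add_assoc)
qed

context ramified_curve
begin

definition G :: "complex point monoid" where "G = points_over W UNIV"

lemma elliptic_W: "elliptic W"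
  using disc_nonzero by (simp add: elliptic_def)

sublocale G: comm_group G
  unfolding G_def by (rule comm_group_points[OF elliptic_W])

lemma G_simps: "P \<in> carrier G \<longleftrightarrow> on_curve C P" "\<one>\<^bsub>G\<^esub> = Infinity" "P \<otimes>\<^bsub>G\<^esub> Q = add_point C P Q"
  by (auto simp: G_def points_over_def C_def)

lemma G_inv: "on_curve C P \<Longrightarrow> inv\<^bsub>G\<^esub> P = neg_point C P"
  by (rule G.inv_equality) (auto simp: G_simps)

lemma kernel_carrier: "P \<in> kernel \<Longrightarrow> P \<in> carrier G"
  by (auto simp: kernel_def G_simps)

end

text \<open>
  In the coordinates \<open>z = x / y\<close>, \<open>t = 1 / y\<close> at infinity the curve is \<open>t = z\<^sup>3 + A z t\<^sup>2 + B t\<^sup>3\<close> and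
  the line \<open>y = m x + c\<close> is \<open>m z + c t = 1\<close>, of slope \<open>-m / c\<close>.
\<close>

lemma slope_at_infinity:
  fixes x1 y1 x2 y2 A B m c :: "'a::field_char_0"
  assumes y0: "y1 \<noteq> 0" "y2 \<noteq> 0"
    and e1: "y1 ^ 2 = x1 ^ 3 + A * x1 + B" and e2: "y2 ^ 2 = x2 ^ 3 + A * x2 + B"
    and y1: "y1 = m * x1 + c" and y2: "y2 = m * x2 + c"
    and m2: "m * (y1 + y2) = x1 ^ 2 + x1 * x2 + x2 ^ 2 + A"
  defines "z1 \<equiv> x1 / y1" and "z2 \<equiv> x2 / y2" and "t1 \<equiv> inverse y1" and "t2 \<equiv> inverse y2"
  defines "U \<equiv> 1 - A * z2 * (t1 + t2) - B * (t1 ^ 2 + t1 * t2 + t2 ^ 2)"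
    and "S \<equiv> z1 ^ 2 + z1 * z2 + z2 ^ 2 + A * t1 ^ 2"
  assumes U: "U \<noteq> 0"
  shows "c \<noteq> 0" "- m * U = S * c"
proof -
  have t0: "t1 \<noteq> 0" "t2 \<noteq> 0" using y0 by (simp_all add: t1_def t2_def)
  have xy: "y1 * t1 = 1" "y2 * t2 = 1" "z1 = x1 * t1" "z2 = x2 * t2"
    using y0 by (simp_all add: t1_def t2_def z1_def z2_def divide_inverse)
  have curve: "t = z ^ 3 + A * z * t ^ 2 + B * t ^ 3"
    if "y ^ 2 = x ^ 3 + A * x + B" "y * t = 1" "z = x * t" for x y z t
  proof -
    have "t = t * (y * t) ^ 2" unfolding that(2) by simp
    also have "\<dots> = y ^ 2 * t ^ 3" by (simp add: power_mult_distrib power3_eq_cube power2_eq_square)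
    finally show ?thesis unfolding that(1,3) by (simp add: ring_expand)
  qed
  note c1 = curve[OF e1 xy(1,3)] and c2 = curve[OF e2 xy(2,4)]
  have l1: "m * z1 = 1 - c * t1" unfolding xy(1)[symmetric] xy(3) y1 by (simp add: algebra_simps)
  have l2: "m * z2 = 1 - c * t2" unfolding xy(2)[symmetric] xy(4) y2 by (simp add: algebra_simps)
  \<comment> \<open>The difference of the two curve equations in \<open>z\<close> and
    \<open>t\<close>, factored: \<open>S / U\<close> is the slope of the chord, in a form that
    survives when the points coincide.\<close>
  have US: "(t1 - t2) * U = (z1 - z2) * S"
  proof -
    have "(t1 - t2) * U - (z1 - z2) * S =
       (t1 - (z1 ^ 3 + A * z1 * t1 ^ 2 + B * t1 ^ 3)) - (t2 - (z2 ^ 3 + A * z2 * t2 ^ 2 + B * t2 ^ 3))"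
      unfolding U_def S_def by (simp add: ring_expand)
    also have "\<dots> = 0" unfolding c1[symmetric] c2[symmetric] by simp
    finally show ?thesis by simp
  qed
  have "c \<noteq> 0 \<and> - m * U = S * c"
  proof (cases "z1 = z2")
    case True
    \<comment> \<open>Equal \<open>z\<close> forces equal \<open>t\<close>, so this is the tangent.
      Its equation is recovered from \<open>2 * m * t1 = S\<close> and
      \<open>2 * c * t1 = - U\<close>.\<close>
    then have "t1 = t2" using US U by simp
    then have y: "y2 = y1" by (simp add: t1_def t2_def)
    with True have eq: "z2 = z1" "t2 = t1" "x2 = x1" "y2 = y1" using y0 by (simp_all add: z1_def z2_def t1_def t2_def)
    have "2 * m * t1 = m * (y1 + y2) * t1 ^ 2"
    proof -
      have "2 * m * t1 = 2 * m * t1 * (y1 * t1)" by (simp add: xy(1))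
      then show ?thesis unfolding y by (simp add: power2_eq_square algebra_simps)
    qed
    also have "\<dots> = S" unfolding m2 unfolding S_def xy(3,4) eq by (simp add: ring_expand)
    finally have mt: "2 * m * t1 = S" .
    have "2 * c * t1 * t1 = 2 * t1 - 2 * m * t1 * z1"
      unfolding mult.assoc[of _ t1 z1] mult.commute[of t1 z1] unfolding mult.assoc[symmetric]
      unfolding mult.assoc[of 2 m z1] l1 by (simp add: algebra_simps)
    also have "\<dots> = - U * t1 + 3 * (t1 - (z1 ^ 3 + A * z1 * t1 ^ 2 + B * t1 ^ 3))"
      unfolding mt unfolding S_def U_def eq by (simp add: ring_expand)
    also have "\<dots> = - U * t1" unfolding c1[symmetric] by simp
    finally have ct: "2 * c * t1 = - U" using mult_right_cancel[OF t0(1)] by blast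
    then have "c \<noteq> 0" using U by auto
    moreover have "2 * t1 * (- m * U) = 2 * t1 * (S * c)"
    proof -
      have "2 * t1 * (- m * U) = 2 * m * t1 * (- U)" by (simp add: algebra_simps)
      also have "\<dots> = S * (2 * c * t1)" unfolding mt ct ..
      finally show ?thesis by (simp add: algebra_simps)
    qed
    moreover have "2 * t1 \<noteq> 0" using t0 by simp
    ultimately show ?thesis using mult_left_cancel by blast
  next
    case False
    have mc: "c * (t1 - t2) = - (m * z1) + m * z2" unfolding l1 l2 by (simp add: algebra_simps)
    have "c \<noteq> 0"
    proof
      assume c: "c = 0"
      then have "m * z1 = m * z2" using l1 l2 by simp
      then have "m = 0" using False by simp
      then have "m * x1 + c = 0" using c by simp
      then show False using y0(1) y1 by metis
    qed
    moreover have "(z1 - z2) * (- m * U) = (z1 - z2) * (S * c)"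
    proof -
      have "(z1 - z2) * (- m * U) = (- (m * z1) + m * z2) * U" by (simp add: algebra_simps)
      also have "\<dots> = c * ((t1 - t2) * U)" unfolding mc[symmetric] by simp
      finally show ?thesis unfolding US by (simp add: algebra_simps)
    qed
    moreover have "z1 - z2 \<noteq> 0" using False by simp
    ultimately show ?thesis using mult_left_cancel by blast
  qed
  then show "c \<noteq> 0" "- m * U = S * c" by auto
qed

text \<open>Substituting \<open>t = l * z + 1 / c\<close> into the equation at infinity gives a
  cubic in \<open>z\<close> with leading coefficient \<open>1 + A * l ^ 2 + B * l ^ 3\<close>, and
  the formula is its sum of roots. Here \<open>(x3, y3)\<close> is the third intersection itself,
  not its reflection.\<close>

lemma sum_at_infinity:
  fixes x1 y1 x2 y2 A B l c :: "'a::field_char_0"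
  defines "m \<equiv> - (l * c)"
  assumes e1: "y1 ^ 2 = x1 ^ 3 + A * x1 + B"
    and y1: "y1 = m * x1 + c" and y2: "y2 = m * x2 + c"
    and m2: "m * (y1 + y2) = x1 ^ 2 + x1 * x2 + x2 ^ 2 + A"
    and x3: "x3 = m ^ 2 - x1 - x2" and y3: "y3 = m * x3 + c"
    and nz: "c \<noteq> 0" "1 + A * l ^ 2 + B * l ^ 3 \<noteq> 0" "y1 \<noteq> 0" "y2 \<noteq> 0"
  shows "y3 \<noteq> 0"
    "x1 / y1 + x2 / y2 + x3 / y3 = - ((2 * A + 3 * B * l) * (l * (1 / c)) / (1 + A * l ^ 2 + B * l ^ 3))"
proof -
  define D where "D = 1 + A * l ^ 2 + B * l ^ 3"
  have D: "D \<noteq> 0" using nz by (simp add: D_def)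
  \<comment> \<open>\<open>v1\<close>, \<open>v2\<close>, \<open>v3\<close> are the relations of
    Vieta for \<open>x^3 + A x + B - (m x + c)^2\<close>.\<close>
  have v1: "m ^ 2 = x1 + x2 + x3" by (simp add: x3)
  have v2: "x1 * x2 + x1 * x3 + x2 * x3 = A - 2 * m * c"
  proof -
    have "x1 * x2 + x1 * x3 + x2 * x3 - (A - 2 * m * c) = m * (y1 + y2) - (x1 ^ 2 + x1 * x2 + x2 ^ 2 + A)"
      unfolding y1 y2 x3 by (simp add: ring_expand)
    then show ?thesis unfolding m2 by simp
  qed
  have v3: "x1 * x2 * x3 = c ^ 2 - B"
  proof -
    have "x1 * x2 * x3 - (c ^ 2 - B) = x1 * ((x1 * x2 + x1 * x3 + x2 * x3) - (A - 2 * m * c)) + x1 ^ 2 * (m ^ 2 - (x1 + x2 + x3))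
       - (y1 ^ 2 - (x1 ^ 3 + A * x1 + B))"
      unfolding y1 by (simp add: ring_expand)
    also have "\<dots> = 0" unfolding v1 v2 e1 by simp
    finally show ?thesis by simp
  qed
  have yyy: "y1 * y2 * y3 = c ^ 3 * D"
  proof -
    have "y1 * y2 * y3 = m ^ 3 * (x1 * x2 * x3) + m ^ 2 * c * (x1 * x2 + x1 * x3 + x2 * x3) + m * c ^ 2 * (x1 + x2 + x3) + c ^ 3"
      unfolding y1 y2 y3 by (simp add: ring_expand)
    also have "\<dots> = c ^ 3 * D"
      unfolding v1[symmetric] v2 v3 D_def m_def by (simp add: ring_expand)
    finally show ?thesis .
  qed
  then show y30: "y3 \<noteq> 0" using nz D by auto
  define z where "z = x1 / y1 + x2 / y2 + x3 / y3"
  have "z * (y1 * y2 * y3) = x1 * y2 * y3 + x2 * y1 * y3 + x3 * y1 * y2"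
    unfolding z_def using nz y30 by (simp add: distrib_right)
  also have "\<dots> = 3 * m ^ 2 * (x1 * x2 * x3) + 2 * m * c * (x1 * x2 + x1 * x3 + x2 * x3) + c ^ 2 * (x1 + x2 + x3)"
    unfolding y1 y2 y3 by (simp add: ring_expand)
  also have "\<dots> = c ^ 2 * (- ((2 * A + 3 * B * l) * l))"
    unfolding v1[symmetric] v2 v3 m_def by (simp add: ring_expand)
  finally have "c ^ 2 * (z * (c * D)) = c ^ 2 * (- ((2 * A + 3 * B * l) * l))"
    unfolding yyy by (simp add: power2_eq_square power3_eq_cube mult_ac)
  then have "z * (c * D) = - ((2 * A + 3 * B * l) * l)" using nz(1) by (simp only: mult_cancel_left power_eq_0_iff) auto
  moreover have "z = z * (c * D) / (c * D)" using D nz(1) by simp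
  ultimately have "z = - ((2 * A + 3 * B * l) * l) / (c * D)" by (simp only:)
  then show "x1 / y1 + x2 / y2 + x3 / y3 = - ((2 * A + 3 * B * l) * (l * (1 / c)) / (1 + A * l ^ 2 + B * l ^ 3))"
    by (simp add: z_def D_def)
qed

text \<open>\<open>a1\<close>, \<open>a2\<close>, \<open>a3\<close> are responsible for the terms of
  orders 2 to 4 in the addition of \<open>x / y\<close>. Without them the error starts at order 5,
  which suffices against \<open>w p = 2\<close>.\<close>

locale short_ramified_curve = ramified_curve +
  assumes short: "a1 W = 0" "a2 W = 0" "a3 W = 0" and p_ge: "p \<ge> 5"
begin

lemma C_short: "a1 C = 0" "a2 C = 0" "a3 C = 0"
  using short by (simp_all add: C_sel)

text \<open>Up to sign the parameter at infinity.\<close>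

fun zz :: "complex point \<Rightarrow> complex" where
  "zz Infinity = 0"
| "zz (Affine x y) = x / y"

lemma kernel_zz:
  assumes "P \<in> kernel"
  shows "zz P \<noteq> 0" "w (zz P) \<ge> 1" "zz P \<in> K"
proof -
  obtain x y where P: "P = Affine x y" "on_curve C (Affine x y)" "x \<in> K" "y \<in> K" "x \<notin> V 0"
    using assms by (auto simp: kernel_def)
  obtain r where "r \<ge> 1" "w x = - 2 * r" "w y = - 3 * r" "x \<noteq> 0" "y \<noteq> 0"
    using kernel_w[OF P(2-5)] by blast
  then show "zz P \<noteq> 0" "w (zz P) \<ge> 1" "zz P \<in> K" using P by (auto simp: w_divide)
qed

text \<open>At infinity the line has slope \<open>l = S / U\<close> in \<open>V (2 * r)\<close>,
  because \<open>S\<close> is small to second order and \<open>U\<close> is a unit, and intercept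
  \<open>n = t1 - l * z1\<close> in \<open>V (3 * r)\<close>. By \<open>sum_at_infinity\<close> the
  three parameters add up to a multiple of \<open>l * n\<close>.\<close>

lemma zz_add_point:
  assumes r: "r \<ge> 1" and P1: "Affine x1 y1 \<in> kernel" "x1 / y1 \<in> V r" and P2: "Affine x2 y2 \<in> kernel" "x2 / y2 \<in> V r"
    and no: "x1 = x2 \<Longrightarrow> y1 + y2 \<noteq> 0"
  shows "add_point C (Affine x1 y1) (Affine x2 y2) \<in> kernel"
    "zz (add_point C (Affine x1 y1) (Affine x2 y2)) - x1 / y1 - x2 / y2 \<in> V (5 * r)"
proof -
  have on: "on_curve C (Affine x1 y1)" "on_curve C (Affine x2 y2)"
    and K: "x1 \<in> K" "y1 \<in> K" "x2 \<in> K" "y2 \<in> K" and nV: "x1 \<notin> V 0" "x2 \<notin> V 0"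
    using P1 P2 by (auto simp: kernel_def)
  have no': "x1 = x2 \<Longrightarrow> y1 + y2 + a1 C * x1 + a3 C \<noteq> 0" using no by (simp add: C_short)
  obtain m where m: "is_slope C m x1 y1 x2 y2" using slope_exists[OF on no'] by blast
  have mK: "m \<in> K" by (rule slope_in_K[OF on K no' m])
  have sum: "add_point C (Affine x1 y1) (Affine x2 y2) = third_point C m x1 y1 x2"
    by (rule add_point_slope[OF on no' m])
  define A where "A = a4 C"
  define B where "B = a6 C"
  have AB: "A \<in> V 0" "B \<in> V 0" by (simp_all add: A_def B_def)
  have e1: "y1 ^ 2 = x1 ^ 3 + A * x1 + B" and e2: "y2 ^ 2 = x2 ^ 3 + A * x2 + B"
    using on by (simp_all add: C_short A_def B_def)
  have m1: "m * (x1 - x2) = y1 - y2" and m2: "m * (y1 + y2) = x1 ^ 2 + x1 * x2 + x2 ^ 2 + A"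
    using m by (simp_all add: is_slope_def C_short A_def)
  define z1 where "z1 = x1 / y1"
  define z2 where "z2 = x2 / y2"
  define t1 where "t1 = inverse y1"
  define t2 where "t2 = inverse y2"
  have zV: "z1 \<in> V r" "z2 \<in> V r" using P1 P2 by (simp_all add: z1_def z2_def)
  have y0: "y1 \<noteq> 0" "y2 \<noteq> 0" and tV: "t1 \<in> V (3 * r)" "t2 \<in> V (3 * r)"
  proof -
    obtain r1 where r1: "r1 \<ge> 1" "w x1 = - 2 * r1" "w y1 = - 3 * r1" "x1 \<noteq> 0" "y1 \<noteq> 0"
      using kernel_w[OF on(1) K(1,2) nV(1)] by blast
    obtain r2 where r2: "r2 \<ge> 1" "w x2 = - 2 * r2" "w y2 = - 3 * r2" "x2 \<noteq> 0" "y2 \<noteq> 0"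
      using kernel_w[OF on(2) K(3,4) nV(2)] by blast
    show "y1 \<noteq> 0" "y2 \<noteq> 0" by fact+
    have "r \<le> r1" "r \<le> r2" using zV r1 r2 K by (auto simp: z1_def z2_def V_def w_divide)
    then show "t1 \<in> V (3 * r)" "t2 \<in> V (3 * r)" using r1 r2 K by (auto simp: t1_def t2_def V_def w_inverse)
  qed
  define c where "c = y1 - m * x1"
  have y1: "y1 = m * x1 + c" by (simp add: c_def)
  have y2: "y2 = m * x2 + c" using m1 by (simp add: c_def algebra_simps)
  define U where "U = 1 - A * z2 * (t1 + t2) - B * (t1 ^ 2 + t1 * t2 + t2 ^ 2)"
  define S where "S = z1 ^ 2 + z1 * z2 + z2 ^ 2 + A * t1 ^ 2"
  have zV0: "z1 \<in> V 0" "z2 \<in> V 0" "t1 \<in> V 0" "t2 \<in> V 0" "t1 \<in> V 1" "t2 \<in> V 1"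
    using zV tV r V_mono by force+
  have U: "U \<noteq> 0" "w U = 0" "U \<in> K"
  proof -
    have "- (A * z2 * (t1 + t2)) - B * (t1 * t1 + t1 * t2 + t2 * t2) \<in> V 1"
      unfolding V_uminus by (intro V_diff V_add V_mult0[of _ 1] V_mult0[of _ 0]; (subst V_uminus)?) (use AB zV0 in \<open>auto intro!: V_mult0\<close>)
    then have *: "- (A * z2 * (t1 + t2)) - B * (t1 * t1 + t1 * t2 + t2 * t2) \<in> V (w 1 + 1)" by simp
    have "U = 1 + (- (A * z2 * (t1 + t2)) - B * (t1 * t1 + t1 * t2 + t2 * t2))"
      by (simp add: U_def power2_eq_square)
    with w_add_dominant[OF _ _ *] V_in[OF *] show "U \<noteq> 0" "w U = 0" "U \<in> K" by simp_all
  qed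
  have S: "S \<in> V (2 * r)" unfolding S_def power2_eq_square
  proof (intro V_add)
    show "z1 * z1 \<in> V (2 * r)" "z1 * z2 \<in> V (2 * r)" "z2 * z2 \<in> V (2 * r)"
      by (rule V_mult[OF zV(1) zV(1)] V_mult[OF zV(1) zV(2)] V_mult[OF zV(2) zV(2)]; simp)+
    show "A * (t1 * t1) \<in> V (2 * r)"
      by (intro V_mult0 AB V_mult[OF tV(1) tV(1)]) (use r in simp)
  qed
  note sl = slope_at_infinity[OF y0 e1 e2 y1 y2 m2, folded z1_def z2_def t1_def t2_def, folded U_def S_def, OF U(1)]
  note c0 = sl(1) and mU = sl(2)
  define l where "l = - m / c"
  define n where "n = 1 / c"
  have "l = S / U" using mU c0 U by (simp add: l_def field_simps)
  then have lV: "l \<in> V (2 * r)" using V_divide[OF S U(3,1)] U(2) by simp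
  have ml: "m = - l * c" using c0 by (simp add: l_def)
  have line: "t = l * z + n" if "m * z + c * t = 1" for z t
  proof -
    have "c * t = 1 - m * z" using that by (metis add_diff_cancel_left')
    then have "t = (1 - m * z) / c" using c0 by (simp add: eq_divide_eq mult.commute)
    then show ?thesis by (simp add: l_def n_def diff_divide_distrib)
  qed
  have nV: "n \<in> V (3 * r)"
  proof -
    have "m * z1 + c * t1 = (m * x1 + c) / y1"
      by (simp only: z1_def t1_def divide_inverse distrib_right mult.assoc)
    also have "\<dots> = 1" unfolding y1[symmetric] using y0 by simp
    finally have "n = t1 - l * z1" using line[of z1 t1] by simp
    then show ?thesis using tV(1) V_mult[OF lV zV(1)] by auto
  qed
  define D where "D = 1 + A * l ^ 2 + B * l ^ 3"
  have lV1: "l \<in> V 1" "l \<in> V 0" using lV r V_mono by force+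
  have D: "D \<noteq> 0" "w D = 0" "D \<in> K"
  proof -
    have "A * l ^ 2 + B * l ^ 3 \<in> V (w 1 + 1)"
      using V_power'[OF lV1(1), of 1 2] V_power'[OF lV1(1), of 1 3] AB by (intro V_add V_mult0) auto
    from w_add_dominant[OF _ _ this] V_in[OF this] show "D \<noteq> 0" "w D = 0" "D \<in> K"
      by (simp_all add: D_def add.assoc)
  qed
  define x3 where "x3 = m ^ 2 - x1 - x2"
  define y3 where "y3 = m * x3 + c"
  have tp: "third_point C m x1 y1 x2 = Affine x3 (- y3)"
    by (simp add: third_point_def Let_def C_short x3_def y3_def c_def algebra_simps)
  have cK: "c \<in> K" "x3 \<in> K" "y3 \<in> K" using mK K by (auto simp: c_def x3_def y3_def)
  have ml': "m = - (l * c)" using ml by simp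
  note sm = sum_at_infinity[of y1 x1 A B l c y2 x2 x3 y3, folded ml' D_def, OF e1 y1 y2 m2 x3_def y3_def c0 D(1) y0]
  note y30 = sm(1)
  define z3 where "z3 = x3 / y3"
  have zs: "z1 + z2 + z3 = - ((2 * A + 3 * B * l) * (l * n) / D)"
    using sm(2) by (simp only: z1_def z2_def z3_def n_def)
  have zsV: "z1 + z2 + z3 \<in> V (5 * r)"
  proof -
    have "2 * A + 3 * B * l \<in> V 0" using AB lV1 by (intro V_add V_mult0) auto
    then have "(2 * A + 3 * B * l) * (l * n) \<in> V (5 * r)"
      by (rule V_mult0) (rule V_mult[OF lV nV], simp)
    then have "(2 * A + 3 * B * l) * (l * n) / D \<in> V (5 * r)" using D by (intro V_divide[of _ "5 * r"]) auto
    then show ?thesis unfolding zs by simp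
  qed
  show "zz (add_point C (Affine x1 y1) (Affine x2 y2)) - x1 / y1 - x2 / y2 \<in> V (5 * r)"
  proof -
    have "zz (add_point C (Affine x1 y1) (Affine x2 y2)) - x1 / y1 - x2 / y2 = - (z1 + z2 + z3)"
      unfolding sum tp by (simp add: z1_def z2_def z3_def)
    then show ?thesis using zsV V_uminus by metis
  qed
  have z3V: "z3 \<in> V r"
  proof -
    have "z3 = (z1 + z2 + z3) - z1 - z2" by simp
    also have "\<dots> \<in> V r" using V_diff[OF V_diff[OF V_mono[OF zsV] zV(1)] zV(2)] r by simp
    finally show ?thesis .
  qed
  have on3: "on_curve C (Affine x3 (- y3))" using on_curve_add[OF on] unfolding sum tp .
  have "x3 \<notin> V 0"
  proof
    assume "x3 \<in> V 0"
    then have "- y3 \<in> V 0" using integral_y[OF on3] cK by simp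
    then have yV: "y3 \<in> V 0" by simp
    have "m * z3 + c * (1 / y3) = (m * x3 + c) / y3" by (simp add: z3_def add_divide_distrib)
    also have "\<dots> = 1" unfolding y3_def[symmetric] using y30 by simp
    finally have "1 / y3 = l * z3 + n" by (rule line)
    also have "\<dots> \<in> V 1" using V_add[OF V_mult[OF lV z3V] V_mono[OF nV]] r by simp
    finally have "y3 * (1 / y3) \<in> V 1" by (rule V_mult0[OF yV])
    then show False using y30 by (simp add: V_def)
  qed
  then show "add_point C (Affine x1 y1) (Affine x2 y2) \<in> kernel"
    unfolding sum tp using on3 cK by (auto simp: kernel_def)
qed

lemma pow_level:
  assumes r: "r \<ge> 1" and P: "P \<in> kernel" "zz P \<in> V r"
  shows "(P [^]\<^bsub>G\<^esub> n = Infinity \<or> P [^]\<^bsub>G\<^esub> n \<in> kernel) \<and> zz (P [^]\<^bsub>G\<^esub> n) - of_nat n * zz P \<in> V (5 * r)"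
proof (induction n)
  case 0
  show ?case by (simp add: G_simps)
next
  case (Suc n)
  define Q where "Q = P [^]\<^bsub>G\<^esub> n"
  obtain x y where Pxy: "P = Affine x y" using P by (auto simp: kernel_def)
  have QP: "P [^]\<^bsub>G\<^esub> Suc n = add_point C Q P" by (simp add: Q_def G_simps)
  have zQ: "zz Q - of_nat n * zz P \<in> V (5 * r)" using Suc by (simp add: Q_def)
  have "(add_point C Q P = Infinity \<or> add_point C Q P \<in> kernel) \<and> zz (add_point C Q P) - zz Q - zz P \<in> V (5 * r)"
  proof (cases Q)
    case Infinity
    then show ?thesis using P by simp
  next
    case (Affine x' y')
    then have Qk: "Q \<in> kernel" using Suc by (simp add: Q_def)
    have QV: "zz Q \<in> V r"
    proof -
      have "zz Q = (zz Q - of_nat n * zz P) + of_nat n * zz P" by simp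
      also have "\<dots> \<in> V r" using zQ r P by (intro V_add V_mult0) (auto elim!: V_mono)
      finally show ?thesis .
    qed
    show ?thesis
    proof (cases "x' = x \<and> y' + y = 0")
      case True
      then have "add_point C Q P = Infinity" unfolding Affine Pxy
        by (metis C_short(1,3) add_point_opposite add.right_neutral mult_zero_left)
      moreover have "y' = - y" "x' = x" using True by (auto simp: eq_neg_iff_add_eq_0)
      ultimately show ?thesis by (simp add: Affine Pxy)
    next
      case False
      then show ?thesis
        using zz_add_point[OF r, of x' y' x y] Qk QV P unfolding Affine Pxy by simp
    qed
  qed
  moreover have "zz (add_point C Q P) - of_nat (Suc n) * zz P =
     (zz (add_point C Q P) - zz Q - zz P) + (zz Q - of_nat n * zz P)" by (simp add: algebra_simps)
  ultimately show ?case unfolding QP using zQ by (metis V_add)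
qed

text \<open>If \<open>k\<close> annihilates \<open>P\<close>, then \<open>k * zz P\<close> is in
  \<open>V (5 * r)\<close>, so \<open>w k \<ge> 4 * r \<ge> 4\<close>. Hence \<open>p\<close>
  divides \<open>n\<close>, but \<open>w p = 2\<close> shows that \<open>p\<close> does not
  annihilate \<open>P\<close>. The induction continues with the multiple of \<open>P\<close> by
  \<open>p\<close> and \<open>n / p\<close>.\<close>

lemma kernel_torsion_free:
  fixes n :: nat
  assumes "P \<in> kernel" "n > 0" "P [^]\<^bsub>G\<^esub> n = Infinity"
  shows False
  using assms
proof (induction n arbitrary: P rule: less_induct)
  case (less n)
  define r where "r = w (zz P)"
  have r: "r \<ge> 1" "zz P \<noteq> 0" "zz P \<in> K" "zz P \<in> V r"
    using kernel_zz[OF less.prems(1)] V_w by (auto simp: r_def)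
  have wn: "w (of_nat k) \<ge> 4 * r" if "P [^]\<^bsub>G\<^esub> k = Infinity" "k > 0" for k :: nat
  proof -
    have "of_nat k * zz P \<in> V (5 * r)" using pow_level[OF r(1) less.prems(1) r(4), of k] that by simp
    moreover have "of_nat k * zz P \<noteq> 0" using r(2) that(2) by simp
    ultimately have "w (of_nat k * zz P) \<ge> 5 * r" by (simp add: V_def)
    moreover have "w (of_nat k * zz P) = w (of_nat k) + r"
      unfolding r_def by (rule w_mult) (use r(2,3) that(2) in auto)
    ultimately show ?thesis by linarith
  qed
  have "w (of_nat n) \<ge> 4" using wn[OF less.prems(3,2)] r(1) by linarith
  then have "multiplicity (int p) (int n) \<noteq> 0" using w_of_nat[OF less.prems(2)] by linarith
  then have "p dvd n" using not_dvd_imp_multiplicity_0[of "int p" "int n"] by (metis int_dvd_int_iff)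
  then obtain k where k: "n = p * k" by (elim dvdE)
  have p0: "p > 0" using p_ge by simp
  have "w (of_nat p) = 2"
  proof -
    have "multiplicity (int p) (int p) = 1"
      by (rule multiplicity_self) (use prime_gt_1_nat[OF prime_p] in auto)
    then show ?thesis using w_of_nat[OF p0] by simp
  qed
  then have "P [^]\<^bsub>G\<^esub> p \<noteq> Infinity" using wn[of p] r(1) p0 by fastforce
  then have "P [^]\<^bsub>G\<^esub> p \<in> kernel" using pow_level[OF r(1) less.prems(1) r(4), of p] by blast
  moreover have "(P [^]\<^bsub>G\<^esub> p) [^]\<^bsub>G\<^esub> k = Infinity"
    using less.prems(3) G.nat_pow_pow[OF kernel_carrier[OF less.prems(1)], of p k] by (simp add: k)
  moreover have "k < n" "k > 0" using k less.prems(2) p_ge by auto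
  ultimately show False using less.IH by blast
qed

end

section \<open>Descent through a 2-isogeny\<close>

context ramified_prime
begin

lemma w_Rats_even: "z \<in> \<rat> \<Longrightarrow> z \<noteq> 0 \<Longrightarrow> even (w z)"
  by (elim Rats_cases) (auto simp: w_of_rat)

lemma Rats_K: "z \<in> \<rat> \<Longrightarrow> z \<in> K"
  by (elim Rats_cases) auto

lemma conj_anti_invariant:
  assumes "z \<in> K" "conj z = - z"
  obtains r where "r \<in> \<rat>" "z = r * s"
proof
  have "conj (z / s) = z / s" using assms by (simp add: conj_divide conj_s)
  then show "z / s \<in> \<rat>" using conj_eq_self_iff[of "z / s"] assms by simp
  show "z = z / s * s" using s_nonzero by simp
qed

lemma Rats_residue_two:
  assumes p2: "p = 2" and z: "z \<in> \<rat>" "z \<in> V 0"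
  shows "z \<in> V 2 \<or> z - 1 \<in> V 2"
proof -
  from z(1) obtain q where q: "z = of_rat q" by (elim Rats_cases)
  obtain a b where ab: "b > 0" "q = of_int a / of_int b" "quotient_of q = (a, b)" by (rule rat_quotient)
  have "p_integral p q" using z(2) by (auto simp: q V_of_rat p_integral_iff[OF prime_p])
  then have b: "odd b" using ab p2 by (simp add: p_integral_def)
  have *: "of_rat (of_int c / of_int b) \<in> V 2" if "even c" for c
    unfolding V_of_rat
  proof
    assume "(of_int c / of_int b :: rat) \<noteq> 0"
    then have "c \<noteq> 0" by auto
    have "multiplicity (int p) b = 0" using b p2 by (simp add: not_dvd_imp_multiplicity_0)
    moreover have "multiplicity (int p) c \<ge> 1" using that p2 \<open>c \<noteq> 0\<close> by (intro multiplicity_geI) auto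
    ultimately show "2 \<le> 2 * vq p (of_int c / of_int b)"
      using vq_divide[OF prime_p \<open>c \<noteq> 0\<close>, of b] ab(1) by simp
  qed
  show ?thesis
  proof (cases "even a")
    case True
    then show ?thesis using *[of a] by (simp add: q ab(2))
  next
    case False
    then have "even (a - b)" using b by simp
    moreover have "z - 1 = of_rat (of_int (a - b) / of_int b)"
      unfolding q ab(2) using ab(1) by (simp add: diff_divide_distrib of_rat_diff of_rat_divide)
    ultimately show ?thesis using *[of "a - b"] by simp
  qed
qed

text \<open>For rationals and \<open>p = 2\<close>, membership in \<open>V 2\<close> and
  \<open>V 4\<close> is divisibility by 2 and 4; both factors \<open>z - 1\<close> and
  \<open>z + 1\<close> are even.\<close>

lemma unit_square_mod_four:
  assumes p2: "p = 2" and z: "z \<in> \<rat>" "z \<noteq> 0" "w z = 0"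
  shows "z ^ 2 - 1 \<in> V 4"
proof -
  have zV: "z \<in> V 0" using z Rats_K by (simp add: V_def)
  have "z \<notin> V 2" using z by (simp add: V_def)
  then have z1: "z - 1 \<in> V 2" using Rats_residue_two[OF p2 z(1) zV] by blast
  have w2: "w 2 = 2" using w_of_nat[of 2] p2 by simp
  have "(z - 1) * ((z - 1) + 2) \<in> V 4"
  proof (rule V_mult[OF z1])
    show "(z - 1) + 2 \<in> V 2" using z1 w2 by (intro V_add) (auto simp: V_def)
  qed simp
  then show ?thesis by (simp add: power2_eq_square algebra_simps)
qed

text \<open>
  The quartic \<open>\<delta>\<^sup>2 = \<mu>\<^sup>4 - 4 a \<mu>\<^sup>2 + c\<close> is the homogeneous space of the 2-isogeny; the parity of the
  valuations only leaves \<open>w \<mu> \<in> {3, 5}\<close>, where one compares both sides modulo 4.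
\<close>

lemma no_descent:
  assumes p2: "p = 2" and \<mu>: "\<mu> \<in> K" "conj \<mu> = - \<mu>" and \<delta>: "\<delta> \<in> K" "conj \<delta> = - \<delta>"
    and a: "a \<in> \<rat>" "a + 1 \<in> V 4" and c: "c \<in> \<rat>" "c \<noteq> 0" "w c = 16"
    and eq: "\<delta> ^ 2 = \<mu> ^ 4 - 4 * a * \<mu> ^ 2 + c"
  shows False
proof -
  have w2: "w 2 = 2" using w_of_nat[of 2] p2 by simp
  have w4: "w 4 = 4" using w_mult[of 2 2] w2 by simp
  have w8: "w 8 = 6" using w_mult[of 2 4] w2 w4 by simp
  have cK: "c \<in> K" "a \<in> K" using a c Rats_K by auto
  have a0: "a \<noteq> 0" "w a = 0"
  proof -
    have "a + 1 \<in> V (w (-1) + 1)" using V_mono[OF a(2)] by simp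
    from w_add_dominant[OF _ _ this] show "a \<noteq> 0" "w a = 0" by auto
  qed
  have w_anti: "odd (w z)" if z: "z \<in> K" "conj z = - z" "z \<noteq> 0" for z
  proof -
    obtain r where r: "r \<in> \<rat>" "z = r * s" by (rule conj_anti_invariant[OF z(1,2)])
    then show ?thesis using z w_Rats_even[OF r(1)] Rats_K[OF r(1)] s_nonzero by (simp add: w_mult w_s)
  qed
  \<comment> \<open>A nonzero anti-invariant element is a rational multiple of \<open>s\<close> and
    has odd valuation, so the valuation of its square is 2 modulo 4.\<close>
  have even_w: False if "\<delta> ^ 2 \<noteq> 0" "w (\<delta> ^ 2) = 4 * k" for k
  proof -
    have "w (\<delta> ^ 2) = 2 * w \<delta>" using that \<delta> by (simp add: w_power)
    then have "w \<delta> = 2 * k" using that by simp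
    moreover have "odd (w \<delta>)" using w_anti \<delta> that by auto
    ultimately show False by simp
  qed
  have \<mu>0: "\<mu> \<noteq> 0"
  proof
    assume "\<mu> = 0"
    then have "\<delta> ^ 2 = c" using eq by simp
    then show False using even_w[of 4] c by simp
  qed
  have k: "odd (w \<mu>)" by (rule w_anti[OF \<mu> \<mu>0])
  have t1: "\<mu> ^ 4 \<noteq> 0" "w (\<mu> ^ 4) = 4 * w \<mu>" "\<mu> ^ 4 \<in> K" using \<mu> \<mu>0 by (auto simp: w_power)
  have t2: "4 * a * \<mu> ^ 2 \<noteq> 0" "w (4 * a * \<mu> ^ 2) = 4 + 2 * w \<mu>" "4 * a * \<mu> ^ 2 \<in> K"
    using \<mu> \<mu>0 a0 cK by (auto simp: w_mult w_power w4)
  have in_V: "z \<in> V l" if "z \<in> K" "w z \<ge> l" for z l using that by (simp add: V_def)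
  \<comment> \<open>With \<open>k = w \<mu>\<close> the three terms have valuations
    \<open>4 k\<close>, \<open>4 + 2 k\<close> and 16. The first is smallest for
    \<open>k \<le> 1\<close>, the last for \<open>k \<ge> 7\<close>, and the middle one for
    \<open>k = 3\<close> and \<open>k = 5\<close>.\<close>
  have "w \<mu> \<le> 1 \<or> w \<mu> = 3 \<or> w \<mu> = 5 \<or> w \<mu> \<ge> 7"
    using k by presburger
  then consider "w \<mu> \<le> 1" | "w \<mu> = 3" | "w \<mu> = 5" | "w \<mu> \<ge> 7" by blast
  then show False
  proof cases
    case 1
    have "c - 4 * a * \<mu> ^ 2 \<in> V (w (\<mu> ^ 4) + 1)"
      by (intro V_diff in_V) (use t1 t2 c cK 1 in auto)
    from w_add_dominant[OF t1(3,1) this] show False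
      using even_w[of "w \<mu>"] t1 by (simp add: eq algebra_simps)
  next
    case 4
    have "\<mu> ^ 4 - 4 * a * \<mu> ^ 2 \<in> V (w c + 1)"
      by (intro V_diff in_V) (use t1 t2 c cK 4 in auto)
    from w_add_dominant[OF cK(1) c(2) this] show False
      using even_w[of 4] c by (simp add: eq algebra_simps)
  next
    case 2
    have "\<mu> ^ 4 + c \<in> V (w (- (4 * a * \<mu> ^ 2)) + 1)"
      by (intro V_add in_V) (use t1 t2 c cK 2 in auto)
    from w_add_dominant[OF _ _ this] have "\<delta> ^ 2 \<noteq> 0" "w (\<delta> ^ 2) = 10"
      using t2 2 by (auto simp: eq algebra_simps)
    then have wd: "\<delta> \<noteq> 0" "w \<delta> = 5" using \<delta> by (auto simp: w_power)
    obtain r where r: "r \<in> \<rat>" "\<mu> = r * s" by (rule conj_anti_invariant[OF \<mu>])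
    obtain t where t: "t \<in> \<rat>" "\<delta> = t * s" by (rule conj_anti_invariant[OF \<delta>])
    \<comment> \<open>Since \<open>w s = 1\<close>, the rational factors \<open>r\<close> and
      \<open>t\<close> have valuations 2 and 4, the same as the divisors 2 and 4; so
      \<open>u\<close> and \<open>v\<close> are units.\<close>
    define u where "u = r / 2"
    define v where "v = t / 4"
    have nz: "r \<noteq> 0" "t \<noteq> 0" using \<mu>0 wd r t by auto
    have "w r = 2" "w t = 4"
      using 2 wd r t nz Rats_K s_nonzero by (auto simp: w_mult w_s)
    then have u: "u \<in> \<rat>" "u \<noteq> 0" "w u = 0" and v: "v \<in> \<rat>" "v \<noteq> 0" "w v = 0"
      using r t nz Rats_K w2 w4 by (auto simp: u_def v_def w_divide)
    have ms: "\<mu> = 2 * u * s" "\<delta> = 4 * v * s" using r t by (simp_all add: u_def v_def)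
    define D where "D = s * s"
    have D: "D \<in> K" "D \<noteq> 0" "w D = 2" using s_nonzero by (auto simp: D_def w_mult w_s)
    have "16 * D * v ^ 2 = 16 * D * (u ^ 4 * D - a * u ^ 2) + c"
      using eq unfolding ms D_def by (simp add: ring_expand)
    then have ceq: "c = 16 * D * v ^ 2 - 16 * D * (u ^ 4 * D - a * u ^ 2)" by simp
    have "c / (16 * D) = v ^ 2 - (u ^ 4 * D - a * u ^ 2)"
      unfolding ceq using D by (simp add: diff_divide_distrib)
    then have veq: "v ^ 2 = u ^ 4 * D - a * u ^ 2 + c / (16 * D)" by simp
    have uK: "u \<in> K" using u Rats_K by blast
    have u2: "u ^ 2 - 1 \<in> V 4" by (rule unit_square_mod_four[OF p2 u])
    have v2: "v ^ 2 - 1 \<in> V 4" by (rule unit_square_mod_four[OF p2 v])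
    have uV: "u ^ 2 \<in> V 0" "a \<in> V 0" using u uK a0 cK by (auto simp: V_def w_power)
    have c16: "c / (16 * D) \<in> V 4"
    proof -
      have "w (16 * D) = 10" using D w_mult[of 4 4] w4 by (simp add: w_mult)
      then show ?thesis using D c cK by (intro in_V) (auto simp: w_divide)
    qed
    \<comment> \<open>Modulo 4 the squares of \<open>u\<close> and \<open>v\<close> are 1,
      \<open>a\<close> is \<open>-1\<close> and the last term vanishes. The equation thus forces
      \<open>D\<close> to vanish modulo 4, while \<open>w D = 2\<close>.\<close>
    have "D = (v ^ 2 - 1) - (u ^ 2 + 1) * (u ^ 2 - 1) * D + (a + 1) * u ^ 2 - (u ^ 2 - 1) - c / (16 * D)"
      unfolding veq by (simp add: ring_expand)
    also have "\<dots> \<in> V 4"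
    proof -
      have "(u ^ 2 + 1) * (u ^ 2 - 1) \<in> V 4" using V_mult0[OF V_add[OF uV(1) V_1] u2] .
      then have "(u ^ 2 + 1) * (u ^ 2 - 1) * D \<in> V 4"
        by (rule V_mult[of _ 4 _ 0]) (use D in \<open>auto simp: V_def\<close>)
      moreover have "(a + 1) * u ^ 2 \<in> V 4" by (rule V_mult[OF a(2) uV(1)]) simp
      ultimately show ?thesis using V_diff[OF V_diff[OF V_add[OF V_diff[OF v2]] u2] c16] by blast
    qed
    finally show False using D by (simp add: V_def)
  next
    case 3
    have "\<mu> ^ 4 + c \<in> V (w (- (4 * a * \<mu> ^ 2)) + 1)"
      by (intro V_add in_V) (use t1 t2 c cK 3 in auto)
    from w_add_dominant[OF _ _ this] have "\<delta> ^ 2 \<noteq> 0" "w (\<delta> ^ 2) = 14"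
      using t2 3 by (auto simp: eq algebra_simps)
    then have wd: "\<delta> \<noteq> 0" "w \<delta> = 7" using \<delta> by (auto simp: w_power)
    obtain r where r: "r \<in> \<rat>" "\<mu> = r * s" by (rule conj_anti_invariant[OF \<mu>])
    obtain t where t: "t \<in> \<rat>" "\<delta> = t * s" by (rule conj_anti_invariant[OF \<delta>])
    define u where "u = r / 4"
    define v where "v = t / 8"
    have nz: "r \<noteq> 0" "t \<noteq> 0" using \<mu>0 wd r t by auto
    have "w r = 4" "w t = 6"
      using 3 wd r t nz Rats_K s_nonzero by (auto simp: w_mult w_s)
    then have u: "u \<in> \<rat>" "u \<noteq> 0" "w u = 0" and v: "v \<in> \<rat>" "v \<noteq> 0" "w v = 0"
      using r t nz Rats_K w4 w8 by (auto simp: u_def v_def w_divide)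
    have ms: "\<mu> = 4 * u * s" "\<delta> = 8 * v * s" using r t by (simp_all add: u_def v_def)
    define D where "D = s * s"
    have D: "D \<in> K" "D \<noteq> 0" "w D = 2" using s_nonzero by (auto simp: D_def w_mult w_s)
    have "64 * D * v ^ 2 = 64 * D * (4 * u ^ 4 * D - a * u ^ 2) + c"
      using eq unfolding ms D_def by (simp add: ring_expand)
    then have ceq: "c = 64 * D * v ^ 2 - 64 * D * (4 * u ^ 4 * D - a * u ^ 2)" by simp
    have "c / (64 * D) = v ^ 2 - (4 * u ^ 4 * D - a * u ^ 2)"
      unfolding ceq using D by (simp add: diff_divide_distrib)
    then have veq: "v ^ 2 = 4 * u ^ 4 * D - a * u ^ 2 + c / (64 * D)" by simp
    have uK: "u \<in> K" using u Rats_K by blast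
    have u2: "u ^ 2 - 1 \<in> V 4" by (rule unit_square_mod_four[OF p2 u])
    have v2: "v ^ 2 - 1 \<in> V 4" by (rule unit_square_mod_four[OF p2 v])
    have uV: "u ^ 2 \<in> V 0" "a \<in> V 0" using u uK a0 cK by (auto simp: V_def w_power)
    have "w (64 * D) = 14" using D w_mult[of 8 8] w8 by (simp add: w_mult)
    then have c64: "c / (64 * D) \<noteq> 0" "w (c / (64 * D)) = 2" using D c cK by (auto simp: w_divide)
    \<comment> \<open>Here the quartic term vanishes modulo 4 and the two squares cancel, so
      \<open>c / (64 * D)\<close>, of valuation 2, would have to vanish as well.\<close>
    have "c / (64 * D) = (v ^ 2 - 1) - (u ^ 2 - 1) + (a + 1) * u ^ 2 - 4 * (u ^ 4 * D)"
      unfolding veq by (simp add: ring_expand)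
    also have "\<dots> \<in> V 4"
    proof -
      have "4 * (u ^ 4 * D) \<in> V 4"
        by (intro in_V) (use D uK u w4 in \<open>auto simp: w_mult w_power\<close>)
      moreover have "(a + 1) * u ^ 2 \<in> V 4" by (rule V_mult[OF a(2) uV(1)]) simp
      ultimately show ?thesis using V_diff[OF V_add[OF V_diff[OF v2 u2]]] by blast
    qed
    finally show False using c64 by (simp add: V_def)
  qed
qed

end

section \<open>A rational point of order two in the kernel and the quartic of a half point\<close>

context ramified_curve
begin

lemma conj_neg_point:
  assumes "set_point P \<subseteq> K"
  shows "map_point conj (neg_point C P) = neg_point C (map_point conj P)"
  using assms by (cases P) (simp_all add: conj_diff conj_uminus conj_mult)

lemma set_point_conj: "set_point P \<subseteq> K \<Longrightarrow> set_point (map_point conj P) \<subseteq> K"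
  by (cases P) auto

lemma set_point_neg: "set_point P \<subseteq> K \<Longrightarrow> set_point (neg_point C P) \<subseteq> K"
  by (cases P) auto

text \<open>
  For a rational 2-torsion point \<open>(e\<^sub>0, f\<^sub>0)\<close> in the kernel of reduction, \<open>x = 4 (x' - e\<^sub>0)\<close> turns
  the curve into \<open>y\<^sup>2 = x (x\<^sup>2 + 2 a x + b)\<close> with \<open>a \<equiv> -1\<close> modulo 4.
\<close>

lemma kernel_two_torsion:
  assumes p2: "p = 2" and ker: "Affine e0 f0 \<in> kernel" and rat: "e0 \<in> \<rat>" "f0 \<in> \<rat>"
    and tors: "2 * f0 + a1 C * e0 + a3 C = 0"
  defines "a \<equiv> (12 * e0 + b2 C) / 2" and "b \<equiv> 48 * e0 ^ 2 + 8 * b2 C * e0 + 8 * b4 C"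
  shows "a \<in> \<rat>" "b \<in> \<rat>" "a + 1 \<in> V 4" "4 * a ^ 2 - 4 * b \<noteq> 0" "w (4 * a ^ 2 - 4 * b) = 16"
proof -
  have w2: "w 2 = 2" using w_of_nat[of 2] p2 by simp
  have w4: "w 4 = 4" using w_mult[of 2 2] w2 by simp
  have on: "on_curve C (Affine e0 f0)" and K: "e0 \<in> K" "f0 \<in> K" and nV: "e0 \<notin> V 0"
    using ker by (auto simp: kernel_def)
  obtain r where r: "r \<ge> 1" "w e0 = - 2 * r" "w f0 = - 3 * r" "e0 \<noteq> 0" "f0 \<noteq> 0"
    using kernel_w[OF on K nV] by blast
  have "even (w f0)" using w_Rats_even rat r by blast
  then have "even r" using r by simp
  have eV: "e0 \<in> V (- 2 * r)" using K r by (simp add: V_def)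
  have f: "2 * f0 = - (a1 C * e0 + a3 C)" 
  proof -
    have "2 * f0 = (2 * f0 + a1 C * e0 + a3 C) - (a1 C * e0 + a3 C)" by simp
    then show ?thesis unfolding tors by simp
  qed
  have "w (2 * f0) = 2 - 3 * r" using K r w2 by (simp add: w_mult)
  moreover have "2 * f0 \<in> V (- 2 * r)" unfolding f V_uminus
    using r by (intro V_add V_mult0 eV V_mono[OF C_V(3)]) auto
  \<comment> \<open>The bound is \<open>2 - 3 * r \<ge> - 2 * r\<close>. As \<open>r\<close> is
    even, \<open>r = 2\<close>; then \<open>w (2 * f0) = w e0 = -4\<close>, which makes
    \<open>a1\<close> a unit.\<close>
  ultimately have "r \<le> 2" using r by (simp add: V_def)
  then have r2: "r = 2" using \<open>even r\<close> r(1) by presburger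
  have a1: "a1 C \<noteq> 0 \<and> w (a1 C) = 0"
  proof (rule ccontr)
    assume "\<not> ?thesis"
    then have "a1 C \<in> V 1" using C_V(1) by (auto simp: V_def)
    then have "2 * f0 \<in> V (- 3)" unfolding f V_uminus
      by (intro V_add V_mult[OF _ eV] V_mono[OF C_V(3)]) (auto simp: r2)
    then show False using \<open>w (2 * f0) = _\<close> r r2 by (simp add: V_def)
  qed
  define e where "e = 4 * e0"
  have e: "e \<in> K" "e \<in> \<rat>" "e \<noteq> 0" "w e = 0" using K r r2 w4 rat by (auto simp: e_def w_mult)
  have eV: "e \<in> V 0" using e by (simp add: V_def)
  have Rats: "a1 C \<in> \<rat>" "a2 C \<in> \<rat>" "a3 C \<in> \<rat>" "a4 C \<in> \<rat>" "a6 C \<in> \<rat>" by (simp_all add: C_sel)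
  have bR: "b2 C \<in> \<rat>" "b4 C \<in> \<rat>" using Rats by (auto simp: b2_def b4_def)
  show "a \<in> \<rat>" "b \<in> \<rat>" using bR rat by (auto simp: a_def b_def)
  have bV: "b2 C \<in> V 0" "b4 C \<in> V 0" "b6 C \<in> V 0"
    unfolding b2_def b4_def b6_def by (intro V_add V_mult0 V_power; simp)+
  have root: "4 * e0 ^ 3 + b2 C * e0 ^ 2 + 2 * b4 C * e0 + b6 C = 0"
  proof -
    have "4 * e0 ^ 3 + b2 C * e0 ^ 2 + 2 * b4 C * e0 + b6 C = (2 * f0 + a1 C * e0 + a3 C) ^ 2
       - 4 * ((f0 ^ 2 + a1 C * e0 * f0 + a3 C * f0) - (e0 ^ 3 + a2 C * e0 ^ 2 + a4 C * e0 + a6 C))"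
      unfolding b2_def b4_def b6_def by (simp add: ring_expand)
    also have "\<dots> = 0" using tors on by simp
    finally show ?thesis .
  qed
  have V4: "4 * z \<in> V 4" if "z \<in> V 0" for z by (rule V_mult[of 4 4 z 0]) (use that w4 in \<open>auto simp: V_def\<close>)
  have b2_1: "b2 C - 1 \<in> V 4"
  proof -
    have "b2 C - 1 = (a1 C ^ 2 - 1) + 4 * a2 C" by (simp add: b2_def)
    also have "\<dots> \<in> V 4"
      by (intro V_add unit_square_mod_four[OF p2 Rats(1)] V4) (use a1 in auto)
    finally show ?thesis .
  qed
  define q where "q = 2 * b4 C * e + 4 * b6 C"
  have qV: "q / e ^ 2 \<in> V 0"
    by (rule V_divide[of _ 0]) (use bV eV e in \<open>auto simp: q_def w_power intro!: V_add V_mult0\<close>)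
  \<comment> \<open>The 2-division polynomial at \<open>e0\<close>, multiplied by 16 to make it
    monic in the unit \<open>e = 4 * e0\<close>.\<close>
  have "e ^ 2 * (e + b2 C) = - 4 * q"
  proof -
    have "e ^ 2 * (e + b2 C) + 4 * q = 16 * (4 * e0 ^ 3 + b2 C * e0 ^ 2 + 2 * b4 C * e0 + b6 C)"
      unfolding q_def e_def by (simp add: ring_expand)
    then show ?thesis unfolding root by (simp add: eq_neg_iff_add_eq_0)
  qed
  then have "(e + b2 C) * e ^ 2 = - 4 * q" by (simp add: mult.commute)
  then have "e + b2 C = - 4 * q / e ^ 2" using e by (simp only: eq_divide_eq) simp
  then have eq4: "e + b2 C = - (4 * (q / e ^ 2))" by simp
  moreover have "e = (e + b2 C) - b2 C" by simp
  ultimately have eb: "e = - b2 C - 4 * (q / e ^ 2)" by (metis diff_conv_add_uminus add.commute)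
  have q2: "q / e ^ 2 \<in> V 2"
  proof -
    have "q = 2 * (b4 C * e + 2 * b6 C)" by (simp add: q_def)
    also have "\<dots> \<in> V 2" by (rule V_mult[of 2 2 _ 0]) (use w2 bV eV in \<open>auto simp: V_def[of 2] intro!: V_add V_mult0\<close>)
    finally show ?thesis by (rule V_divide[of _ 2]) (use e in \<open>auto simp: w_power\<close>)
  qed
  \<comment> \<open>\<open>2 * a = 2 * e + (e + b2 C)\<close>, where
    \<open>e + b2 C = - 4 * q / e ^ 2\<close> with \<open>q\<close> in \<open>V 2\<close>, and
    \<open>b2 C\<close> is 1 modulo 4.\<close>
  have "2 * (a + 1) = 2 * (- (b2 C - 1) - 4 * (q / e ^ 2) - 2 * (q / e ^ 2))"
  proof -
    have "2 * (a + 1) = 2 * e + (e + b2 C) + 2" by (simp add: a_def e_def)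
    also have "\<dots> = 2 * (- b2 C - 4 * (q / e ^ 2)) + (- (4 * (q / e ^ 2))) + 2"
      using eb eq4 by metis
    finally show ?thesis by (simp add: algebra_simps)
  qed
  then have "a + 1 = - (b2 C - 1) - 4 * (q / e ^ 2) - 2 * (q / e ^ 2)" by (simp only: mult_cancel_left) simp
  also have "\<dots> \<in> V 4"
  proof (intro V_diff V4 qV)
    show "- (b2 C - 1) \<in> V 4" using b2_1 by (simp only: V_uminus)
    show "2 * (q / e ^ 2) \<in> V 4" by (rule V_mult[OF _ q2, of _ 2]) (use w2 in \<open>auto simp: V_def\<close>)
  qed
  finally show "a + 1 \<in> V 4" .
  have b: "b \<noteq> 0 \<and> w b = 0"
  proof -
    have w3: "w 3 = 0"
    proof -
      have "multiplicity (2::int) 3 = 0" by (rule not_dvd_imp_multiplicity_0) simp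
      then show ?thesis using w_of_nat[of 3] p2 by simp
    qed
    have 3: "w (3 * e ^ 2) = 0" "3 * e ^ 2 \<noteq> 0" using e w3 by (auto simp: w_mult w_power)
    have "2 * (b2 C * e + 4 * b4 C) \<in> V 1"
      by (rule V_mult[of 2 2 _ 0]) (use w2 bV eV in \<open>auto simp: V_def[of 2] intro!: V_add V_mult0\<close>)
    then have "2 * (b2 C * e + 4 * b4 C) \<in> V (w (3 * e ^ 2) + 1)" using 3 by simp
    from w_add_dominant[OF _ _ this] 3 e have "3 * e ^ 2 + 2 * (b2 C * e + 4 * b4 C) \<noteq> 0 \<and>
      w (3 * e ^ 2 + 2 * (b2 C * e + 4 * b4 C)) = 0" by auto
    moreover have "b = 3 * e ^ 2 + 2 * (b2 C * e + 4 * b4 C)" by (simp add: b_def e_def ring_expand)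
    ultimately show ?thesis by simp
  qed
  define c where "c = 4 * a ^ 2 - 4 * b"
  \<comment> \<open>The discriminant of \<open>y^2 = x (x^2 + 2 a x + b)\<close> is
    \<open>16 * b ^ 2 * c\<close>, and scaling with \<open>u = 1 / 2\<close> makes it
    \<open>2 ^ 12 * disc C\<close>.\<close>
  have "b ^ 2 * c = 256 * disc C"
  proof -
    have b6: "b6 C = - (4 * e0 ^ 3 + b2 C * e0 ^ 2 + 2 * b4 C * e0)"
    proof -
      have "b6 C = (4 * e0 ^ 3 + b2 C * e0 ^ 2 + 2 * b4 C * e0 + b6 C) - (4 * e0 ^ 3 + b2 C * e0 ^ 2 + 2 * b4 C * e0)"
        by simp
      then show ?thesis unfolding root by simp
    qed
    have c: "c = b2 C ^ 2 - 48 * e0 ^ 2 - 8 * b2 C * e0 - 32 * b4 C"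
      unfolding c_def a_def b_def by (simp add: power_divide) (simp add: ring_expand)
    have "b ^ 2 * c = 64 * (4 * disc C)"
      unfolding four_disc b6 unfolding c b_def by (simp add: ring_expand)
    then show ?thesis by simp
  qed
  moreover have "w 256 = 16"
    using w_mult[of 4 4] w_mult[of 16 16] w4 by simp
  ultimately have "b ^ 2 * c \<noteq> 0" "w (b ^ 2 * c) = 16" using disc_C by (auto simp: w_mult)
  moreover have "b \<in> K" "c \<in> K" using \<open>a \<in> \<rat>\<close> \<open>b \<in> \<rat>\<close> by (auto simp: c_def Rats_K)
  ultimately show "4 * a ^ 2 - 4 * b \<noteq> 0" "w (4 * a ^ 2 - 4 * b) = 16"
    using b by (auto simp: w_mult w_power simp flip: c_def)
qed

text \<open>As \<open>2 P\<close> is fixed, \<open>R = P - conj P\<close> has order two; so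
  \<open>conj R = - R = R\<close> is rational and \<open>conj P = P + R\<close>. The slope of the
  line through \<open>P\<close> and \<open>R\<close> then yields an anti-invariant
  \<open>\<mu>\<close>, the difference of the abscissae of \<open>P\<close> and
  \<open>conj P\<close> an anti-invariant \<open>\<delta>\<close>, and \<open>no_descent\<close>
  applies.\<close>

lemma no_half_point:
  assumes p2: "p = 2" and on: "on_curve C P" and PK: "set_point P \<subseteq> K" and ne: "map_point conj P \<noteq> P"
    and double: "map_point conj (add_point C P P) = add_point C P P"
  shows False
proof -
  obtain x y where P: "P = Affine x y" using ne by (cases P) auto
  have K: "x \<in> K" "y \<in> K" using PK P by auto
  define P' where "P' = map_point conj P"
  define R where "R = add_point C P (neg_point C P')"
  have on': "on_curve C P'" "set_point P' \<subseteq> K"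
    using on_curve_conj[OF on PK] set_point_conj[OF PK] by (simp_all add: P'_def)
  have ker: "R \<in> kernel"
    unfolding R_def P'_def P by (rule minus_conj_in_kernel) (use on P K ne p2 in auto)
  have car: "P \<in> carrier G" "P' \<in> carrier G" using on on' by (simp_all add: G_simps)
  have R: "R = P \<otimes>\<^bsub>G\<^esub> inv\<^bsub>G\<^esub> P'" using G_inv[OF on'(1)] by (simp add: R_def G_simps)
  have PP: "P' \<otimes>\<^bsub>G\<^esub> P' = P \<otimes>\<^bsub>G\<^esub> P"
    using conj_add_point[OF on on PK PK] double by (simp add: G_simps P'_def)
  have Rc: "R \<in> carrier G" using car R by simp
  have invR: "inv\<^bsub>G\<^esub> R = R"
  proof (rule G.inv_equality)
    have "R \<otimes>\<^bsub>G\<^esub> R = (P \<otimes>\<^bsub>G\<^esub> P) \<otimes>\<^bsub>G\<^esub> inv\<^bsub>G\<^esub> (P' \<otimes>\<^bsub>G\<^esub> P')"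
      unfolding R using car by (simp add: G.inv_mult G.m_ac)
    then show "R \<otimes>\<^bsub>G\<^esub> R = \<one>\<^bsub>G\<^esub>" unfolding PP using car by simp
  qed (use Rc in auto)
  have sum: "P' = P \<otimes>\<^bsub>G\<^esub> R"
  proof -
    have "P' = P \<otimes>\<^bsub>G\<^esub> inv\<^bsub>G\<^esub> R" 
    proof -
      have "inv\<^bsub>G\<^esub> R = inv\<^bsub>G\<^esub> P \<otimes>\<^bsub>G\<^esub> P'" unfolding R using car by (simp add: G.inv_mult)
      then show ?thesis using car by (simp flip: G.m_assoc)
    qed
    then show ?thesis by (simp add: invR)
  qed
  have conjR: "map_point conj R = R"
  proof -
    have "map_point conj P' = P"
      using K by (simp add: P'_def P conj_conj)
    then have "map_point conj R = add_point C P' (neg_point C P)"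
      unfolding R_def using conj_add_point[OF on _ PK set_point_neg[OF on'(2)]] on'
      by (simp add: conj_neg_point flip: P'_def)
    also have "\<dots> = P' \<otimes>\<^bsub>G\<^esub> inv\<^bsub>G\<^esub> P" using G_inv[OF on] by (simp add: G_simps)
    also have "\<dots> = inv\<^bsub>G\<^esub> R" unfolding R using car by (simp add: G.inv_mult G.m_comm)
    finally show ?thesis by (simp add: invR)
  qed
  obtain e0 f0 where Rxy: "R = Affine e0 f0" "e0 \<in> K" "f0 \<in> K" and onR: "on_curve C (Affine e0 f0)"
    using ker by (auto simp: kernel_def)
  have rat: "e0 \<in> \<rat>" "f0 \<in> \<rat>" using conjR Rxy conj_eq_self_iff by auto
  have "f0 = - f0 - a1 C * e0 - a3 C"
    using invR G_inv[OF onR] Rxy by simp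
  then have "f0 - (- f0 - a1 C * e0 - a3 C) = 0" by (metis right_minus_eq)
  then have tors: "2 * f0 + a1 C * e0 + a3 C = 0" by (simp add: algebra_simps)
  have xe: "x \<noteq> e0"
  proof
    assume xe: "x = e0"
    have "y + f0 + a1 C * x + a3 C = y - f0 + (2 * f0 + a1 C * e0 + a3 C)" by (simp add: xe)
    then have "y + f0 + a1 C * x + a3 C = y - f0" unfolding tors by simp
    moreover have "y = f0 \<or> y + f0 + a1 C * x + a3 C = 0"
      by (rule same_x) (use on onR P xe in \<open>simp_all only:\<close>)
    ultimately have "y = f0" by (metis right_minus_eq)
    then have "P = R" using xe P Rxy by simp
    then show False using conjR ne by simp
  qed
  define a where "a = (12 * e0 + b2 C) / 2"
  define b where "b = 48 * e0 ^ 2 + 8 * b2 C * e0 + 8 * b4 C"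
  note ab = kernel_two_torsion[OF p2 ker[unfolded Rxy(1)] rat tors, folded a_def b_def]
  define m where "m = (y - f0) / (x - e0)"
  have m: "m * (x - e0) = y - f0" using xe by (simp add: m_def)
  have y: "y = f0 + m * (x - e0)" using m by simp
  define x' where "x' = conj x"
  define y' where "y' = conj y"
  have "third_point C m x y e0 = Affine x' y'"
    using sum add_point_chord[OF xe m, of C] by (simp add: G_simps P Rxy P'_def x'_def y'_def)
  then have x': "x' = m ^ 2 + a1 C * m - a2 C - x - e0" and y': "y' = - (m + a1 C) * x' - (y - m * x) - a3 C"
    by (rule third_point_eqD)+
  \<comment> \<open>In the model \<open>y^2 = x (x^2 + 2 a x + b)\<close>, with \<open>R\<close> at
    the origin, \<open>\<mu>\<close> is the quotient \<open>y / x\<close> at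
    \<open>P\<close>.\<close>
  define \<mu> where "\<mu> = 2 * m + a1 C"
  define \<delta> where "\<delta> = 4 * (x - x')"
  have K': "x' \<in> K" "y' \<in> K" using K by (simp_all add: x'_def y'_def)
  have mK: "m \<in> K" using K Rxy by (simp add: m_def)
  have cm: "conj m = (y' - f0) / (x' - e0)"
  proof -
    have "conj e0 = e0" "conj f0 = f0" using Rxy(2,3) rat conj_eq_self_iff by blast+
    then show ?thesis using K Rxy(2,3) by (simp add: m_def conj_divide conj_diff x'_def y'_def)
  qed
  have xe': "x' \<noteq> e0" using xe conj_conj[OF K(1)] rat conj_eq_self_iff[OF Rxy(2)] by (metis x'_def)
  have "conj m = - m - a1 C"
  proof -
    have "y' - f0 = (- m - a1 C) * (x' - e0) - (2 * f0 + a1 C * e0 + a3 C)"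
      unfolding y' unfolding y by (simp add: algebra_simps)
    then have "y' - f0 = (- m - a1 C) * (x' - e0)" unfolding tors by simp
    then show ?thesis unfolding cm using xe' by (simp add: divide_eq_eq)
  qed
  then have \<mu>: "\<mu> \<in> K" "conj \<mu> = - \<mu>"
    using mK conj_of_rat[of 2] by (simp_all add: \<mu>_def conj_add conj_mult)
  have \<delta>: "\<delta> \<in> K" "conj \<delta> = - \<delta>"
    using K K' conj_of_rat[of 4] conj_conj[OF K(1)] by (simp_all add: \<delta>_def conj_diff conj_mult x'_def)
  define h where "h = 4 * (x - e0)"
  have a2: "2 * a = 12 * e0 + b2 C" by (simp add: a_def)
  \<comment> \<open>In that model \<open>h\<close> is the abscissa of \<open>P\<close>, and
    translation by \<open>R\<close> sends it to \<open>b / h\<close>. The two abscissae have sum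
    \<open>\<mu> ^ 2 - 2 * a\<close> and product \<open>b\<close>, so the square of their difference
    is \<open>(\<mu> ^ 2 - 2 * a) ^ 2 - 4 * b\<close>.\<close>
  have s1: "4 * (x' - e0) = \<mu> ^ 2 - 2 * a - h"
    unfolding a2 x' \<mu>_def h_def b2_def by (simp add: ring_expand)
  have cub: "h * (\<mu> ^ 2 * h - h ^ 2 - 2 * a * h - b) = 0"
  proof -
    have "h * (\<mu> ^ 2 * h - h ^ 2 - 2 * a * h - b) =
       64 * ((y ^ 2 + a1 C * x * y + a3 C * y) - (x ^ 3 + a2 C * x ^ 2 + a4 C * x + a6 C))
       - 64 * ((f0 ^ 2 + a1 C * e0 * f0 + a3 C * f0) - (e0 ^ 3 + a2 C * e0 ^ 2 + a4 C * e0 + a6 C))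
       - 64 * m * (x - e0) * (2 * f0 + a1 C * e0 + a3 C) - 32 * a1 C * (x - e0) * (2 * f0 + a1 C * e0 + a3 C)"
      unfolding a2 y h_def \<mu>_def b_def b2_def b4_def by (simp add: ring_expand)
    also have "\<dots> = 0" using on onR tors unfolding P by simp
    finally show ?thesis .
  qed
  moreover have "h \<noteq> 0" using xe by (simp add: h_def)
  ultimately have hb: "\<mu> ^ 2 * h - h ^ 2 - 2 * a * h - b = 0" by simp
  have deq: "\<delta> = 2 * h - (\<mu> ^ 2 - 2 * a)"
    using s1 by (simp add: \<delta>_def h_def algebra_simps)
  have "\<delta> ^ 2 = \<mu> ^ 4 - 4 * a * \<mu> ^ 2 + (4 * a ^ 2 - 4 * b) - 4 * (\<mu> ^ 2 * h - h ^ 2 - 2 * a * h - b)"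
    unfolding deq by (simp add: ring_expand)
  then have "\<delta> ^ 2 = \<mu> ^ 4 - 4 * a * \<mu> ^ 2 + (4 * a ^ 2 - 4 * b)" unfolding hb by simp
  moreover have "4 * a ^ 2 - 4 * b \<in> \<rat>" using ab by auto
  ultimately show False using no_descent[OF p2 \<mu> \<delta> ab(1,3)] ab(4,5) by blast
qed

end

section \<open>Powers of points and changes of the model\<close>

lemma points_over_ops [simp]:
  "\<one>\<^bsub>points_over W F\<^esub> = Infinity"
  "P \<otimes>\<^bsub>points_over W F\<^esub> Q = add_point (map_weierstrass of_rat W) P Q"
  by (simp_all add: points_over_def)

lemma points_over_pow_cong: "P [^]\<^bsub>points_over W F\<^esub> (n::nat) = P [^]\<^bsub>points_over W F'\<^esub> n"
  by (induction n) simp_all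

lemma on_curve_pow:
  "on_curve (map_weierstrass of_rat W) P \<Longrightarrow> on_curve (map_weierstrass of_rat W) (P [^]\<^bsub>points_over W F\<^esub> (n::nat))"
  by (induction n) (simp_all add: on_curve_add)

lemma change_vars_map:
  "map_weierstrass of_rat (change_vars u r s t W) =
    (change_vars (of_rat u) (of_rat r) (of_rat s) (of_rat t) (map_weierstrass of_rat W) :: 'a::field_char_0 weierstrass)"
  by (simp add: change_vars_def weierstrass.map_sel of_rat_add of_rat_diff of_rat_mult of_rat_power of_rat_divide)

lemma disc_change_vars:
  fixes W :: "'a::field_char_0 weierstrass"
  shows "disc (change_vars 1 r s t W) = disc W"
proof -
  let ?W = "change_vars 1 r s t W"
  have b2: "b2 ?W = b2 W + 12 * r"
    unfolding change_vars_def b2_def by (simp add: ring_expand)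
  have b4: "b4 ?W = b4 W + r * b2 W + 6 * r ^ 2"
    unfolding change_vars_def b2_def b4_def by (simp add: ring_expand)
  have b6: "b6 ?W = b6 W + 2 * r * b4 W + r ^ 2 * b2 W + 4 * r ^ 3"
    unfolding change_vars_def b2_def b4_def b6_def by (simp add: ring_expand)
  have "4 * disc ?W = 4 * disc W"
    unfolding four_disc b2 b4 b6 by (simp add: ring_expand)
  then show ?thesis by simp
qed

section \<open>Torsion points over ramified quadratic fields\<close>

context ramified_prime
begin

text \<open>A form of the conclusion that can be transported along rational changes of variables, so
  that it may be proved for a good model.\<close>

definition torsion_rational :: "rat weierstrass \<Rightarrow> bool" where
  "torsion_rational W \<longleftrightarrow> (\<forall>P n. on_curve (map_weierstrass of_rat W) P \<longrightarrow> set_point P \<subseteq> K \<longrightarrow> n > 0 \<longrightarrow>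
     P [^]\<^bsub>points_over W UNIV\<^esub> (n::nat) = Infinity \<longrightarrow> set_point P \<subseteq> \<rat>)"

lemma torsion_rational_change_vars:
  assumes u: "u \<noteq> 0" and W: "torsion_rational (change_vars u r q t W)"
  shows "torsion_rational W"
  unfolding torsion_rational_def
proof (intro allI impI)
  fix P and n :: nat
  let ?C = "map_weierstrass complex_of_rat W"
  let ?f = "change_point (complex_of_rat u) (of_rat r) (of_rat q) (of_rat t)"
  assume P: "on_curve ?C P" "set_point P \<subseteq> K" "n > 0" "P [^]\<^bsub>points_over W UNIV\<^esub> n = Infinity"
  have u': "complex_of_rat u \<noteq> 0" using u by simp
  have "?f (P [^]\<^bsub>points_over W UNIV\<^esub> k) = ?f P [^]\<^bsub>points_over (change_vars u r q t W) UNIV\<^esub> k" for k :: nat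
  proof (induction k)
    case (Suc k)
    show ?case
      using add_point_change[OF u' on_curve_pow[OF P(1)] P(1)]
      by (simp add: change_vars_map Suc.IH[symmetric])
  qed simp
  from this[of n] have "?f P [^]\<^bsub>points_over (change_vars u r q t W) UNIV\<^esub> n = Infinity" using P(4) by simp
  moreover have "on_curve (map_weierstrass of_rat (change_vars u r q t W)) (?f P)"
    unfolding change_vars_map on_curve_change_iff[OF u'] by (rule P)
  moreover have "set_point (?f P) \<subseteq> K" using P(2) by (cases P) auto
  ultimately have rat: "set_point (?f P) \<subseteq> \<rat>" using W P(3) unfolding torsion_rational_def by blast
  show "set_point P \<subseteq> \<rat>"
  proof (cases P)
    case (Affine x y)
    define x' where "x' = (x - of_rat r) / of_rat u ^ 2"
    define y' where "y' = (y - of_rat q * (x - of_rat r) - of_rat t) / of_rat u ^ 3"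
    have r: "x' \<in> \<rat>" "y' \<in> \<rat>" using rat by (simp_all add: Affine x'_def y'_def)
    have "x = of_rat u ^ 2 * x' + of_rat r" using u' by (simp add: x'_def)
    moreover from this have "y = of_rat u ^ 3 * y' + of_rat q * (x - of_rat r) + of_rat t" using u' by (simp add: y'_def)
    ultimately show ?thesis using r Affine by simp
  qed simp
qed

end

section \<open>Torsion points at the prime 2\<close>

context ramified_curve
begin

lemma conj_pow:
  assumes P: "on_curve C P" "set_point P \<subseteq> K"
  shows "map_point conj (P [^]\<^bsub>G\<^esub> (n::nat)) = map_point conj P [^]\<^bsub>G\<^esub> n \<and> set_point (P [^]\<^bsub>G\<^esub> n) \<subseteq> K"
proof (induction n)
  case 0
  then show ?case by (simp add: G_simps)
next
  case (Suc n)
  have "on_curve C (P [^]\<^bsub>G\<^esub> n)" using G.nat_pow_closed[of P n] P by (simp add: G_simps)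
  then show ?case
    using conj_add_point[OF _ P(1) _ P(2), of "P [^]\<^bsub>G\<^esub> n"] set_point_add[OF _ P(1) _ P(2), of "P [^]\<^bsub>G\<^esub> n"] Suc
    by (simp add: G_simps)
qed

lemma minus_conj_pow:
  assumes P: "on_curve C P" "set_point P \<subseteq> K" and "P [^]\<^bsub>G\<^esub> (n::nat) = Infinity"
  shows "add_point C P (neg_point C (map_point conj P)) [^]\<^bsub>G\<^esub> n = Infinity"
proof -
  have on': "on_curve C (map_point conj P)" by (rule on_curve_conj[OF P])
  have car: "P \<in> carrier G" "map_point conj P \<in> carrier G" using P on' by (simp_all add: G_simps)
  have Pn: "P [^]\<^bsub>G\<^esub> n = \<one>\<^bsub>G\<^esub>" using assms(3) by (simp add: G_simps)
  have "map_point conj P [^]\<^bsub>G\<^esub> n = \<one>\<^bsub>G\<^esub>" using conj_pow[OF P, of n] assms(3) by (simp add: G_simps)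
  then have "(P \<otimes>\<^bsub>G\<^esub> inv\<^bsub>G\<^esub> (map_point conj P)) [^]\<^bsub>G\<^esub> n = \<one>\<^bsub>G\<^esub>"
    using car Pn by (simp add: G.nat_pow_distrib G.nat_pow_inv)
  then show ?thesis using G_inv[OF on'] by (simp add: G_simps)
qed

lemma torsion_rational_iff:
  "torsion_rational W \<longleftrightarrow> (\<forall>P n. on_curve C P \<longrightarrow> set_point P \<subseteq> K \<longrightarrow> n > 0 \<longrightarrow>
     P [^]\<^bsub>G\<^esub> (n::nat) = Infinity \<longrightarrow> map_point conj P = P)"
proof -
  have "map_point conj P = P \<longleftrightarrow> set_point P \<subseteq> \<rat>" if "set_point P \<subseteq> K" for P
    using that conj_eq_self_iff by (cases P) auto
  then show ?thesis unfolding torsion_rational_def C_def[symmetric] G_def[symmetric] by blast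
qed

text \<open>Repeated doubling strictly lowers \<open>w x\<close> and never reaches
  \<open>Infinity\<close>, since the order is odd. By the theorem of Euler, however, the multiple by
  \<open>2 ^ totient m\<close> is \<open>R\<close> again.\<close>

lemma odd_torsion_not_in_kernel:
  assumes p2: "p = 2" and R: "R \<in> kernel" and m: "odd m" "R [^]\<^bsub>G\<^esub> (m::nat) = Infinity"
  shows False
proof -
  have Rc: "R \<in> carrier G" by (rule kernel_carrier[OF R])
  obtain x y where Rxy: "R = Affine x y" using R by (auto simp: kernel_def)
  have ne: "R [^]\<^bsub>G\<^esub> ((2::nat) ^ i) \<noteq> Infinity" for i
  proof
    assume "R [^]\<^bsub>G\<^esub> ((2::nat) ^ i) = Infinity"
    then have "G.ord R dvd 2 ^ i" "G.ord R dvd m"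
      using G.pow_eq_id[OF Rc] m(2) by (simp_all add: G_simps)
    moreover have "coprime (2 ^ i) m" using m(1) by simp
    ultimately have "G.ord R = 1" by (metis coprime_common_divisor_nat)
    then have "R = Infinity" using G.ord_eq_1[OF Rc] by (simp add: G_simps)
    then show False by (simp add: Rxy)
  qed
  have chain: "\<exists>x' y'. R [^]\<^bsub>G\<^esub> ((2::nat) ^ i) = Affine x' y' \<and> Affine x' y' \<in> kernel \<and> w x' \<le> w x - int i" for i
  proof (induction i)
    case 0
    then show ?case using R Rxy Rc by (simp add: G_simps)
  next
    case (Suc i)
    then obtain x' y' where i: "R [^]\<^bsub>G\<^esub> ((2::nat) ^ i) = Affine x' y'" "Affine x' y' \<in> kernel" "w x' \<le> w x - int i"
      by blast
    have "R [^]\<^bsub>G\<^esub> ((2::nat) ^ Suc i) = R [^]\<^bsub>G\<^esub> ((2::nat) ^ i) \<otimes>\<^bsub>G\<^esub> R [^]\<^bsub>G\<^esub> ((2::nat) ^ i)"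
      using G.nat_pow_mult[OF Rc] by (simp add: mult_2)
    then have *: "R [^]\<^bsub>G\<^esub> ((2::nat) ^ Suc i) = add_point C (Affine x' y') (Affine x' y')"
      by (simp add: i(1) G_simps)
    have "add_point C (Affine x' y') (Affine x' y') \<noteq> Infinity" using ne[of "Suc i"] * by metis
    from double_kernel[OF p2 i(2) this] obtain x3 y3 where
      "add_point C (Affine x' y') (Affine x' y') = Affine x3 y3" "Affine x3 y3 \<in> kernel" "w x3 < w x'" by blast
    then show ?case using * i(3) by (intro exI[of _ x3] exI[of _ y3]) auto
  qed
  have "m > 0" using m(1) by (cases m) auto
  then have tot: "totient m > 0" by simp
  have "coprime 2 m" using m(1) by simp
  then have "[2 ^ totient m = 1] (mod m)" by (rule euler_theorem)
  then obtain k where k: "2 ^ totient m = 1 + m * k"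
    using cong_to_1'_nat by (metis One_nat_def add.commute mult.commute not_less_eq power_eq_0_iff zero_neq_numeral)
  have "R [^]\<^bsub>G\<^esub> ((2::nat) ^ totient m) = R"
    unfolding k using Rc m(2) by (simp add: G.nat_pow_mult[symmetric] G.nat_pow_pow[symmetric] G_simps(2)[symmetric])
  then show False using chain[of "totient m"] tot by (simp add: Rxy)
qed

text \<open>Induction on the power of 2 in an annihilating number: \<open>2 P\<close> is fixed by
  induction, and \<open>no_half_point\<close> passes to \<open>P\<close>. In the odd case a nonzero
  \<open>P - conj P\<close> would be odd torsion in the kernel.\<close>

lemma torsion_rational_two:
  assumes p2: "p = 2"
  shows "torsion_rational W"
proof -
  have "map_point conj P = P" if "odd m" "on_curve C P" "set_point P \<subseteq> K" "P [^]\<^bsub>G\<^esub> (2 ^ k * m) = Infinity"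
    for P and k m :: nat
    using that
  proof (induction k arbitrary: P)
    case 0
    show ?case
    proof (rule ccontr)
      assume ne: "map_point conj P \<noteq> P"
      then obtain x y where P: "P = Affine x y" by (cases P) auto
      have "add_point C P (neg_point C (map_point conj P)) \<in> kernel"
        unfolding P by (rule minus_conj_in_kernel) (use 0 ne p2 P in auto)
      moreover have "add_point C P (neg_point C (map_point conj P)) [^]\<^bsub>G\<^esub> m = Infinity"
        by (rule minus_conj_pow) (use 0 in auto)
      ultimately show False using odd_torsion_not_in_kernel[OF p2 _ \<open>odd m\<close>] by blast
    qed
  next
    case (Suc k)
    have car: "P \<in> carrier G" using Suc.prems by (simp add: G_simps)
    have PP: "P [^]\<^bsub>G\<^esub> (2::nat) = add_point C P P" using car by (simp add: numeral_2_eq_2 G_simps)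
    have "(P [^]\<^bsub>G\<^esub> (2::nat)) [^]\<^bsub>G\<^esub> (2 ^ k * m) = Infinity"
      using Suc.prems(4) G.nat_pow_pow[OF car, of 2 "2 ^ k * m"] by (simp add: mult.assoc)
    then have "map_point conj (add_point C P P) = add_point C P P"
      unfolding PP using Suc by (intro Suc.IH on_curve_add set_point_add) auto
    then show ?case using no_half_point[OF p2 Suc.prems(2,3)] by blast
  qed
  moreover have "\<exists>k m. odd m \<and> n = 2 ^ k * m" if "n > 0" for n :: nat
    using that by (metis bot_nat_0.not_eq_extremum multiplicity_decompose' not_prime_unit prime_nat_iff' two_is_prime_nat)
  ultimately show ?thesis unfolding torsion_rational_iff by metis
qed

end

section \<open>Torsion points at primes from 5 on\<close>

context short_ramified_curve
begin

lemma torsion_rational_short: "torsion_rational W"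
  unfolding torsion_rational_iff
proof (intro allI impI)
  fix P and n :: nat
  assume P: "on_curve C P" "set_point P \<subseteq> K" "n > 0" "P [^]\<^bsub>G\<^esub> n = Infinity"
  show "map_point conj P = P"
  proof (rule ccontr)
    assume ne: "map_point conj P \<noteq> P"
    then obtain x y where Pxy: "P = Affine x y" by (cases P) auto
    show False
    proof (cases "x \<in> V 0")
      case True
      have "add_point C P (neg_point C (map_point conj P)) \<in> kernel"
        unfolding Pxy by (rule minus_conj_in_kernel) (use P ne Pxy True in auto)
      then show False using kernel_torsion_free[OF _ P(3) minus_conj_pow[OF P(1,2,4)]] by blast
    next
      case False
      then have "P \<in> kernel" using P Pxy by (auto simp: kernel_def)
      then show False using kernel_torsion_free P(3,4) by blast
    qed
  qed
qed

end

context ramified_curve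
begin

lemma torsion_rational_large:
  assumes p5: "p \<ge> 5"
  shows "torsion_rational W"
proof -
  \<comment> \<open>The substitution completing the square (\<open>q\<close>, \<open>t\<close>) and
    the cube (\<open>r\<close>). It is integral because 2 and 3 are units, and with
    \<open>u = 1\<close> it keeps the discriminant.\<close>
  define r where "r = - (b2 W / 12)"
  define q where "q = - (a1 W / 2)"
  define t where "t = - ((a3 W + r * a1 W) / 2)"
  define W' where "W' = change_vars 1 r q t W"
  have unit: "w (of_nat k) = 0" if "k \<in> {2, 3}" for k :: nat
  proof -
    have "\<not> p dvd k" using that p5 by (auto dest!: dvd_imp_le)
    then have "multiplicity (int p) (int k) = 0" by (intro not_dvd_imp_multiplicity_0) simp
    then show ?thesis using w_of_nat[of k] that by auto
  qed
  have w2: "w 2 = 0" "w 3 = 0" using unit[of 2] unit[of 3] by simp_all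
  have w12: "w 12 = 0" using w_mult[of 2 2] w_mult[of 4 3] w2 by simp
  have half: "x / 2 \<in> V 0" and twelfth: "x / 12 \<in> V 0" if "x \<in> V 0" for x
    using that w2 w12 by (auto intro!: V_divide[OF that])
  have "of_rat r = - ((a1 C ^ 2 + 4 * a2 C) / 12)"
    by (simp add: r_def b2_def C_sel of_rat_minus of_rat_divide of_rat_add of_rat_mult of_rat_power)
  then have rV: "of_rat r \<in> V 0"
    using twelfth[of "a1 C ^ 2 + 4 * a2 C"] by (simp only: V_uminus) (simp add: V_add V_power V_mult0)
  have "of_rat q = - (a1 C / 2)" by (simp add: q_def C_sel of_rat_minus of_rat_divide)
  then have qV: "of_rat q \<in> V 0" using half[of "a1 C"] by (simp only: V_uminus) simp
  have "of_rat t = - ((a3 C + of_rat r * a1 C) / 2)"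
    by (simp add: t_def C_sel of_rat_minus of_rat_divide of_rat_add of_rat_mult)
  then have tV: "of_rat t \<in> V 0"
    using half[of "a3 C + of_rat r * a1 C"] rV by (simp only: V_uminus) (simp add: V_add V_mult0)
  have a1': "a1 W' = 0" and a3': "a3 W' = 0"
    by (simp_all add: W'_def change_vars_def q_def t_def)
  have a2': "a2 W' = 0"
  proof -
    have a1: "a1 W = - 2 * q" by (simp add: q_def)
    have "12 * r = - (4 * q ^ 2 + 4 * a2 W)" 
    proof -
      have "12 * r = - b2 W" by (simp add: r_def)
      then show ?thesis by (simp add: b2_def a1 power_mult_distrib)
    qed
    moreover have "4 * a2 W' = 4 * a2 W + 4 * q ^ 2 + 12 * r"
      unfolding W'_def change_vars_def weierstrass.sel a1 by (simp add: ring_expand)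
    ultimately show ?thesis by simp
  qed
  have mC: "map_weierstrass of_rat W' = change_vars 1 (of_rat r) (of_rat q) (of_rat t) C"
    unfolding W'_def change_vars_map C_def by simp
  have "of_rat (a4 W') = a4 (change_vars 1 (of_rat r) (of_rat q) (of_rat t) C)"
    "of_rat (a6 W') = a6 (change_vars 1 (of_rat r) (of_rat q) (of_rat t) C)"
    unfolding mC[symmetric] by (simp_all add: weierstrass.map_sel)
  moreover have "a4 (change_vars 1 (of_rat r) (of_rat q) (of_rat t) C) \<in> V 0"
    "a6 (change_vars 1 (of_rat r) (of_rat q) (of_rat t) C) \<in> V 0"
    unfolding change_vars_def weierstrass.sel power_one div_by_1
    by (intro V_add V_diff V_mult0 V_power rV qV tV C_V V_numeral)+
  ultimately have a46: "of_rat (a4 W') \<in> V 0" "of_rat (a6 W') \<in> V 0" by simp_all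
  have int: "p_integral p a" if "of_rat a \<in> V 0" for a
    using that unfolding V_of_rat p_integral_iff[OF prime_p] by auto
  have disc: "disc W' = disc W" unfolding W'_def by (rule disc_change_vars)
  interpret W': short_ramified_curve p d W'
  proof
    fix a assume "a \<in> set_weierstrass W'"
    then have "a \<in> {a1 W', a2 W', a3 W', a4 W', a6 W'}" by (cases W') auto
    then have "a = 0 \<or> a = a4 W' \<or> a = a6 W'" using a1' a2' a3' by auto
    then show "p_integral p a" using int[of a] a46 by auto
  qed (use disc disc_nonzero disc_unit a1' a2' a3' p5 in auto)
  have "torsion_rational W'" by (rule W'.torsion_rational_short)
  then show ?thesis unfolding W'_def by (rule torsion_rational_change_vars[rotated]) simp
qed

end

section \<open>From a good model to the given equation\<close>

context ramified_prime
begin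

lemma torsion_rational_good_reduction:
  assumes good: "good_reduction p W" and p3: "p \<noteq> 3"
  shows "torsion_rational W"
proof -
  from good obtain W' where W': "minimal_model p W W'" "\<not> zero_mod p (disc W')"
    by (auto simp: good_reduction_def)
  then obtain u r q t where u: "u \<noteq> 0" and eq: "W' = change_vars u r q t W"
    and int: "\<And>a. a \<in> set_weierstrass W' \<Longrightarrow> p_integral p a"
    by (auto simp: minimal_model_def p_integral_model_def isomorphic_def)
  have nz: "disc W' \<noteq> 0" using W'(2) by (auto simp: zero_mod_def)
  have intV: "of_rat a \<in> V 0" if "a \<in> set_weierstrass W'" for a
    using int[OF that] by (auto simp: V_of_rat p_integral_iff[OF prime_p])
  let ?C = "map_weierstrass complex_of_rat W'"
  have CV: "a1 ?C \<in> V 0" "a2 ?C \<in> V 0" "a3 ?C \<in> V 0" "a4 ?C \<in> V 0" "a6 ?C \<in> V 0"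
    unfolding weierstrass.map_sel by (rule intV; cases W'; simp)+
  have bV: "b2 ?C \<in> V 0" "b4 ?C \<in> V 0" "b6 ?C \<in> V 0" "b8 ?C \<in> V 0"
    unfolding b2_def b4_def b6_def b8_def by (intro V_add V_diff V_mult0 V_power CV V_numeral)+
  have "disc ?C = 9 * b2 ?C * b4 ?C * b6 ?C - b2 ?C ^ 2 * b8 ?C - 8 * b4 ?C ^ 3 - 27 * b6 ?C ^ 2"
    unfolding disc_def by (simp add: algebra_simps)
  also have "\<dots> \<in> V 0" by (intro V_diff V_mult0 V_power bV V_numeral)
  finally have "disc ?C \<in> V 0" .
  then have ge: "vq p (disc W') \<ge> 0" using nz unfolding disc_map V_of_rat by simp
  \<comment> \<open>\<open>zero_mod\<close> inspects only the numerator and so bounds the valuation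
    from above; the bound from below came from the integral coefficients.\<close>
  have "vq p (disc W') \<le> 0"
    using W'(2) by (simp add: zero_mod_def vq_def not_dvd_imp_multiplicity_0)
  with ge have v0: "vq p (disc W') = 0" by simp
  interpret W': ramified_curve p d W'
    by unfold_locales (use int nz v0 in auto)
  have "p = 2 \<or> p \<ge> 5"
  proof -
    have "p \<noteq> 4"
    proof
      assume "p = 4"
      then have "Factorial_Ring.prime (2 * 2 :: nat)" using prime_p by simp
      then show False using prime_product[of 2 "2::nat"] by simp
    qed
    then show ?thesis using prime_gt_1_nat[OF prime_p] p3 by linarith
  qed
  then have "torsion_rational W'" using W'.torsion_rational_two W'.torsion_rational_large by blast
  then show ?thesis unfolding eq by (rule torsion_rational_change_vars[OF u])
qed

lemma E_tors_quadratic_field: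
  assumes "torsion_rational W"
  shows "E_tors W \<rat> = E_tors W (quadratic_field d)"
proof
  have "\<rat> \<subseteq> quadratic_field d" unfolding quadratic_field_def by (rule Rats_subset_rat_adjoin)
  then show "E_tors W \<rat> \<subseteq> E_tors W (quadratic_field d)"
    unfolding E_tors_def torsion_def using points_over_pow_cong[where W = W and F = "\<rat>" and F' = "quadratic_field d"]
    by (auto simp: points_over_def)
  show "E_tors W (quadratic_field d) \<subseteq> E_tors W \<rat>"
  proof
    fix P assume "P \<in> E_tors W (quadratic_field d)"
    then obtain n :: nat where P: "on_curve (map_weierstrass of_rat W) P" "set_point P \<subseteq> quadratic_field d"
      "n > 0" "P [^]\<^bsub>points_over W (quadratic_field d)\<^esub> n = Infinity"
      by (auto simp: E_tors_def torsion_def points_over_def)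
    have "set_point P \<subseteq> \<rat>"
      using assms P quadratic_field_subset points_over_pow_cong[where P = P and W = W and n = n and F = "quadratic_field d" and F' = UNIV]
      unfolding torsion_rational_def by (metis subset_trans)
    moreover have "P [^]\<^bsub>points_over W \<rat>\<^esub> n = Infinity"
      using P(4) points_over_pow_cong[where P = P and W = W and n = n and F = "quadratic_field d" and F' = "\<rat>"] by simp
    ultimately show "P \<in> E_tors W \<rat>"
      using P(1,3) by (auto simp: E_tors_def torsion_def points_over_def)
  qed
qed

end

section \<open>Primes dividing the conductor\<close>

text \<open>For a discriminant that is nonzero modulo \<open>p\<close>, \<open>p_val\<close> is 0,
  the least natural number, so minimality is automatic.\<close>

lemma good_reduction_self:
  assumes "\<And>a. a \<in> set_weierstrass E \<Longrightarrow> p_integral p a" "\<not> zero_mod p (disc E)"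
  shows "good_reduction p E"
proof -
  have "isomorphic E E"
    unfolding isomorphic_def
    by (rule exI[of _ 1], rule exI[of _ 0], rule exI[of _ 0], rule exI[of _ 0]) (cases E; simp add: change_vars_def)
  then have "minimal_model p E E"
    using assms by (simp add: minimal_model_def p_integral_model_def p_val_def zero_mod_def not_dvd_imp_multiplicity_0)
  then show ?thesis using assms(2) by (auto simp: good_reduction_def)
qed

lemma conductor_exponent_eq_0_iff: "conductor_exponent p E = 0 \<longleftrightarrow> good_reduction p E"
  by (simp add: conductor_exponent_def)

text \<open>Over an infinite index set the product in \<open>conductor\<close> would be 1 by
  convention; finiteness is what lets a bad prime divide it. At a prime not dividing
  \<open>M\<close> the given equation is itself a good model.\<close>

lemma finite_bad_reduction:
  assumes "elliptic E"
  shows "finite {p. Factorial_Ring.prime p \<and> \<not> good_reduction p E}"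
proof -
  define M where "M = fst (quotient_of (disc E)) * (\<Prod>a\<in>set_weierstrass E. snd (quotient_of a))"
  have fin: "finite (set_weierstrass E)" by (cases E) simp
  have "fst (quotient_of (disc E)) \<noteq> 0"
  proof
    assume "fst (quotient_of (disc E)) = 0"
    then have "disc E = 0" by (metis div_0 of_int_0 prod.collapse quotient_of_div)
    then show False using assms by (simp add: elliptic_def)
  qed
  moreover have "snd (quotient_of a) \<noteq> 0" for a :: rat by (metis less_irrefl prod.collapse quotient_of_denom_pos)
  ultimately have M: "M \<noteq> 0" using fin by (simp add: M_def)
  have "{p. Factorial_Ring.prime p \<and> \<not> good_reduction p E} \<subseteq> {p. p dvd nat \<bar>M\<bar>}"
  proof
    fix p assume "p \<in> {p. Factorial_Ring.prime p \<and> \<not> good_reduction p E}"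
    then have bad: "\<not> good_reduction p E" by simp
    have "int p dvd M"
    proof (rule ccontr)
      assume nd: "\<not> int p dvd M"
      have "p_integral p a" if "a \<in> set_weierstrass E" for a
        unfolding p_integral_def
      proof
        assume "int p dvd snd (quotient_of a)"
        also have "\<dots> dvd (\<Prod>a\<in>set_weierstrass E. snd (quotient_of a))"
          using dvd_prodI[OF fin that] by simp
        finally show False using nd by (simp add: M_def)
      qed
      moreover have "\<not> zero_mod p (disc E)" using nd by (auto simp: zero_mod_def M_def)
      ultimately show False using bad good_reduction_self by blast
    qed
    then show "p \<in> {p. p dvd nat \<bar>M\<bar>}" by (simp add: int_dvd_int_iff[symmetric] del: int_dvd_int_iff)
  qed
  moreover have "finite {p. p dvd nat \<bar>M\<bar>}" using M by (intro finite_divisors_nat) simp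
  ultimately show ?thesis by (rule finite_subset)
qed

lemma bad_prime_dvd_conductor:
  assumes "elliptic E" "Factorial_Ring.prime p" "\<not> good_reduction p E"
  shows "p dvd conductor E"
proof -
  let ?S = "{p. Factorial_Ring.prime p \<and> conductor_exponent p E \<noteq> 0}"
  have "finite ?S" using finite_bad_reduction[OF assms(1)] by (simp add: conductor_exponent_eq_0_iff)
  moreover have "p \<in> ?S" using assms by (simp add: conductor_exponent_eq_0_iff)
  ultimately have "p ^ conductor_exponent p E dvd conductor E"
    unfolding conductor_def by (rule dvd_prodI)
  moreover have "conductor_exponent p E \<noteq> 0" using assms(3) by (simp add: conductor_exponent_eq_0_iff)
  then have "p dvd p ^ conductor_exponent p E" by (intro dvd_power) auto
  ultimately show ?thesis by (rule dvd_trans[rotated])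
qed

theorem theorem6p1:
  fixes E :: "rat weierstrass" and d :: int and p :: nat
  assumes "elliptic E"
    and "squarefree d" and "d \<noteq> 1"
    and "E_tors E \<rat> \<noteq> E_tors E (quadratic_field d)"
    and "Factorial_Ring.prime p" and "int p dvd d"
  shows "p dvd conductor E \<or> p = 3"
proof (rule ccontr)
  assume *: "\<not> (p dvd conductor E \<or> p = 3)"
  interpret ramified_prime p d
    using assms by unfold_locales
  have "good_reduction p E" using bad_prime_dvd_conductor[OF assms(1,5)] * by blast
  then have "torsion_rational E" using torsion_rational_good_reduction * by blast
  then show False using E_tors_quadratic_field assms(4) by blast
qed

end
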